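(* Let $\Gamma$ be a countably infinite discrete sofic group with sofic approximation $\Sigma$. Let $\Gamma\curvearrowright (X,\mathcal{M},\mu)$ be a measure-preserving action, where $(X,\mathcal{M},\mu)$ is a standard probability space. Suppose that $\mathcal{H}\subseteq L^{2}(X,\mu)$ is a closed, $\Gamma$-invariant, linear subspace such that $\mathcal{M}$ is generated as a $\sigma$-algebra (up to sets of measure zero) by $$\{f^{-1}(A): f\in\mathcal{H},\ A\subseteq\mathbb{C}\text{ Borel}\}.$$ If the restriction to $\mathcal{H}$ of the unitary representation $\rho_{\Gamma\curvearrowright(X,\mu)}$ of $\Gamma$ on $L^{2}(X,\mu)$ is singular with respect to the left regular representation $\lambda_\Gamma$, then $$h_{\Sigma,\mu}(X,\Gamma)\leq 0.$$
   Context: Representations. $\rho_{\Gamma\curvearrowright (X,\mu)}\colon\Gamma\to\mathcal{U}(L^2(X,\mu))$ is $(\rho_{\Gamma\curvearrowright (X,\mu)}(g)\xi)(x)=\xi(g^{-1}x)$, and $\lambda_\Gamma\colon\Gamma\to\mathcal{U}(\ell^2(\Gamma))$ is $(\lambda_\Gamma(g)f)(x)=f(g^{-1}x)$. A subrepresentation is the restriction to a closed $\Gamma$-invariant linear subspace. Two unitary representations $\rho_1,\rho_2$ of $\Gamma$ are singular, written $\rho_1\perp\rho_2$, if no nonzero subrepresentation of $\rho_1$ embeds into $\rho_2$. Sofic approximations. $u_d$ is the uniform probability measure on $\{1,\dots,d\}$ and $S_d$ is the symmetric group. A sofic approximation of a countable discrete group $\Gamma$ is a sequence $\Sigma=(\sigma_i\colon\Gamma\to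 S_{d_i})$ of functions (not assumed homomorphisms) such that $u_{d_i}(\{k:\sigma_i(g)\sigma_i(h)(k)=\sigma_i(gh)(k)\})\to1$ for all $g,h\in\Gamma$ and $u_{d_i}(\{k:\sigma_i(g)(k)\neq\sigma_i(h)(k)\})\to1$ for all $g\neq h$ in $\Gamma$. $\Gamma$ is sofic if it has a sofic approximation. Sofic measure entropy (Bowen, Kerr–Li; in Kerr's formulation). A finite observable on $X$ is a measurable map $\alpha\colon X\to A$ with $A$ finite. A finite observable $\beta\colon X\to B$ refines $\alpha$, written $\alpha\le\beta$, if there is $\pi\colon B\to A$ with $\pi(\beta(x))=\alpha(x)$ for a.e. $x$. For finite $F\subseteq\Gamma$, let $\widetilde{\beta}^{F}\colon X\to B^F$, $\widetilde\beta^F(x)(g)=\beta(g^{-1}x)$. For finite $F\subseteq \Gamma$ containing the identity $e$, $\delta>0$ and $\sigma\colon\Gamma\to S_d$, let $\mathrm{AP}(\beta,F,\delta,\sigma)$ be the set of all $\phi\colon\{1,\dots,d\}\to B^F$ with $$\sum_{b\in B^F}\left|u_d(\phi^{-1}(\{b\}))-\mu((\widetilde\beta^F)^{-1}(\{b\}))\right|<\delta,\qquad u_d(\{j:\phi(j)(g)\neq\phi(\sigma(g)^{-1}(j))(e)\})<\delta\ \text{ for all } g\in F.$$ Let $\pi^*\colon B^F\to A$, $\pi^*(b)=\pi(b(e))$. With $\log 0=-\infty$, put $$h_{\Sigma,\mu}(\alpha;\beta,F,\delta)=\limsup_{i\to\infty}\frac1{d_i}\log\left|\{\pi^*\circ\phi:\phi\in\mathrm{AP}(\beta,F,\delta,\sigma_i)\}\right|,\qquad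 h_{\Sigma,\mu}(\alpha;\beta)=\inf_{F,\delta}h_{\Sigma,\mu}(\alpha;\beta,F,\delta),$$ and $h_{\Sigma,\mu}(X,\Gamma)=\sup_\alpha\inf_{\beta\ge\alpha}h_{\Sigma,\mu}(\alpha;\beta)$, over all finite observables $\alpha$ and finite observables $\beta$ refining $\alpha$. *)

theory Defs
  imports "HOL-Probability.Probability" "HOL-Algebra.Group_Action"
begin

section \<open>Standard probability spaces and measure-preserving actions\<close>

definition standard_borel :: "'x measure \<Rightarrow> bool" where
  "standard_borel N \<longleftrightarrow>
     (\<exists>T. topspace T = space N \<and> completely_metrizable_space T \<and> second_countable T \<and>
          sets N = sigma_sets (space N) {U. openin T U})"

text \<open>Both usual conventions are admitted: a Borel probability measure on a standard Borel
  space, and the completion of such a measure.\<close>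

definition standard_probability_space :: "'x measure \<Rightarrow> bool" where
  "standard_probability_space M \<longleftrightarrow>
     prob_space M \<and> (\<exists>N. standard_borel N \<and> (M = N \<or> M = completion N))"

definition measure_preserving_action ::
    "('g, 'z) monoid_scheme \<Rightarrow> 'x measure \<Rightarrow> ('g \<Rightarrow> 'x \<Rightarrow> 'x) \<Rightarrow> bool" where
  "measure_preserving_action G M a \<longleftrightarrow>
     group_action G (space M) a \<and>
     (\<forall>g\<in>carrier G. a g \<in> measurable M M \<and> distr M M (a g) = M)"

section \<open>Unitary representations on closed subspaces of \<open>L\<^sup>2\<close>\<close>

text \<open>Elements of \<open>L\<^sup>2(M)\<close> are handled through their representatives, that is, as square
  integrable functions, with the semi-norm below; values outside the space of \<open>M\<close> are
  irrelevant. In particular \<open>\<ell>\<^sup>2\<close> of a set \<open>S\<close> is \<open>L2 (count_space S)\<close>.\<close>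

definition L2 :: "'x measure \<Rightarrow> ('x \<Rightarrow> complex) set" where
  "L2 M = {f \<in> borel_measurable M. integrable M (\<lambda>x. (cmod (f x))\<^sup>2)}"

definition L2_norm :: "'x measure \<Rightarrow> ('x \<Rightarrow> complex) \<Rightarrow> real" where
  "L2_norm M f = sqrt (\<integral>x. (cmod (f x))\<^sup>2 \<partial>M)"

text \<open>The last clause makes a closed subspace contain, with a function, every measurable function
  that is almost everywhere equal to it: such a function is at semi-norm distance 0.\<close>

definition closed_subspace :: "'x measure \<Rightarrow> ('x \<Rightarrow> complex) set \<Rightarrow> bool" where
  "closed_subspace M H \<longleftrightarrow>
     H \<subseteq> L2 M \<and> (\<lambda>x. 0) \<in> H \<and>
     (\<forall>f\<in>H. \<forall>h\<in>H. (\<lambda>x. f x + h x) \<in> H) \<and>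
     (\<forall>c. \<forall>f\<in>H. (\<lambda>x. c * f x) \<in> H) \<and>
     (\<forall>f\<in>L2 M. (\<forall>\<epsilon>>0. \<exists>h\<in>H. L2_norm M (\<lambda>x. f x - h x) < \<epsilon>) \<longrightarrow> f \<in> H)"

definition invariant_subspace ::
    "('g, 'z) monoid_scheme \<Rightarrow> 'x measure \<Rightarrow> ('g \<Rightarrow> ('x \<Rightarrow> complex) \<Rightarrow> 'x \<Rightarrow> complex)
      \<Rightarrow> ('x \<Rightarrow> complex) set \<Rightarrow> bool" where
  "invariant_subspace G M \<rho> H \<longleftrightarrow>
     closed_subspace M H \<and> (\<forall>g\<in>carrier G. \<forall>f\<in>H. \<rho> g f \<in> H)"

definition koopman ::
    "('g, 'z) monoid_scheme \<Rightarrow> ('g \<Rightarrow> 'x \<Rightarrow> 'x) \<Rightarrow> 'g \<Rightarrow> ('x \<Rightarrow> complex) \<Rightarrow> 'x \<Rightarrow> complex" where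
  "koopman G a g \<xi> = (\<lambda>x. \<xi> (a (inv\<^bsub>G\<^esub> g) x))"

definition left_regular ::
    "('g, 'z) monoid_scheme \<Rightarrow> 'g \<Rightarrow> ('g \<Rightarrow> complex) \<Rightarrow> 'g \<Rightarrow> complex" where
  "left_regular G g f = (\<lambda>x. f (inv\<^bsub>G\<^esub> g \<otimes>\<^bsub>G\<^esub> x))"

text \<open>The representation \<open>\<rho>\<close> on \<open>K \<subseteq> L\<^sup>2(M)\<close> embeds into the representation \<open>\<tau>\<close> on
  \<open>L \<subseteq> L\<^sup>2(N)\<close> if there is an equivariant linear isometry \<open>T\<close>. Since \<open>T\<close> acts on
  representatives, linearity and equivariance are required almost everywhere; together with the
  isometry condition this makes \<open>T\<close> well defined on classes.\<close>

definition rep_embeds ::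
    "('g, 'z) monoid_scheme
      \<Rightarrow> 'x measure \<Rightarrow> ('g \<Rightarrow> ('x \<Rightarrow> complex) \<Rightarrow> 'x \<Rightarrow> complex) \<Rightarrow> ('x \<Rightarrow> complex) set
      \<Rightarrow> 'y measure \<Rightarrow> ('g \<Rightarrow> ('y \<Rightarrow> complex) \<Rightarrow> 'y \<Rightarrow> complex) \<Rightarrow> ('y \<Rightarrow> complex) set \<Rightarrow> bool" where
  "rep_embeds G M \<rho> K N \<tau> L \<longleftrightarrow>
     (\<exists>T. (\<forall>f\<in>K. T f \<in> L) \<and>
          (\<forall>f\<in>K. \<forall>h\<in>K. AE y in N. T (\<lambda>x. f x + h x) y = T f y + T h y) \<and>
          (\<forall>c. \<forall>f\<in>K. AE y in N. T (\<lambda>x. c * f x) y = c * T f y) \<and>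
          (\<forall>f\<in>K. L2_norm N (T f) = L2_norm M f) \<and>
          (\<forall>g\<in>carrier G. \<forall>f\<in>K. AE y in N. T (\<rho> g f) y = \<tau> g (T f) y))"

definition singular_reps ::
    "('g, 'z) monoid_scheme
      \<Rightarrow> 'x measure \<Rightarrow> ('g \<Rightarrow> ('x \<Rightarrow> complex) \<Rightarrow> 'x \<Rightarrow> complex) \<Rightarrow> ('x \<Rightarrow> complex) set
      \<Rightarrow> 'y measure \<Rightarrow> ('g \<Rightarrow> ('y \<Rightarrow> complex) \<Rightarrow> 'y \<Rightarrow> complex) \<Rightarrow> ('y \<Rightarrow> complex) set \<Rightarrow> bool" where
  "singular_reps G M \<rho> H N \<tau> L \<longleftrightarrow>
     \<not> (\<exists>K. invariant_subspace G M \<rho> K \<and> K \<subseteq> H \<and> (\<exists>f\<in>K. \<not> (AE x in M. f x = 0)) \<and>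
            rep_embeds G M \<rho> K N \<tau> L)"

definition generates_mod_null :: "'x measure \<Rightarrow> ('x \<Rightarrow> complex) set \<Rightarrow> bool" where
  "generates_mod_null M H \<longleftrightarrow>
     (\<forall>S\<in>sets M. \<exists>S'\<in>sigma_sets (space M) {f -` A \<inter> space M | f A. f \<in> H \<and> A \<in> sets borel}.
        (S - S') \<union> (S' - S) \<in> null_sets M)"

section \<open>Sofic approximations\<close>

abbreviation unif :: "nat \<Rightarrow> nat measure" where
  "unif d \<equiv> uniform_count_measure {1..d}"

definition sofic_approximation ::
    "('g, 'z) monoid_scheme \<Rightarrow> (nat \<Rightarrow> nat) \<Rightarrow> (nat \<Rightarrow> 'g \<Rightarrow> nat \<Rightarrow> nat) \<Rightarrow> bool" where
  "sofic_approximation G d \<sigma> \<longleftrightarrow>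
     (\<forall>i. d i > 0) \<and>
     (\<forall>i. \<forall>g\<in>carrier G. \<sigma> i g permutes {1..d i}) \<and>
     (\<forall>g\<in>carrier G. \<forall>h\<in>carrier G.
        (\<lambda>i. measure (unif (d i)) {k\<in>{1..d i}. \<sigma> i g (\<sigma> i h k) = \<sigma> i (g \<otimes>\<^bsub>G\<^esub> h) k})
          \<longlonglongrightarrow> 1) \<and>
     (\<forall>g\<in>carrier G. \<forall>h\<in>carrier G. g \<noteq> h \<longrightarrow>
        (\<lambda>i. measure (unif (d i)) {k\<in>{1..d i}. \<sigma> i g k \<noteq> \<sigma> i h k}) \<longlonglongrightarrow> 1)"

section \<open>Sofic measure entropy\<close>

text \<open>A finite observable is a pair of its finite set of labels and the map. Labels are natural
  numbers, which is no restriction as every finite set can be relabelled.\<close>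

definition observables :: "'x measure \<Rightarrow> (nat set \<times> ('x \<Rightarrow> nat)) set" where
  "observables M = {(A, \<alpha>). finite A \<and> \<alpha> \<in> measurable M (count_space A)}"

text \<open>Refinements carry the witness \<open>\<pi>\<close>, because \<open>\<pi>\<^sup>*\<close> below depends on it. Two
  witnesses differ only on labels whose preimage is a null set, and this does not affect the
  infimum over \<open>F\<close> and \<open>\<delta>\<close> defining \<open>entropy_rel\<close>.\<close>

definition refinements ::
    "'x measure \<Rightarrow> nat set \<Rightarrow> ('x \<Rightarrow> nat) \<Rightarrow> (nat set \<times> ('x \<Rightarrow> nat) \<times> (nat \<Rightarrow> nat)) set" where
  "refinements M A \<alpha> =
     {(B, \<beta>, \<pi>). (B, \<beta>) \<in> observables M \<and> \<pi> \<in> B \<rightarrow> A \<and> (AE x in M. \<pi> (\<beta> x) = \<alpha> x)}"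

definition observable_pattern ::
    "('g, 'z) monoid_scheme \<Rightarrow> ('g \<Rightarrow> 'x \<Rightarrow> 'x) \<Rightarrow> ('x \<Rightarrow> nat) \<Rightarrow> 'g set \<Rightarrow> 'x \<Rightarrow> 'g \<Rightarrow> nat" where
  "observable_pattern G a \<beta> F x = (\<lambda>g\<in>F. \<beta> (a (inv\<^bsub>G\<^esub> g) x))"

definition AP ::
    "('g, 'z) monoid_scheme \<Rightarrow> 'x measure \<Rightarrow> ('g \<Rightarrow> 'x \<Rightarrow> 'x) \<Rightarrow> nat set \<Rightarrow> ('x \<Rightarrow> nat)
      \<Rightarrow> 'g set \<Rightarrow> real \<Rightarrow> nat \<Rightarrow> ('g \<Rightarrow> nat \<Rightarrow> nat) \<Rightarrow> (nat \<Rightarrow> 'g \<Rightarrow> nat) set" where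
  "AP G M a B \<beta> F \<delta> d \<sigma> =
     {\<phi> \<in> {1..d} \<rightarrow>\<^sub>E (F \<rightarrow>\<^sub>E B).
        (\<Sum>b \<in> F \<rightarrow>\<^sub>E B.
           \<bar>measure (unif d) (\<phi> -` {b} \<inter> {1..d})
             - measure M (observable_pattern G a \<beta> F -` {b} \<inter> space M)\<bar>) < \<delta> \<and>
        (\<forall>g\<in>F. measure (unif d)
           {j\<in>{1..d}. \<phi> j g \<noteq> \<phi> (inv_into {1..d} (\<sigma> g) j) \<one>\<^bsub>G\<^esub>} < \<delta>)}"

definition log_count :: "nat \<Rightarrow> ereal" where
  "log_count n = (if n = 0 then -\<infinity> else ereal (ln (real n)))"

definition entropy_at ::
    "('g, 'z) monoid_scheme \<Rightarrow> (nat \<Rightarrow> nat) \<Rightarrow> (nat \<Rightarrow> 'g \<Rightarrow> nat \<Rightarrow> nat)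
      \<Rightarrow> 'x measure \<Rightarrow> ('g \<Rightarrow> 'x \<Rightarrow> 'x) \<Rightarrow> nat set \<Rightarrow> ('x \<Rightarrow> nat) \<Rightarrow> (nat \<Rightarrow> nat)
      \<Rightarrow> 'g set \<Rightarrow> real \<Rightarrow> ereal" where
  "entropy_at G d \<sigma> M a B \<beta> \<pi> F \<delta> =
     limsup (\<lambda>i. ereal (1 / real (d i)) *
       log_count (card ((\<lambda>\<phi>. \<lambda>j\<in>{1..d i}. \<pi> (\<phi> j \<one>\<^bsub>G\<^esub>)) ` AP G M a B \<beta> F \<delta> (d i) (\<sigma> i))))"

definition entropy_rel ::
    "('g, 'z) monoid_scheme \<Rightarrow> (nat \<Rightarrow> nat) \<Rightarrow> (nat \<Rightarrow> 'g \<Rightarrow> nat \<Rightarrow> nat)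
      \<Rightarrow> 'x measure \<Rightarrow> ('g \<Rightarrow> 'x \<Rightarrow> 'x) \<Rightarrow> nat set \<Rightarrow> ('x \<Rightarrow> nat) \<Rightarrow> (nat \<Rightarrow> nat) \<Rightarrow> ereal" where
  "entropy_rel G d \<sigma> M a B \<beta> \<pi> =
     (INF (F, \<delta>) \<in> {F. finite F \<and> F \<subseteq> carrier G \<and> \<one>\<^bsub>G\<^esub> \<in> F} \<times> {0<..}.
        entropy_at G d \<sigma> M a B \<beta> \<pi> F \<delta>)"

definition sofic_entropy ::
    "('g, 'z) monoid_scheme \<Rightarrow> (nat \<Rightarrow> nat) \<Rightarrow> (nat \<Rightarrow> 'g \<Rightarrow> nat \<Rightarrow> nat)
      \<Rightarrow> 'x measure \<Rightarrow> ('g \<Rightarrow> 'x \<Rightarrow> 'x) \<Rightarrow> ereal" where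
  "sofic_entropy G d \<sigma> M a =
     (SUP (A, \<alpha>) \<in> observables M. INF (B, \<beta>, \<pi>) \<in> refinements M A \<alpha>.
        entropy_rel G d \<sigma> M a B \<beta> \<pi>)"

end

(*
  Let f be in H. By singularity, the closure of the graph {(rho(c) f, c)} of finitely supported
  coefficient functions c contains (f, 0): the projection onto this closed invariant subspace of
  H + l2 has an off-diagonal corner S : H -> l2 that intertwines the representations, and the polar
  decomposition of a nonzero S would embed a part of H into l2. So f is approximated by rho(c) f
  with the l2 norm of c as small as we please.

  A microstate v of f is then almost fixed by the matrix T = sum c(g) sigma(g), and by asymptotic
  freeness all but few columns of T have norm ||c||. Rounding v at random to a sparse vector with
  entries in L Z[i] changes T v by at most L ||c|| in mean square; hence v, being close to T v, is
  determined up to a small error by a sparse integer vector, and there are only exp(kappa d) of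
  these. This makes every level set {Re f <= t} a set without entropy; such sets form a
  sigma-algebra that is closed under null modifications, so they are all measurable sets.
*)

theory Submission
  imports Defs "HOL-Library.Function_Algebras" "HOL-Library.Nat_Bijection"
begin

text \<open>Small l2 norm of c makes only the normalised Hilbert-Schmidt norm of the matrix T small;
  its operator norm may stay large. A deterministic rounding error would be governed by the operator
  norm, whereas independent random errors are governed by the Hilbert-Schmidt norm. The lattice
  scale L has to be large, so that the integer vectors are sparse enough to be counted, and c is
  then chosen small against 1/L; hence L must not depend on c. Entropy is defined through finite
  observables, so f is replaced by a simple function. This comes after c, since the replacement
  error is multiplied by the sum of all |c(g)|, which the l2 norm does not control. The exact level
  set is recorded beside the simple function; the few places where the two disagree cost only a
  small Hamming ball. Elements of L2 are functions and not classes. The Hilbert space part therefore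
  works with degenerate forms: projections, roots and limits are fixed only up to null vectors, and
  operator identities are stated through inner products or semi-norms. The square root in the polar
  decomposition is a power series, convergent on contractions.\<close>

section \<open>The power series of the square root\<close>

text \<open>Taylor coefficients of p(x) = 1 - sqrt(1 - x). The recursion reads off the coefficients
  of p = (x + p^2)/2, which makes their nonnegativity visible without a closed form.\<close>

fun sqrt_coeff :: "nat \<Rightarrow> real" where
  "sqrt_coeff n = (if n = 0 then 0 else if n = 1 then 1/2
     else (\<Sum>i\<in>{1..<n}. sqrt_coeff i * sqrt_coeff (n - i)) / 2)"

declare sqrt_coeff.simps [simp del]

lemma sqrt_coeff_0 [simp]: "sqrt_coeff 0 = 0"
  by (simp add: sqrt_coeff.simps)

lemma sqrt_coeff_nonneg: "0 \<le> sqrt_coeff n"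
proof (induction n rule: less_induct)
  case (less n)
  then show ?case
    by (subst sqrt_coeff.simps) (auto intro!: sum_nonneg mult_nonneg_nonneg)
qed

text \<open>The identity p^2 = 2 p - x, coefficient by coefficient; the two end terms vanish because
  p has no constant term.\<close>

lemma sqrt_coeff_conv:
  "(\<Sum>i\<le>n. sqrt_coeff i * sqrt_coeff (n - i)) = 2 * sqrt_coeff n - (if n = 1 then 1 else 0)"
proof -
  have "(\<Sum>i\<le>n. sqrt_coeff i * sqrt_coeff (n - i)) = (\<Sum>i\<in>{1..<n}. sqrt_coeff i * sqrt_coeff (n - i))"
    proof (rule sum.mono_neutral_right)
    show "\<forall>i\<in>{..n} - {1..<n}. sqrt_coeff i * sqrt_coeff (n - i) = 0"
    proof
      fix i assume "i \<in> {..n} - {1..<n}"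
      then have "i = 0 \<or> i = n" by auto
      then show "sqrt_coeff i * sqrt_coeff (n - i) = 0" by auto
    qed
  qed auto
  also have "\<dots> = 2 * sqrt_coeff n - (if n = 1 then 1 else 0)"
    by (subst (3) sqrt_coeff.simps) simp
  finally show ?thesis .
qed

definition sqrt_psum :: "nat \<Rightarrow> real" where
  "sqrt_psum N = (\<Sum>n\<le>N. sqrt_coeff n)"

text \<open>Summation of the coefficient identity along the antidiagonals i + j = n. From N = 1 on
  the triangle contains the antidiagonal that contributes the -1.\<close>

lemma sqrt_psum_triangle:
  assumes "N \<ge> 1"
  shows "(\<Sum>(i,j)\<in>{(i,j). i + j \<le> N}. sqrt_coeff i * sqrt_coeff j) = 2 * sqrt_psum N - 1"
proof -
  have "(\<Sum>(i,j)\<in>{(i,j). i + j \<le> N}. sqrt_coeff i * sqrt_coeff j)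
      = (\<Sum>n\<le>N. 2 * sqrt_coeff n - (if n = 1 then 1 else 0))"
    by (simp add: sum.triangle_reindex_eq sqrt_coeff_conv)
  then show ?thesis
    using assms by (simp add: sum_subtractf sqrt_psum_def sum_distrib_left sum.delta')
qed

lemma sqrt_psum_square:
  "sqrt_psum N ^ 2 = (\<Sum>(i,j)\<in>{..N} \<times> {..N}. sqrt_coeff i * sqrt_coeff j)"
  by (simp add: sqrt_psum_def power2_eq_square sum_product sum.cartesian_product)

lemma finite_triangle: "finite {(i::nat, j). i + j \<le> N}"
  by (rule finite_subset[of _ "{..N} \<times> {..N}"]) auto

lemma sqrt_psum_nonneg: "0 \<le> sqrt_psum N"
  by (simp add: sqrt_psum_def sum_nonneg sqrt_coeff_nonneg)

text \<open>With s for the partial sums, the triangle of size N + 1 fits into the square of side N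
  up to vanishing terms, whence 2 s(N + 1) - 1 <= s(N)^2 <= 1.\<close>

lemma sqrt_psum_le_1: "sqrt_psum N \<le> 1"
proof (induction N)
  case 0
  then show ?case by (simp add: sqrt_psum_def)
next
  case (Suc N)
  have "2 * sqrt_psum (Suc N) - 1 = (\<Sum>(i,j)\<in>{(i,j). i + j \<le> Suc N}. sqrt_coeff i * sqrt_coeff j)"
    by (simp add: sqrt_psum_triangle)
  also have "\<dots> \<le> (\<Sum>(i,j)\<in>{..N} \<times> {..N}. sqrt_coeff i * sqrt_coeff j)"
  proof -
    let ?c = "\<lambda>(i, j). sqrt_coeff i * sqrt_coeff j"
    \<comment> \<open>A pair of the triangle outside the square has one entry N + 1 and hence the
      other entry 0.\<close>
    have "sum ?c {(i, j). i + j \<le> Suc N} = sum ?c ({(i, j). i + j \<le> Suc N} \<inter> {..N} \<times> {..N})"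
    proof (rule sum.mono_neutral_right[OF finite_triangle])
      show "\<forall>p\<in>{(i, j). i + j \<le> Suc N} - {(i, j). i + j \<le> Suc N} \<inter> {..N} \<times> {..N}. ?c p = 0"
      proof (clarify, goal_cases)
        case (1 i j)
        then have "i = 0 \<or> j = 0" by auto
        then show ?case by auto
      qed
    qed auto
    also have "\<dots> \<le> sum ?c ({..N} \<times> {..N})"
      by (rule sum_mono2) (auto simp: sqrt_coeff_nonneg)
    finally show ?thesis .
  qed
  also have "\<dots> = sqrt_psum N ^ 2" by (simp add: sqrt_psum_square)
  also have "\<dots> \<le> 1" using Suc sqrt_psum_nonneg by (simp add: power_le_one)
  finally show ?case by simp
qed

text \<open>The square of side N lies in the triangle of size 2 N, so the limit s satisfies s^2 <= 2
  s - 1, that is (s - 1)^2 <= 0.\<close>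

lemma sqrt_psum_tendsto: "sqrt_psum \<longlonglongrightarrow> 1"
proof -
  have inc: "incseq sqrt_psum"
    by (rule incseq_SucI) (simp add: sqrt_psum_def sqrt_coeff_nonneg)
  obtain s where s: "sqrt_psum \<longlonglongrightarrow> s"
    using incseq_convergent[OF inc, of 1] sqrt_psum_le_1 by blast
  have le: "sqrt_psum N ^ 2 \<le> 2 * sqrt_psum (2 * N) - 1" if "N \<ge> 1" for N
  proof -
    have "sqrt_psum N ^ 2 \<le> (\<Sum>(i,j)\<in>{(i,j). i + j \<le> 2 * N}. sqrt_coeff i * sqrt_coeff j)"
      unfolding sqrt_psum_square
      by (rule sum_mono2) (auto simp: finite_triangle sqrt_coeff_nonneg)
    then show ?thesis using that sqrt_psum_triangle[of "2 * N"] by simp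
  qed
  have s2: "(\<lambda>N. sqrt_psum (2 * N)) \<longlonglongrightarrow> s"
    using LIMSEQ_subseq_LIMSEQ[OF s, of "\<lambda>N. 2 * N"] by (simp add: strict_mono_def o_def)
  have "s ^ 2 \<le> 2 * s - 1"
  proof (rule tendsto_le[OF trivial_limit_sequentially])
    show "(\<lambda>N. 2 * sqrt_psum (2 * N) - 1) \<longlonglongrightarrow> 2 * s - 1" by (intro tendsto_intros s2)
    show "(\<lambda>N. sqrt_psum N ^ 2) \<longlonglongrightarrow> s ^ 2" by (intro tendsto_intros s)
    show "\<forall>\<^sub>F N in sequentially. sqrt_psum N ^ 2 \<le> 2 * sqrt_psum (2 * N) - 1"
      using le by (intro eventually_sequentiallyI[of 1])
  qed
  then have "(s - 1) ^ 2 \<le> 0" by (simp add: power2_eq_square algebra_simps)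
  then have "s = 1" by simp
  with s show ?thesis by simp
qed

text \<open>The scalar shadow of (1 - p(X))^2 = 1 - X. For a symmetric contraction X and
  \<open>a n\<close> = <X^n x, x> the left side is the squared norm of x minus the N-th partial sum
  of p(X) x. The error lives on the square minus the triangle, whose total weight s^2 - (2 s - 1)
  tends to 0.\<close>

lemma sqrt_series_quadratic:
  assumes a: "\<And>n. \<bar>a n\<bar> \<le> (a 0 :: real)"
  shows "(\<lambda>N. a 0 - 2 * (\<Sum>n\<le>N. sqrt_coeff n * a n)
      + (\<Sum>i\<le>N. \<Sum>j\<le>N. sqrt_coeff i * sqrt_coeff j * a (i + j))) \<longlonglongrightarrow> a 0 - a 1"
    (is "?f \<longlonglongrightarrow> _")
proof -
  have bd: "\<bar>?f N - (a 0 - a 1)\<bar> \<le> a 0 * (sqrt_psum N ^ 2 - (2 * sqrt_psum N - 1))" if N: "N \<ge> 1" for N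
  proof -
    let ?T = "{(i::nat, j). i + j \<le> N}" and ?S = "{..N} \<times> {..N}"
    let ?c = "\<lambda>(i, j). sqrt_coeff i * sqrt_coeff j" and ?a = "\<lambda>(i, j). a (i + j)"
    have TS: "?T \<subseteq> ?S" by auto
    have "(\<Sum>p\<in>?T. ?c p * ?a p) = (\<Sum>n\<le>N. \<Sum>i\<le>n. sqrt_coeff i * sqrt_coeff (n - i) * a n)"
      using sum.triangle_reindex_eq[of "\<lambda>i j. sqrt_coeff i * sqrt_coeff j * a (i + j)" N]
      by (auto simp: case_prod_unfold intro!: sum.cong)
    also have "\<dots> = (\<Sum>n\<le>N. 2 * (sqrt_coeff n * a n) - (if n = 1 then a 1 else 0))"
      by (intro sum.cong refl, subst sum_distrib_right[symmetric], subst sqrt_coeff_conv)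
        (auto simp: algebra_simps)
    also have "\<dots> = 2 * (\<Sum>n\<le>N. sqrt_coeff n * a n) - a 1"
      using N by (simp add: sum_subtractf sum_distrib_left sum.delta')
    finally have tri: "(\<Sum>p\<in>?T. ?c p * ?a p) = 2 * (\<Sum>n\<le>N. sqrt_coeff n * a n) - a 1" .
    have sq: "(\<Sum>i\<le>N. \<Sum>j\<le>N. sqrt_coeff i * sqrt_coeff j * a (i + j)) = (\<Sum>p\<in>?S. ?c p * ?a p)"
      by (simp add: sum.cartesian_product case_prod_unfold)
    have "?f N - (a 0 - a 1) = (\<Sum>p\<in>?S. ?c p * ?a p) - (\<Sum>p\<in>?T. ?c p * ?a p)"
      unfolding sq tri by simp
    also have "\<dots> = (\<Sum>p\<in>?S - ?T. ?c p * ?a p)"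
      by (rule sum_diff[symmetric]) (use TS in auto)
    also have "\<bar>\<dots>\<bar> \<le> (\<Sum>p\<in>?S - ?T. ?c p * a 0)"
      by (intro order_trans[OF sum_abs] sum_mono)
        (auto simp: abs_mult sqrt_coeff_nonneg intro!: mult_left_mono a)
    also have "\<dots> = a 0 * ((\<Sum>p\<in>?S. ?c p) - (\<Sum>p\<in>?T. ?c p))"
      by (subst sum_diff[symmetric]) (use TS in \<open>auto simp: sum_distrib_left mult.commute\<close>)
    also have "\<dots> = a 0 * (sqrt_psum N ^ 2 - (2 * sqrt_psum N - 1))"
      using sqrt_psum_square[of N] sqrt_psum_triangle[OF N] by (simp add: case_prod_unfold)
    finally show ?thesis .
  qed
  have "(\<lambda>N. a 0 * (sqrt_psum N ^ 2 - (2 * sqrt_psum N - 1))) \<longlonglongrightarrow> a 0 * (1 ^ 2 - (2 * 1 - 1))"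
    by (intro tendsto_intros sqrt_psum_tendsto)
  then have "(\<lambda>N. a 0 * (sqrt_psum N ^ 2 - (2 * sqrt_psum N - 1))) \<longlonglongrightarrow> 0" by simp
  then have "(\<lambda>N. ?f N - (a 0 - a 1)) \<longlonglongrightarrow> 0"
    by (rule Lim_null_comparison[rotated]) (unfold real_norm_def, rule eventually_sequentiallyI[of 1], rule bd)
  then show ?thesis by (rule LIM_zero_cancel)
qed

section \<open>Spaces with a complete semi-inner product\<close>

text \<open>The form may be degenerate because the intended vectors are square integrable functions
  rather than classes; the limits provided by completeness are unique only up to null
  vectors.\<close>

locale semi_hilbert =
  fixes V :: "'v::real_vector set" and ip :: "'v \<Rightarrow> 'v \<Rightarrow> real"
  assumes subspace_V: "subspace V"
    and ip_add_left: "\<And>x y z. x \<in> V \<Longrightarrow> y \<in> V \<Longrightarrow> z \<in> V \<Longrightarrow> ip (x + y) z = ip x z + ip y z"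
    and ip_scale_left: "\<And>r x z. x \<in> V \<Longrightarrow> z \<in> V \<Longrightarrow> ip (r *\<^sub>R x) z = r * ip x z"
    and ip_sym: "\<And>x y. x \<in> V \<Longrightarrow> y \<in> V \<Longrightarrow> ip x y = ip y x"
    and ip_nonneg: "\<And>x. x \<in> V \<Longrightarrow> 0 \<le> ip x x"
    and ip_complete: "\<And>X. (\<And>n. X n \<in> V) \<Longrightarrow>
      (\<And>e. e > 0 \<Longrightarrow> \<exists>N. \<forall>m\<ge>N. \<forall>n\<ge>N. sqrt (ip (X m - X n) (X m - X n)) < e) \<Longrightarrow>
      \<exists>l\<in>V. (\<lambda>n. sqrt (ip (X n - l) (X n - l))) \<longlonglongrightarrow> 0"
begin

section \<open>Norm, Cauchy-Schwarz inequality and limits for a degenerate form\<close>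

definition nrm :: "'v \<Rightarrow> real" where "nrm x = sqrt (ip x x)"

lemma V_closed [simp, intro]:
  "0 \<in> V" "x \<in> V \<Longrightarrow> y \<in> V \<Longrightarrow> x + y \<in> V" "x \<in> V \<Longrightarrow> y \<in> V \<Longrightarrow> x - y \<in> V"
  "x \<in> V \<Longrightarrow> r *\<^sub>R x \<in> V" "x \<in> V \<Longrightarrow> - x \<in> V"
  using subspace_V by (auto simp: subspace_0 subspace_add subspace_diff subspace_scale subspace_neg)

lemma V_sum: "(\<And>i. i \<in> A \<Longrightarrow> f i \<in> V) \<Longrightarrow> (\<Sum>i\<in>A. f i) \<in> V"
  by (rule subspace_sum[OF subspace_V])

lemma ip_add_right: "x \<in> V \<Longrightarrow> y \<in> V \<Longrightarrow> z \<in> V \<Longrightarrow> ip z (x + y) = ip z x + ip z y"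
  by (metis V_closed(2) ip_add_left ip_sym)
lemma ip_scale_right: "x \<in> V \<Longrightarrow> z \<in> V \<Longrightarrow> ip z (r *\<^sub>R x) = r * ip z x"
  by (metis V_closed(4) ip_scale_left ip_sym)
lemma ip_diff_left: "x \<in> V \<Longrightarrow> y \<in> V \<Longrightarrow> z \<in> V \<Longrightarrow> ip (x - y) z = ip x z - ip y z"
  using ip_add_left[of x "(-1) *\<^sub>R y" z] ip_scale_left[of y z "-1"] V_closed(4)[of y "-1"] by simp
lemma ip_diff_right: "x \<in> V \<Longrightarrow> y \<in> V \<Longrightarrow> z \<in> V \<Longrightarrow> ip z (x - y) = ip z x - ip z y"
  by (metis V_closed(3) ip_diff_left ip_sym)
lemma ip_0_left [simp]: "x \<in> V \<Longrightarrow> ip 0 x = 0"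
  using ip_scale_left[of 0 x 0] by simp
lemma ip_0_right [simp]: "x \<in> V \<Longrightarrow> ip x 0 = 0"
  using ip_scale_right[of 0 x 0] by simp

lemmas ip_simps = ip_add_left ip_add_right ip_diff_left ip_diff_right ip_scale_left ip_scale_right

lemma ip_sum_left: "finite A \<Longrightarrow> (\<And>i. i \<in> A \<Longrightarrow> f i \<in> V) \<Longrightarrow> z \<in> V \<Longrightarrow> ip (\<Sum>i\<in>A. f i) z = (\<Sum>i\<in>A. ip (f i) z)"
  by (induction A rule: finite_induct) (auto simp: ip_add_left V_sum)
lemma nrm_nonneg [simp]: "x \<in> V \<Longrightarrow> 0 \<le> nrm x"
  by (simp add: nrm_def ip_nonneg)
lemma nrm_sq: "x \<in> V \<Longrightarrow> (nrm x)\<^sup>2 = ip x x"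
  by (simp add: nrm_def ip_nonneg)
lemma nrm_0 [simp]: "nrm 0 = 0"
  by (simp add: nrm_def)
lemma nrm_scale: "x \<in> V \<Longrightarrow> nrm (r *\<^sub>R x) = \<bar>r\<bar> * nrm x"
proof -
  assume x: "x \<in> V"
  then have "ip (r *\<^sub>R x) (r *\<^sub>R x) = r\<^sup>2 * ip x x"
    by (simp add: ip_scale_left ip_scale_right power2_eq_square)
  then show ?thesis by (simp add: nrm_def real_sqrt_mult)
qed
lemma nrm_minus: "x \<in> V \<Longrightarrow> nrm (- x) = nrm x"
  using nrm_scale[of x "-1"] by simp
lemma nrm_minus_commute: "x \<in> V \<Longrightarrow> y \<in> V \<Longrightarrow> nrm (x - y) = nrm (y - x)"
  using nrm_minus[of "x - y"] by simp

lemma cauchy_schwarz: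
  assumes "x \<in> V" "y \<in> V" shows "\<bar>ip x y\<bar> \<le> nrm x * nrm y"
proof -
  have q: "0 \<le> ip x x - 2 * r * ip x y + r\<^sup>2 * ip y y" for r
    using ip_nonneg[of "x - r *\<^sub>R y"] assms ip_sym[of x y]
    by (simp add: ip_simps power2_eq_square algebra_simps)
  have "(ip x y)\<^sup>2 \<le> ip x x * ip y y"
  proof (cases "ip y y = 0")
    case True
    have "ip x y = 0"
    proof (rule ccontr)
      assume "ip x y \<noteq> 0"
      \<comment> \<open>For a null y the quadratic is affine in r, and this r gives it the value
        -\<open>ip x x\<close> - 2.\<close>
      then show False using q[of "(ip x x + 1) / ip x y"] True ip_nonneg[OF assms(1)] by simp
    qed
    then show ?thesis using True by simp
  next
    case False
    then have "ip y y > 0" using ip_nonneg[OF assms(2)] by simp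
    then show ?thesis using q[of "ip x y / ip y y"] by (simp add: field_simps power2_eq_square)
  qed
  then have "(ip x y)\<^sup>2 \<le> (nrm x * nrm y)\<^sup>2"
    using assms by (simp add: power_mult_distrib nrm_sq)
  then show ?thesis using assms by (simp add: abs_le_square_iff[symmetric])
qed

lemma nrm_add_sq:
  "x \<in> V \<Longrightarrow> y \<in> V \<Longrightarrow> (nrm (x + y))\<^sup>2 = (nrm x)\<^sup>2 + 2 * ip x y + (nrm y)\<^sup>2"
  using ip_sym[of x y] by (simp add: nrm_sq ip_simps)

lemma nrm_triangle:
  assumes "x \<in> V" "y \<in> V" shows "nrm (x + y) \<le> nrm x + nrm y"
proof (rule power2_le_imp_le)
  show "(nrm (x + y))\<^sup>2 \<le> (nrm x + nrm y)\<^sup>2"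
    using cauchy_schwarz[OF assms] by (simp add: power2_sum nrm_add_sq[OF assms])
qed (use assms in auto)

lemma nrm_triangle3: "x \<in> V \<Longrightarrow> y \<in> V \<Longrightarrow> z \<in> V \<Longrightarrow> nrm (x - z) \<le> nrm (x - y) + nrm (y - z)"
  using nrm_triangle[of "x - y" "y - z"] by simp
lemma nrm_sum: "finite A \<Longrightarrow> (\<And>i. i \<in> A \<Longrightarrow> f i \<in> V) \<Longrightarrow> nrm (\<Sum>i\<in>A. f i) \<le> (\<Sum>i\<in>A. nrm (f i))"
proof (induction A rule: finite_induct)
  case (insert a A)
  then show ?case using nrm_triangle[of "f a" "sum f A"] V_sum[of A f] by auto
qed simp

lemma nrm_tendsto:
  assumes "\<And>n. X n \<in> V" "l \<in> V" "(\<lambda>n. nrm (X n - l)) \<longlonglongrightarrow> 0" "y \<in> V"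
  shows "(\<lambda>n. nrm (X n - y)) \<longlonglongrightarrow> nrm (l - y)"
proof -
  have "\<bar>nrm (X n - y) - nrm (l - y)\<bar> \<le> nrm (X n - l)" for n
    using nrm_triangle3[of "X n" l y] nrm_triangle3[of l "X n" y] nrm_minus_commute[of "X n" l] assms by auto
  then have "(\<lambda>n. nrm (X n - y) - nrm (l - y)) \<longlonglongrightarrow> 0"
    by (intro Lim_null_comparison[OF _ assms(3)]) auto
  then show ?thesis by (rule LIM_zero_cancel)
qed

lemma nrm_tendsto':
  assumes "\<And>n. X n \<in> V" "l \<in> V" "(\<lambda>n. nrm (X n - l)) \<longlonglongrightarrow> 0"
  shows "(\<lambda>n. nrm (X n)) \<longlonglongrightarrow> nrm l"
  using nrm_tendsto[OF assms, of 0] by simp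

lemma ip_tendsto:
  assumes "\<And>n. X n \<in> V" "l \<in> V" "(\<lambda>n. nrm (X n - l)) \<longlonglongrightarrow> 0" "y \<in> V"
  shows "(\<lambda>n. ip (X n) y) \<longlonglongrightarrow> ip l y"
proof -
  have "\<bar>ip (X n) y - ip l y\<bar> \<le> nrm (X n - l) * nrm y" for n
    using cauchy_schwarz[of "X n - l" y] assms by (simp add: ip_simps)
  then have "(\<lambda>n. ip (X n) y - ip l y) \<longlonglongrightarrow> 0"
    by (intro Lim_null_comparison[OF _ tendsto_mult_left_zero[OF assms(3), of "nrm y"]]) auto
  then show ?thesis by (rule LIM_zero_cancel)
qed

lemma nrm_eq_0D: "x \<in> V \<Longrightarrow> nrm x = 0 \<Longrightarrow> y \<in> V \<Longrightarrow> ip x y = 0"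
  using cauchy_schwarz[of x y] by simp

lemma nrm_eq_0I: "x \<in> V \<Longrightarrow> (\<And>y. y \<in> V \<Longrightarrow> ip x y = 0) \<Longrightarrow> nrm x = 0"
  by (simp add: nrm_def)

lemma nrm_eq_0_approx:
  assumes "x \<in> V" "\<And>e. e > 0 \<Longrightarrow> nrm x \<le> e" shows "nrm x = 0"
  using field_le_epsilon[of "nrm x" 0] assms by (simp add: antisym)

section \<open>Closures and orthogonal projections\<close>

definition clos :: "'v set \<Rightarrow> 'v set" where
  "clos W = {x \<in> V. \<forall>e>0. \<exists>w\<in>W. nrm (x - w) < e}"

lemma closI: "x \<in> V \<Longrightarrow> (\<And>e. e > 0 \<Longrightarrow> \<exists>w\<in>W. nrm (x - w) < e) \<Longrightarrow> x \<in> clos W"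
  by (simp add: clos_def)

lemma closD: "x \<in> clos W \<Longrightarrow> x \<in> V" "x \<in> clos W \<Longrightarrow> e > 0 \<Longrightarrow> \<exists>w\<in>W. nrm (x - w) < e"
  by (auto simp: clos_def)

lemma clos_closed:
  assumes "W \<subseteq> V" "x \<in> V" "\<And>e. e > 0 \<Longrightarrow> \<exists>w\<in>clos W. nrm (x - w) < e"
  shows "x \<in> clos W"
proof (rule closI[OF assms(2)])
  fix e :: real assume "e > 0"
  then obtain w where w: "w \<in> clos W" "nrm (x - w) < e/2" using assms(3)[of "e/2"] by auto
  then obtain w' where "w' \<in> W" "nrm (w - w') < e/2" using \<open>e > 0\<close> closD(2)[of w W "e/2"] by auto
  moreover have "nrm (x - w') \<le> nrm (x - w) + nrm (w - w')"
    using w \<open>w' \<in> W\<close> assms by (intro nrm_triangle3) (auto simp: clos_def)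
  ultimately have "nrm (x - w') < e" using w by linarith
  then show "\<exists>w\<in>W. nrm (x - w) < e" using \<open>w' \<in> W\<close> by blast
qed

lemma clos_orth:
  assumes "W \<subseteq> V" "y \<in> V" "\<And>w. w \<in> W \<Longrightarrow> ip y w = 0" "z \<in> clos W"
  shows "ip y z = 0"
proof (rule ccontr)
  assume "ip y z \<noteq> 0"
  then have pos: "\<bar>ip y z\<bar> / (nrm y + 1) > 0" using nrm_nonneg[OF assms(2)] by (simp add: add_nonneg_pos)
  obtain w where w: "w \<in> W" "nrm (z - w) < \<bar>ip y z\<bar> / (nrm y + 1)"
    using closD(2)[OF assms(4) pos] by blast
  have "z \<in> V" "w \<in> V" using assms w by (auto simp: clos_def)
  have "\<bar>ip y z\<bar> = \<bar>ip y (z - w)\<bar>" using \<open>z \<in> V\<close> \<open>w \<in> V\<close> assms w by (simp add: ip_simps)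
  also have "\<dots> \<le> nrm y * nrm (z - w)" using \<open>z \<in> V\<close> \<open>w \<in> V\<close> assms by (intro cauchy_schwarz) auto
  also have "\<dots> \<le> nrm y * (\<bar>ip y z\<bar> / (nrm y + 1))" using w assms by (intro mult_left_mono) auto
  also have "\<dots> < \<bar>ip y z\<bar>" using \<open>ip y z \<noteq> 0\<close> nrm_nonneg[OF assms(2)] by (simp add: field_simps)
  finally show False by simp
qed

text \<open>A minimising sequence is Cauchy by the parallelogram law, and the first variation at its
  limit gives orthogonality. The relation that will be projected on is not closed, so the foot point
  is sought in the closure.\<close>

lemma projection:
  assumes W: "W \<subseteq> V" "subspace W" and x: "x \<in> V"
  shows "\<exists>p\<in>clos W. \<forall>w\<in>W. ip (x - p) w = 0"
proof -
  define m where "m = (INF w\<in>W. (nrm (x - w))\<^sup>2)"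
  have W0: "0 \<in> W" using W(2) by (rule subspace_0)
  have bdd: "bdd_below ((\<lambda>w. (nrm (x - w))\<^sup>2) ` W)" by (rule bdd_belowI[of _ 0]) auto
  have m_le: "m \<le> (nrm (x - w))\<^sup>2" if "w \<in> W" for w
    unfolding m_def using bdd that by (rule cINF_lower)
  have "\<exists>w\<in>W. (nrm (x - w))\<^sup>2 < m + 1 / Suc n" for n
    using cINF_less_iff[of W "\<lambda>w. (nrm (x - w))\<^sup>2" "m + 1 / Suc n"] bdd W0
    unfolding m_def[symmetric] by auto
  then obtain w where w: "\<And>n. w n \<in> W" and wm: "\<And>n. (nrm (x - w n))\<^sup>2 < m + 1 / Suc n"
    by metis
  have wV: "w n \<in> V" for n using w W by auto
  \<comment> \<open>Parallelogram law: the midpoint of \<open>w a\<close> and \<open>w b\<close> is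
    still in the subspace, so its squared distance from x is at least m.\<close>
  have par: "(nrm (w a - w b))\<^sup>2 \<le> 2 / Suc a + 2 / Suc b" for a b
  proof -
    have "(nrm (w a - w b))\<^sup>2 = 2 * (nrm (x - w a))\<^sup>2 + 2 * (nrm (x - w b))\<^sup>2
        - 4 * (nrm (x - (1/2) *\<^sub>R (w a + w b)))\<^sup>2"
      using x wV by (simp add: nrm_sq ip_simps ip_sym[OF x wV] ip_sym[OF wV wV, of a b] algebra_simps)
    moreover have "m \<le> (nrm (x - (1/2) *\<^sub>R (w a + w b)))\<^sup>2"
      using w W(2) by (intro m_le) (auto intro: subspace_scale subspace_add)
    ultimately show ?thesis using wm[of a] wm[of b] by simp
  qed
  have "\<exists>l\<in>V. (\<lambda>n. sqrt (ip (w n - l) (w n - l))) \<longlonglongrightarrow> 0"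
  proof (rule ip_complete[OF wV])
    fix e :: real assume e: "e > 0"
    obtain N :: nat where N: "4 / e\<^sup>2 < N" using reals_Archimedean2 by blast
    have "sqrt (ip (w a - w b) (w a - w b)) < e" if "a \<ge> N" "b \<ge> N" for a b
    proof -
      have "4 / e\<^sup>2 < Suc a" "4 / e\<^sup>2 < Suc b" using N that by linarith+
      then have "2 / Suc a < e\<^sup>2 / 2" "2 / Suc b < e\<^sup>2 / 2" using e by (simp_all add: field_simps)
      then have "(nrm (w a - w b))\<^sup>2 < e\<^sup>2" using par[of a b] by linarith
      then show ?thesis using e unfolding nrm_def[symmetric] by (simp add: power2_less_imp_less)
    qed
    then show "\<exists>N. \<forall>m\<ge>N. \<forall>n\<ge>N. sqrt (ip (w m - w n) (w m - w n)) < e" by blast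
  qed
  then obtain p where p: "p \<in> V" and lim: "(\<lambda>n. nrm (w n - p)) \<longlonglongrightarrow> 0" unfolding nrm_def by blast
  have inv: "(\<lambda>n. 1 / real (Suc n)) \<longlonglongrightarrow> 0" using LIMSEQ_inverse_real_of_nat by (simp add: inverse_eq_divide)
  have lim_x: "(\<lambda>n. (nrm (w n - y))\<^sup>2) \<longlonglongrightarrow> (nrm (p - y))\<^sup>2" if "y \<in> V" for y
    by (intro tendsto_intros nrm_tendsto[OF wV p lim that])
  have up: "(nrm (p - x))\<^sup>2 \<le> m + 0"
  proof (rule LIMSEQ_le[OF lim_x[OF x]])
    show "(\<lambda>n. m + 1 / real (Suc n)) \<longlonglongrightarrow> m + 0" by (intro tendsto_intros inv)
    show "\<exists>N. \<forall>n\<ge>N. (nrm (w n - x))\<^sup>2 \<le> m + 1 / real (Suc n)"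
      using wm x wV nrm_minus_commute by (metis less_imp_le)
  qed
  have "p \<in> clos W"
  proof (rule closI[OF p])
    fix e :: real assume "e > 0"
    then have "\<forall>\<^sub>F n in sequentially. nrm (w n - p) < e" using order_tendstoD(2)[OF lim] by blast
    then obtain n where "nrm (w n - p) < e" by (auto simp: eventually_sequentially)
    then show "\<exists>w\<in>W. nrm (p - w) < e" using w nrm_minus_commute[OF wV p] by metis
  qed
  moreover have "ip (x - p) u = 0" if u: "u \<in> W" for u
  proof -
    have uV: "u \<in> V" using u W by auto
    let ?c = "ip (x - p) u" and ?k = "ip u u"
    have "0 \<le> r\<^sup>2 * ?k - 2 * r * ?c" for r
    proof -
      have "m \<le> (nrm (p - (x - r *\<^sub>R u)))\<^sup>2"
      proof (rule LIMSEQ_le_const[OF lim_x])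
        show "x - r *\<^sub>R u \<in> V" using x uV by auto
        have "m \<le> (nrm (w n - (x - r *\<^sub>R u)))\<^sup>2" for n
        proof -
          have "m \<le> (nrm (x - (w n + r *\<^sub>R u)))\<^sup>2"
            using w u W(2) by (intro m_le) (auto intro: subspace_scale subspace_add)
          also have "nrm (x - (w n + r *\<^sub>R u)) = nrm (w n - (x - r *\<^sub>R u))"
            using nrm_minus[of "x - (w n + r *\<^sub>R u)"] x wV uV by (simp add: algebra_simps)
          finally show ?thesis .
        qed
        then show "\<exists>N. \<forall>n\<ge>N. m \<le> (nrm (w n - (x - r *\<^sub>R u)))\<^sup>2" by blast
      qed
      also have "(nrm (p - (x - r *\<^sub>R u)))\<^sup>2 = (nrm (p - x))\<^sup>2 - 2 * r * ?c + r\<^sup>2 * ?k"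
        using nrm_add_sq[of "p - x" "r *\<^sub>R u"] p x uV
        by (simp add: ip_scale_right ip_scale_left nrm_scale nrm_sq[OF uV, symmetric] power_mult_distrib
            algebra_simps ip_diff_left)
      finally show ?thesis using up by simp
    qed
    \<comment> \<open>Dividing by \<open>?k + 1\<close> and not by \<open>?k\<close> covers null
      vectors u as well.\<close>
    from this[of "?c / (?k + 1)"] have *: "0 \<le> (?c / (?k + 1))\<^sup>2 * ?k - 2 * (?c / (?k + 1)) * ?c" .
    define y where "y = ?c / (?k + 1)"
    have c: "?c = y * (?k + 1)" using ip_nonneg[OF uV] by (simp add: y_def field_simps)
    have "y\<^sup>2 * (?k + 2) \<le> 0" using *[folded y_def] by (subst (asm) c) (simp add: power2_eq_square algebra_simps)
    moreover have "0 \<le> y\<^sup>2 * ?k" using ip_nonneg[OF uV] by simp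
    ultimately have "y\<^sup>2 \<le> 0" unfolding distrib_left by linarith
    then have "y = 0" by simp
    then show ?thesis using c by simp
  qed
  ultimately show ?thesis by blast
qed

end

section \<open>Closures of invariant graphs\<close>

context semi_hilbert begin

text \<open>Vectors with the same inner products differ by a null vector. This replaces equality
  wherever an operator is determined only up to null vectors.\<close>

lemma eqv_nrm:
  assumes "x \<in> V" "y \<in> V" "\<And>z. z \<in> V \<Longrightarrow> ip x z = ip y z" "p \<in> V"
  shows "nrm (p - x) = nrm (p - y)"
proof -
  have 0: "nrm (y - x) = 0" "nrm (x - y) = 0"
    using assms by (auto intro!: nrm_eq_0I simp: ip_diff_left)
  have "nrm (p - x) \<le> nrm (p - y) + nrm (y - x)" "nrm (p - y) \<le> nrm (p - x) + nrm (x - y)"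
    using assms by (auto intro!: nrm_triangle3)
  then show ?thesis using 0 by simp
qed

lemma null_nrm:
  assumes "x \<in> V" "y \<in> V" "nrm (x - y) = 0" "p \<in> V"
  shows "nrm (p - x) = nrm (p - y)"
proof (rule eqv_nrm[OF assms(1,2) _ assms(4)])
  fix z assume "z \<in> V"
  then show "ip x z = ip y z" using nrm_eq_0D[OF _ assms(3), of z] assms by (simp add: ip_diff_left)
qed

lemma eqv_nrm0:
  assumes "x \<in> V" "y \<in> V" "\<And>z. z \<in> V \<Longrightarrow> ip x z = ip y z"
  shows "nrm x = nrm y"
  using eqv_nrm[OF assms, of 0] nrm_minus[of x] nrm_minus[of y] assms by simp

lemma eqv_ip: "x \<in> V \<Longrightarrow> y \<in> V \<Longrightarrow> nrm (x - y) = 0 \<Longrightarrow> z \<in> V \<Longrightarrow> ip x z = ip y z"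
  using nrm_eq_0D[of "x - y" z] by (simp add: ip_diff_left)

end

lemma semi_hilbert_prod:
  assumes "semi_hilbert V ip" "semi_hilbert W ipw"
  shows "semi_hilbert (V \<times> W) (\<lambda>p q. ip (fst p) (fst q) + ipw (snd p) (snd q))"
proof -
  interpret V: semi_hilbert V ip by fact
  interpret W: semi_hilbert W ipw by fact
  show ?thesis
  proof
    show "subspace (V \<times> W)" by (auto simp: subspace_def zero_prod_def)
  next
    fix X :: "nat \<Rightarrow> 'a \<times> 'b"
    assume X: "\<And>n. X n \<in> V \<times> W"
    let ?n = "\<lambda>p. sqrt (ip (fst p) (fst p) + ipw (snd p) (snd p))"
    assume C: "\<And>e. e > 0 \<Longrightarrow> \<exists>N. \<forall>m\<ge>N. \<forall>n\<ge>N. ?n (X m - X n) < e"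
    have XV: "fst (X n) \<in> V" "snd (X n) \<in> W" for n using X[of n] by auto
    have le: "V.nrm (fst p) \<le> ?n p" "W.nrm (snd p) \<le> ?n p" "?n p \<le> V.nrm (fst p) + W.nrm (snd p)"
      if "p \<in> V \<times> W" for p
      using that V.ip_nonneg[of "fst p"] W.ip_nonneg[of "snd p"]
      by (auto simp: V.nrm_def W.nrm_def sqrt_add_le_add_sqrt)
    have "\<exists>l\<in>V. (\<lambda>n. sqrt (ip (fst (X n) - l) (fst (X n) - l))) \<longlonglongrightarrow> 0"
    proof (rule V.ip_complete[OF XV(1)])
      fix e :: real assume "e > 0"
      from C[OF this] obtain N where N: "\<forall>m\<ge>N. \<forall>n\<ge>N. ?n (X m - X n) < e" by blast
      have "sqrt (ip (fst (X m) - fst (X n)) (fst (X m) - fst (X n))) < e" if "m \<ge> N" "n \<ge> N" for m n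
      proof -
        have "X m - X n \<in> V \<times> W" using XV by (simp add: mem_Times_iff)
        then have "?n (X m - X n) \<ge> V.nrm (fst (X m - X n))" by (rule le)
        moreover have "?n (X m - X n) < e" using N that by blast
        ultimately have "V.nrm (fst (X m - X n)) < e" by linarith
        then show ?thesis by (simp add: V.nrm_def)
      qed
      then show "\<exists>N. \<forall>m\<ge>N. \<forall>n\<ge>N. sqrt (ip (fst (X m) - fst (X n)) (fst (X m) - fst (X n))) < e" by blast
    qed
    then obtain l where l: "l \<in> V" "(\<lambda>n. V.nrm (fst (X n) - l)) \<longlonglongrightarrow> 0" unfolding V.nrm_def by blast
    have "\<exists>l\<in>W. (\<lambda>n. sqrt (ipw (snd (X n) - l) (snd (X n) - l))) \<longlonglongrightarrow> 0"
    proof (rule W.ip_complete[OF XV(2)])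
      fix e :: real assume "e > 0"
      from C[OF this] obtain N where N: "\<forall>m\<ge>N. \<forall>n\<ge>N. ?n (X m - X n) < e" by blast
      have "sqrt (ipw (snd (X m) - snd (X n)) (snd (X m) - snd (X n))) < e" if "m \<ge> N" "n \<ge> N" for m n
      proof -
        have "X m - X n \<in> V \<times> W" using XV by (simp add: mem_Times_iff)
        then have "?n (X m - X n) \<ge> W.nrm (snd (X m - X n))" by (rule le)
        moreover have "?n (X m - X n) < e" using N that by blast
        ultimately have "W.nrm (snd (X m - X n)) < e" by linarith
        then show ?thesis by (simp add: W.nrm_def)
      qed
      then show "\<exists>N. \<forall>m\<ge>N. \<forall>n\<ge>N. sqrt (ipw (snd (X m) - snd (X n)) (snd (X m) - snd (X n))) < e" by blast
    qed
    then obtain k where k: "k \<in> W" "(\<lambda>n. W.nrm (snd (X n) - k)) \<longlonglongrightarrow> 0" unfolding W.nrm_def by blast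
    have "(\<lambda>n. V.nrm (fst (X n) - l) + W.nrm (snd (X n) - k)) \<longlonglongrightarrow> 0"
      using tendsto_add[OF l(2) k(2)] by simp
    moreover have "norm (?n (X n - (l, k))) \<le> V.nrm (fst (X n) - l) + W.nrm (snd (X n) - k)" for n
    proof -
      have in_VW: "X n - (l, k) \<in> V \<times> W" using XV l(1) k(1) by (simp add: mem_Times_iff)
      have "0 \<le> ?n (X n - (l, k))" using in_VW V.ip_nonneg W.ip_nonneg by (simp add: mem_Times_iff)
      then show ?thesis using le(3)[OF in_VW] by simp
    qed
    ultimately have "(\<lambda>n. ?n (X n - (l, k))) \<longlonglongrightarrow> 0"
      by (rule Lim_null_comparison[rotated, OF _ always_eventually[OF allI]])
    then show "\<exists>l\<in>V \<times> W. (\<lambda>n. ?n (X n - l)) \<longlonglongrightarrow> 0" using l(1) k(1) by blast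
  next
    fix p q assume "p \<in> V \<times> W" "q \<in> V \<times> W"
    then show "ip (fst p) (fst q) + ipw (snd p) (snd q) = ip (fst q) (fst p) + ipw (snd q) (snd p)"
      using V.ip_sym[of "fst p" "fst q"] W.ip_sym[of "snd p" "snd q"] by (simp add: mem_Times_iff)
  qed (auto simp: V.ip_add_left W.ip_add_left V.ip_scale_left W.ip_scale_left V.ip_nonneg W.ip_nonneg
      distrib_left)
qed

text \<open>Two representations of one family of bounded operators that is closed under adjoints,
  with an invariant subspace of the direct sum. \<open>D\<close> is only a linear relation, since a
  vector may arise from several coefficient functions.\<close>

locale hilbert_graph = V: semi_hilbert V ip + W: semi_hilbert W ipw
  for V :: "'v::real_vector set" and ip and W :: "'w::real_vector set" and ipw +
  fixes I :: "'i set" and U :: "'i \<Rightarrow> 'v \<Rightarrow> 'v" and Uw :: "'i \<Rightarrow> 'w \<Rightarrow> 'w" and adj :: "'i \<Rightarrow> 'i"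
    and D :: "('v \<times> 'w) set"
  assumes adj_in: "\<And>i. i \<in> I \<Longrightarrow> adj i \<in> I"
    and U_in: "\<And>i x. i \<in> I \<Longrightarrow> x \<in> V \<Longrightarrow> U i x \<in> V"
    and Uw_in: "\<And>i x. i \<in> I \<Longrightarrow> x \<in> W \<Longrightarrow> Uw i x \<in> W"
    and U_diff: "\<And>i x y. i \<in> I \<Longrightarrow> x \<in> V \<Longrightarrow> y \<in> V \<Longrightarrow> U i (x - y) = U i x - U i y"
    and Uw_diff: "\<And>i x y. i \<in> I \<Longrightarrow> x \<in> W \<Longrightarrow> y \<in> W \<Longrightarrow> Uw i (x - y) = Uw i x - Uw i y"
    and U_bounded: "\<And>i. i \<in> I \<Longrightarrow> \<exists>C>0. \<forall>x\<in>V. V.nrm (U i x) \<le> C * V.nrm x"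
    and Uw_bounded: "\<And>i. i \<in> I \<Longrightarrow> \<exists>C>0. \<forall>x\<in>W. W.nrm (Uw i x) \<le> C * W.nrm x"
    and U_adj: "\<And>i x y. i \<in> I \<Longrightarrow> x \<in> V \<Longrightarrow> y \<in> V \<Longrightarrow> ip (U i x) y = ip x (U (adj i) y)"
    and Uw_adj: "\<And>i x y. i \<in> I \<Longrightarrow> x \<in> W \<Longrightarrow> y \<in> W \<Longrightarrow> ipw (Uw i x) y = ipw x (Uw (adj i) y)"
    and D_sub: "D \<subseteq> V \<times> W" and D_subspace: "subspace D"
    and D_inv: "\<And>i x y. i \<in> I \<Longrightarrow> (x, y) \<in> D \<Longrightarrow> (U i x, Uw i y) \<in> D"
begin

abbreviation "ipe \<equiv> \<lambda>p q. ip (fst p) (fst q) + ipw (snd p) (snd q)"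

section \<open>The direct sum and the corners of the projection\<close>

sublocale E: semi_hilbert "V \<times> W" ipe
  by (rule semi_hilbert_prod[OF V.semi_hilbert_axioms W.semi_hilbert_axioms])

lemma E_nrm:
  assumes "x \<in> V" "y \<in> W"
  shows "V.nrm x \<le> E.nrm (x, y)" "W.nrm y \<le> E.nrm (x, y)" "E.nrm (x, y) \<le> V.nrm x + W.nrm y"
  using assms V.ip_nonneg[of x] W.ip_nonneg[of y]
  by (auto simp: V.nrm_def W.nrm_def E.nrm_def sqrt_add_le_add_sqrt)

text \<open>For the projection P onto the closure of \<open>D\<close>, \<open>Q\<close> and
  \<open>S\<close> below are the corners that P has on V + 0. Choice enters because P(x, 0) is
  determined only up to null vectors; accordingly \<open>Q\<close> and \<open>S\<close> are linear
  only modulo null vectors.\<close>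

definition proj :: "'v \<Rightarrow> 'v \<times> 'w" where
  "proj x = (SOME p. p \<in> E.clos D \<and> (\<forall>w\<in>D. ipe ((x, 0) - p) w = 0))"

definition "Q x = fst (proj x)"
definition "S x = snd (proj x)"

lemma proj:
  assumes "x \<in> V"
  shows "(Q x, S x) \<in> E.clos D" "\<And>y z. (y, z) \<in> E.clos D \<Longrightarrow> ip (x - Q x) y = ipw (S x) z"
proof -
  have x0: "(x, 0) \<in> V \<times> W" using assms by simp
  have "\<exists>p. p \<in> E.clos D \<and> (\<forall>w\<in>D. ipe ((x, 0) - p) w = 0)"
    using E.projection[OF D_sub D_subspace x0] by blast
  from someI_ex[OF this] have p: "proj x \<in> E.clos D" "\<And>w. w \<in> D \<Longrightarrow> ipe ((x, 0) - proj x) w = 0"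
    unfolding proj_def by auto
  then show 1: "(Q x, S x) \<in> E.clos D" by (simp add: Q_def S_def)
  have in_E: "proj x \<in> V \<times> W" using E.closD(1)[OF p(1)] .
  fix y z assume yz: "(y, z) \<in> E.clos D"
  have "z \<in> W" using E.closD(1)[OF yz] by simp
  have "ipe ((x, 0) - proj x) (y, z) = 0"
    using in_E x0 by (intro E.clos_orth[OF D_sub _ p(2) yz]) auto
  then show "ip (x - Q x) y = ipw (S x) z"
    using W.ip_diff_left[of 0 "S x" z] in_E \<open>z \<in> W\<close> by (auto simp: Q_def S_def)
qed

lemma Q_in [simp, intro]: "Q x \<in> V" and S_in [simp, intro]: "S x \<in> W" if "x \<in> V"
  using E.closD(1)[OF proj(1)[OF that]] by auto

text \<open>The difference of the two candidates is orthogonal to the closure. Testing it with both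
  candidates, which lie there, makes it orthogonal to itself.\<close>

lemma proj_unique:
  assumes x: "x \<in> V" and c: "(q, s) \<in> E.clos D"
    and o: "\<And>y z. (y, z) \<in> D \<Longrightarrow> ip (x - q) y = ipw s z"
  shows "V.nrm (Q x - q) = 0" "W.nrm (S x - s) = 0"
proof -
  have qs: "q \<in> V" "s \<in> W" using E.closD(1)[OF c] by auto
  have o': "ip (x - q) y = ipw s z" if "(y, z) \<in> E.clos D" for y z
  proof -
    have "ipe (x - q, - s) (y, z) = 0"
    proof (rule E.clos_orth[OF D_sub _ _ that])
      fix w assume w: "w \<in> D"
      then have "w \<in> V \<times> W" using D_sub by auto
      then show "ipe (x - q, - s) w = 0"
        using o[of "fst w" "snd w"] w qs W.ip_diff_left[of 0 s "snd w"] by auto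
    qed (use qs x in auto)
    then show ?thesis using W.ip_diff_left[of 0 s z] qs E.closD(1)[OF that] by auto
  qed
  have e: "ip (Q x - q) y + ipw (S x - s) z = 0" if "(y, z) \<in> E.clos D" for y z
    using o'[OF that] proj(2)[OF x that] E.closD(1)[OF that] qs x
    by (auto simp: V.ip_diff_left W.ip_diff_left)
  have "ip (Q x - q) (Q x - q) + ipw (S x - s) (S x - s) = 0"
    using e[OF c] e[OF proj(1)[OF x]] qs x by (auto simp: V.ip_diff_right W.ip_diff_right)
  then show "V.nrm (Q x - q) = 0" "W.nrm (S x - s) = 0"
    using V.ip_nonneg[of "Q x - q"] W.ip_nonneg[of "S x - s"] x qs
    by (auto simp: V.nrm_def W.nrm_def add_nonneg_eq_0_iff)
qed

text \<open>The corner of P^*P = P on V + 0, that is S^*S = Q - Q^2. It comes from testing the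
  residual of x with the projection of (y, 0).\<close>

lemma S_Q: "x \<in> V \<Longrightarrow> y \<in> V \<Longrightarrow> ipw (S x) (S y) = ip x (Q y) - ip (Q x) (Q y)"
  using proj(2)[of x "Q y" "S y"] proj(1)[of y] by (simp add: V.ip_diff_left)

lemma Q_sym: "x \<in> V \<Longrightarrow> y \<in> V \<Longrightarrow> ip (Q x) y = ip x (Q y)"
  using S_Q[of x y] S_Q[of y x] W.ip_sym[of "S x" "S y"] V.ip_sym[of "Q x" "Q y"] V.ip_sym[of y "Q x"]
  by simp

text \<open>\<open>A\<close> is S^*S expressed through \<open>Q\<close>, so that no adjoint of
  \<open>S\<close> has to be constructed; \<open>X\<close> = 1 - S^*S is the argument of the power
  series.\<close>

definition "A x = Q x - Q (Q x)"
definition "X x = x - A x"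

lemma A_in [simp, intro]: "x \<in> V \<Longrightarrow> A x \<in> V" and X_in [simp, intro]: "x \<in> V \<Longrightarrow> X x \<in> V"
  by (auto simp: A_def X_def)

lemma A_sym: "x \<in> V \<Longrightarrow> y \<in> V \<Longrightarrow> ip (A x) y = ip x (A y)"
  by (simp add: A_def V.ip_simps Q_sym)
lemma X_sym: "x \<in> V \<Longrightarrow> y \<in> V \<Longrightarrow> ip (X x) y = ip x (X y)"
  by (simp add: X_def V.ip_simps A_sym)
lemma S_A: "x \<in> V \<Longrightarrow> y \<in> V \<Longrightarrow> ipw (S x) (S y) = ip x (A y)"
  by (simp add: A_def V.ip_simps S_Q Q_sym)

lemma S_nrm:
  assumes x: "x \<in> V" shows "W.nrm (S x) \<le> V.nrm x"
proof (rule power2_le_imp_le)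
  have "(W.nrm (S x))\<^sup>2 = ip x (Q x) - (V.nrm (Q x))\<^sup>2" using x by (simp add: W.nrm_sq S_Q V.nrm_sq)
  also have "ip x (Q x) \<le> V.nrm x * V.nrm (Q x)" using V.cauchy_schwarz[of x "Q x"] x by simp
  also have "V.nrm x * V.nrm (Q x) - (V.nrm (Q x))\<^sup>2 \<le> (V.nrm x)\<^sup>2"
  proof -
    have "0 \<le> (V.nrm x - V.nrm (Q x))\<^sup>2" "0 \<le> V.nrm x * V.nrm (Q x)" using x by auto
    then show ?thesis by (simp add: power2_diff)
  qed
  finally show "(W.nrm (S x))\<^sup>2 \<le> (V.nrm x)\<^sup>2" by simp
qed (use x in simp)

lemma A_nrm:
  assumes x: "x \<in> V" shows "V.nrm (A x) \<le> W.nrm (S x)"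
proof (cases "V.nrm (A x) = 0")
  case False
  have "V.nrm (A x) * V.nrm (A x) = ipw (S (A x)) (S x)"
    using x V.nrm_sq[of "A x"] by (simp add: S_A power2_eq_square)
  also have "\<dots> \<le> W.nrm (S (A x)) * W.nrm (S x)" using W.cauchy_schwarz[of "S (A x)" "S x"] x by simp
  also have "\<dots> \<le> V.nrm (A x) * W.nrm (S x)" using x by (intro mult_right_mono S_nrm) auto
  finally have "V.nrm (A x) * V.nrm (A x) \<le> V.nrm (A x) * W.nrm (S x)" .
  moreover have "V.nrm (A x) > 0" using False V.nrm_nonneg[OF A_in[OF x]] by linarith
  ultimately show ?thesis by simp
qed (use x in simp)

text \<open>The squared norm is |x|^2 - 2 |S x|^2 + |A x|^2, and |A x| <= |S x|. Contractivity is
  what a power series at radius 1 demands.\<close>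

lemma X_nrm:
  assumes x: "x \<in> V" shows "V.nrm (X x) \<le> V.nrm x"
proof (rule power2_le_imp_le)
  have "(V.nrm (X x))\<^sup>2 = (V.nrm x)\<^sup>2 - 2 * (W.nrm (S x))\<^sup>2 + (V.nrm (A x))\<^sup>2"
    using x V.ip_sym[of x "A x"]
    by (simp add: X_def V.nrm_sq W.nrm_sq S_A) (simp add: V.ip_simps)
  also have "(V.nrm (A x))\<^sup>2 \<le> (W.nrm (S x))\<^sup>2" using A_nrm[OF x] x by (intro power_mono) auto
  finally show "(V.nrm (X x))\<^sup>2 \<le> (V.nrm x)\<^sup>2" using zero_le_power2[of "W.nrm (S x)"] by linarith
qed (use x in simp)

lemma Xn_in [simp, intro]: "x \<in> V \<Longrightarrow> (X ^^ n) x \<in> V"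
  by (induction n) auto
lemma Xn_sym: "x \<in> V \<Longrightarrow> y \<in> V \<Longrightarrow> ip ((X ^^ n) x) y = ip x ((X ^^ n) y)"
proof (induction n arbitrary: x y)
  case (Suc n)
  have "ip ((X ^^ Suc n) x) y = ip ((X ^^ n) x) (X y)" using Suc.prems by (simp add: X_sym)
  also have "\<dots> = ip x ((X ^^ n) (X y))" using Suc by simp
  finally show ?case by (simp add: funpow_swap1)
qed simp
lemma Xn_nrm: "x \<in> V \<Longrightarrow> V.nrm ((X ^^ n) x) \<le> V.nrm x"
proof (induction n)
  case (Suc n)
  then show ?case using X_nrm[of "(X ^^ n) x"] by simp
qed simp

text \<open>Partial sums of sqrt A = 1 - p(1 - A).\<close>

definition "BN N x = x - (\<Sum>n\<le>N. sqrt_coeff n *\<^sub>R (X ^^ n) x)"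

lemma BN_in [simp, intro]: "x \<in> V \<Longrightarrow> BN N x \<in> V"
  by (auto simp: BN_def intro!: V.V_closed V.V_sum)

lemma BN_ip: "x \<in> V \<Longrightarrow> y \<in> V \<Longrightarrow> ip (BN N x) y = ip x y - (\<Sum>n\<le>N. sqrt_coeff n * ip ((X ^^ n) x) y)"
  by (simp add: BN_def V.ip_simps V.V_sum V.ip_sum_left)

lemma BN_sym: "x \<in> V \<Longrightarrow> y \<in> V \<Longrightarrow> ip (BN N x) y = ip x (BN N y)"
proof -
  assume xy: "x \<in> V" "y \<in> V"
  have s: "ip ((X ^^ n) y) x = ip ((X ^^ n) x) y" for n
    using xy Xn_sym[of x y n] V.ip_sym[of x "(X ^^ n) y"] by simp
  have "ip x (BN N y) = ip (BN N y) x" using xy by (intro V.ip_sym) auto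
  then show ?thesis using xy V.ip_sym[of x y] by (simp add: BN_ip s)
qed

text \<open>Powers of a contraction reduce the difference to the tail of the scalar series.\<close>

lemma BN_diff_nrm:
  assumes "x \<in> V" "M \<le> N"
  shows "V.nrm (BN M x - BN N x) \<le> (sqrt_psum N - sqrt_psum M) * V.nrm x"
proof -
  have *: "sum f {..N} = sum f {..M} + sum f {M<..N}" for f :: "nat \<Rightarrow> 'z::comm_monoid_add"
    using assms(2) by (subst sum.union_disjoint[symmetric]) (auto intro: sum.cong)
  have "BN M x - BN N x = (\<Sum>n\<in>{M<..N}. sqrt_coeff n *\<^sub>R (X ^^ n) x)"
    by (simp add: BN_def *)
  then have "V.nrm (BN M x - BN N x) \<le> (\<Sum>n\<in>{M<..N}. V.nrm (sqrt_coeff n *\<^sub>R (X ^^ n) x))"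
    using V.nrm_sum[of "{M<..N}" "\<lambda>n. sqrt_coeff n *\<^sub>R (X ^^ n) x"] assms by simp
  also have "\<dots> \<le> (\<Sum>n\<in>{M<..N}. sqrt_coeff n * V.nrm x)"
    using assms by (intro sum_mono) (auto simp: V.nrm_scale sqrt_coeff_nonneg intro!: mult_left_mono Xn_nrm)
  also have "\<dots> = (sqrt_psum N - sqrt_psum M) * V.nrm x"
    by (simp add: sqrt_psum_def * sum_distrib_right)
  finally show ?thesis .
qed

lemma BN_limit:
  assumes x: "x \<in> V"
  shows "\<exists>l\<in>V. (\<lambda>N. V.nrm (BN N x - l)) \<longlonglongrightarrow> 0"
  unfolding V.nrm_def
proof (rule V.ip_complete[OF BN_in[OF x]])
  fix e :: real assume e: "e > 0"
  have "Cauchy sqrt_psum" using sqrt_psum_tendsto by (intro LIMSEQ_imp_Cauchy)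
  moreover have d: "e / (V.nrm x + 1) > 0" using e V.nrm_nonneg[OF x] by (simp add: add_nonneg_pos)
  ultimately obtain K where K: "\<And>m n. m \<ge> K \<Longrightarrow> n \<ge> K \<Longrightarrow> \<bar>sqrt_psum m - sqrt_psum n\<bar> < e / (V.nrm x + 1)"
    unfolding Cauchy_def dist_real_def by meson
  have le: "V.nrm (BN m x - BN n x) < e" if "m \<ge> K" "m \<le> n" for m n
  proof -
    have "V.nrm (BN m x - BN n x) \<le> (sqrt_psum n - sqrt_psum m) * V.nrm x" by (rule BN_diff_nrm[OF x that(2)])
    also have "\<dots> \<le> e / (V.nrm x + 1) * V.nrm x"
      using K[of n m] that x by (intro mult_right_mono) auto
    also have "\<dots> < e" using e V.nrm_nonneg[OF x] by (simp add: field_simps)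
    finally show ?thesis .
  qed
  have "V.nrm (BN m x - BN n x) < e" if "m \<ge> K" "n \<ge> K" for m n
    using le[of m n] le[of n m] that V.nrm_minus_commute[of "BN m x" "BN n x"] x by (cases "m \<le> n") auto
  then show "\<exists>K. \<forall>m\<ge>K. \<forall>n\<ge>K. sqrt (ip (BN m x - BN n x) (BN m x - BN n x)) < e"
    unfolding V.nrm_def by blast
qed

text \<open>The positive factor |S| of the polar decomposition. What matters of it is that it is
  symmetric, equivariant and satisfies |B x| = |S x|.\<close>

definition "B x = (SOME l. l \<in> V \<and> (\<lambda>N. V.nrm (BN N x - l)) \<longlonglongrightarrow> 0)"

lemma B: "x \<in> V \<Longrightarrow> B x \<in> V \<and> (\<lambda>N. V.nrm (BN N x - B x)) \<longlonglongrightarrow> 0"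
  unfolding B_def using BN_limit[of x] by (intro someI_ex[of "\<lambda>l. l \<in> V \<and> (\<lambda>N. V.nrm (BN N x - l)) \<longlonglongrightarrow> 0"]) blast
lemma B_in [simp, intro]: "x \<in> V \<Longrightarrow> B x \<in> V" using B by blast
lemma B_ip: "x \<in> V \<Longrightarrow> y \<in> V \<Longrightarrow> (\<lambda>N. ip (BN N x) y) \<longlonglongrightarrow> ip (B x) y"
  using B[of x] by (intro V.ip_tendsto) auto

lemma B_sym: "x \<in> V \<Longrightarrow> y \<in> V \<Longrightarrow> ip (B x) y = ip x (B y)"
proof -
  assume xy: "x \<in> V" "y \<in> V"
  have "(\<lambda>N. ip (BN N x) y) \<longlonglongrightarrow> ip x (B y)"
    using B_ip[of y x] xy V.ip_sym[of x "B y"] BN_sym[of x y] V.ip_sym[of x "BN _ y"] by simp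
  then show ?thesis using LIMSEQ_unique[OF B_ip[OF xy]] by simp
qed

text \<open>|BN N x|^2 expands into the expression of \<open>sqrt_series_quadratic\<close> and so
  tends to <x - X x, x> = <A x, x> = |S x|^2. The operator identity B^2 = A is bypassed.\<close>

lemma B_nrm:
  assumes x: "x \<in> V" shows "V.nrm (B x) = W.nrm (S x)"
proof -
  define a where "a n = ip ((X ^^ n) x) x" for n
  have a0: "a 0 = (V.nrm x)\<^sup>2" using x by (simp add: a_def V.nrm_sq)
  have "\<bar>a n\<bar> \<le> a 0" for n
  proof -
    have "\<bar>a n\<bar> \<le> V.nrm ((X ^^ n) x) * V.nrm x" unfolding a_def using x by (intro V.cauchy_schwarz) auto
    also have "\<dots> \<le> V.nrm x * V.nrm x" using x by (intro mult_right_mono Xn_nrm) auto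
    finally show ?thesis by (simp add: a0 power2_eq_square)
  qed
  note lim = sqrt_series_quadratic[of a, OF this]
  have aij: "ip ((X ^^ i) x) ((X ^^ j) x) = a (i + j)" for i j
  proof -
    have "a (i + j) = ip ((X ^^ j) ((X ^^ i) x)) x" unfolding a_def by (subst add.commute) (simp add: funpow_add)
    also have "\<dots> = ip ((X ^^ i) x) ((X ^^ j) x)" using x by (intro Xn_sym) auto
    finally show ?thesis by simp
  qed
  have ax: "ip x ((X ^^ n) x) = a n" for n using x by (simp add: a_def V.ip_sym)
  have "(V.nrm (BN N x))\<^sup>2 = a 0 - 2 * (\<Sum>n\<le>N. sqrt_coeff n * a n)
      + (\<Sum>i\<le>N. \<Sum>j\<le>N. sqrt_coeff i * sqrt_coeff j * a (i + j))" for N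
  proof -
    have y: "ip ((X ^^ i) x) (BN N x) = a i - (\<Sum>n\<le>N. sqrt_coeff n * a (n + i))" for i
      using x V.ip_sym[of "(X ^^ i) x" "BN N x"] BN_ip[of x "(X ^^ i) x" N] by (simp add: aij ax)
    have "(V.nrm (BN N x))\<^sup>2 = ip x (BN N x) - (\<Sum>i\<le>N. sqrt_coeff i * ip ((X ^^ i) x) (BN N x))"
      using x by (simp add: V.nrm_sq BN_ip)
    also have "ip x (BN N x) = a 0 - (\<Sum>n\<le>N. sqrt_coeff n * a n)" using y[of 0] by simp
    finally show ?thesis
      unfolding y by (simp add: right_diff_distrib sum_subtractf sum_distrib_left add.commute mult.assoc sum_negf)
  qed
  with lim have "(\<lambda>N. (V.nrm (BN N x))\<^sup>2) \<longlonglongrightarrow> a 0 - a 1" by presburger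
  moreover have "(\<lambda>N. (V.nrm (BN N x))\<^sup>2) \<longlonglongrightarrow> (V.nrm (B x))\<^sup>2"
    using B[OF x] x by (intro tendsto_intros V.nrm_tendsto') auto
  ultimately have "(V.nrm (B x))\<^sup>2 = a 0 - a 1" using LIMSEQ_unique by blast
  also have "\<dots> = (W.nrm (S x))\<^sup>2"
    using x by (simp add: a_def X_def V.ip_simps A_sym W.nrm_sq S_A)
  finally show ?thesis using x by (simp add: power2_eq_iff_nonneg)
qed

lemma A_diff: "x \<in> V \<Longrightarrow> y \<in> V \<Longrightarrow> z \<in> V \<Longrightarrow> ip z (A (x - y)) = ip z (A x) - ip z (A y)"
  by (simp add: A_sym[symmetric] V.ip_simps)

text \<open>This makes B x -> S x well defined and isometric, which is the polar decomposition:
  \<open>S\<close> and \<open>B\<close> are additive up to null vectors, and their norms agree at x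
  - y.\<close>

lemma S_diff:
  assumes "x \<in> V" "y \<in> V" shows "W.nrm (S x - S y) = V.nrm (B x - B y)"
proof -
  have "(W.nrm (S x - S y))\<^sup>2 = (W.nrm (S (x - y)))\<^sup>2"
    using assms by (simp add: W.nrm_sq W.ip_simps S_A V.ip_simps A_diff)
  then have "W.nrm (S x - S y) = W.nrm (S (x - y))" using assms by (simp add: power2_eq_iff_nonneg)
  also have "\<dots> = V.nrm (B (x - y))" using assms by (simp add: B_nrm)
  also have "\<dots> = V.nrm (B x - B y)"
    using assms by (intro V.eqv_nrm0) (auto simp: B_sym V.ip_simps)
  finally show ?thesis .
qed

lemma B_add: "x \<in> V \<Longrightarrow> y \<in> V \<Longrightarrow> p \<in> V \<Longrightarrow> V.nrm (p - B (x + y)) = V.nrm (p - (B x + B y))"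
  by (rule V.eqv_nrm) (auto simp: B_sym V.ip_simps)
lemma B_scale: "x \<in> V \<Longrightarrow> p \<in> V \<Longrightarrow> V.nrm (p - B (r *\<^sub>R x)) = V.nrm (p - r *\<^sub>R B x)"
  by (rule V.eqv_nrm) (auto simp: B_sym V.ip_simps)

text \<open>The defect is orthogonal to all values of \<open>S\<close> and is itself a combination
  of such values.\<close>

lemma S_add:
  assumes "x \<in> V" "y \<in> V" shows "W.nrm (S (x + y) - (S x + S y)) = 0"
proof -
  let ?z = "S (x + y) - (S x + S y)"
  have "ipw ?z (S w) = 0" if "w \<in> V" for w
    using assms that by (simp add: W.ip_simps S_A V.ip_simps)
  then have "ipw ?z ?z = 0" using assms by (simp only: W.ip_simps S_in V.V_closed W.V_closed)
  then show ?thesis by (simp add: W.nrm_def)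
qed

section \<open>Equivariance of the projection and of the square root\<close>

lemma clos_D_inv:
  assumes i: "i \<in> I" and c: "(x, y) \<in> E.clos D"
  shows "(U i x, Uw i y) \<in> E.clos D"
proof (rule E.closI)
  have xy: "x \<in> V" "y \<in> W" using E.closD(1)[OF c] by auto
  then show "(U i x, Uw i y) \<in> V \<times> W" using i U_in Uw_in by auto
  fix e :: real assume e: "e > 0"
  obtain C where C: "C > 0" "\<And>x. x \<in> V \<Longrightarrow> V.nrm (U i x) \<le> C * V.nrm x" using U_bounded[OF i] by blast
  obtain C' where C': "C' > 0" "\<And>x. x \<in> W \<Longrightarrow> W.nrm (Uw i x) \<le> C' * W.nrm x" using Uw_bounded[OF i] by blast
  have "e / (C + C') > 0" using e C C' by simp
  then obtain w where w: "w \<in> D" "E.nrm ((x, y) - w) < e / (C + C')" using E.closD(2)[OF c] by blast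
  obtain u v where uv: "w = (u, v)" by (cases w)
  have uv_in: "u \<in> V" "v \<in> W" using w uv D_sub by auto
  have n: "V.nrm (x - u) < e / (C + C')" "W.nrm (y - v) < e / (C + C')"
    using E_nrm[of "x - u" "y - v"] w uv xy uv_in by auto
  have "E.nrm (U i (x - u), Uw i (y - v)) \<le> V.nrm (U i (x - u)) + W.nrm (Uw i (y - v))"
    using xy uv_in i U_in Uw_in by (intro E_nrm) auto
  also have "\<dots> \<le> C * V.nrm (x - u) + C' * W.nrm (y - v)"
    using C(2)[of "x - u"] C'(2)[of "y - v"] xy uv_in by auto
  also have "\<dots> < C * (e / (C + C')) + C' * (e / (C + C'))"
    using n C C' by (intro add_strict_mono mult_strict_left_mono) auto
  also have "\<dots> = e" using C(1) C'(1) by (simp add: add_divide_distrib[symmetric] distrib_right[symmetric])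
  finally have "E.nrm ((U i x, Uw i y) - (U i u, Uw i v)) < e"
    using i xy uv_in by (simp add: U_diff Uw_diff)
  moreover have "(U i u, Uw i v) \<in> D" using D_inv[OF i] w uv by simp
  ultimately show "\<exists>w\<in>D. E.nrm ((U i x, Uw i y) - w) < e" by blast
qed

text \<open>The closure of \<open>D\<close> is invariant under a family closed under adjoints, so (U
  Q x, Uw S x) satisfies the conditions that characterise the projection of (U x, 0).\<close>

lemma QS_U:
  assumes i: "i \<in> I" and x: "x \<in> V"
  shows "V.nrm (Q (U i x) - U i (Q x)) = 0" "W.nrm (S (U i x) - Uw i (S x)) = 0"
proof -
  have c: "(U i (Q x), Uw i (S x)) \<in> E.clos D" using clos_D_inv[OF i proj(1)[OF x]] .
  have o: "ip (U i x - U i (Q x)) y = ipw (Uw i (S x)) z" if "(y, z) \<in> D" for y z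
  proof -
    have yz: "y \<in> V" "z \<in> W" using that D_sub by auto
    have "(U (adj i) y, Uw (adj i) z) \<in> D" using D_inv adj_in i that by blast
    then have "(U (adj i) y, Uw (adj i) z) \<in> E.clos D"
      using D_sub by (intro E.closI) (auto intro!: bexI[of _ "(U (adj i) y, Uw (adj i) z)"] simp: E.nrm_def zero_prod_def)
    from proj(2)[OF x this] show ?thesis
      using i x yz by (simp add: U_diff[symmetric] U_adj Uw_adj)
  qed
  show "V.nrm (Q (U i x) - U i (Q x)) = 0" "W.nrm (S (U i x) - Uw i (S x)) = 0"
    using proj_unique[OF U_in[OF i x] c o] by auto
qed

lemma Q_U: "i \<in> I \<Longrightarrow> x \<in> V \<Longrightarrow> z \<in> V \<Longrightarrow> ip (Q (U i x)) z = ip (U i (Q x)) z"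
  using QS_U(1)[of i x] by (intro V.eqv_ip) (auto simp: U_in)

lemma QQ_U: "i \<in> I \<Longrightarrow> x \<in> V \<Longrightarrow> z \<in> V \<Longrightarrow> ip (Q (Q (U i x))) z = ip (U i (Q (Q x))) z"
  by (simp add: Q_sym[of "Q (U i x)"] U_in Q_U) (simp add: Q_sym[symmetric] U_in Q_U)

lemma X_U: "i \<in> I \<Longrightarrow> x \<in> V \<Longrightarrow> z \<in> V \<Longrightarrow> ip (X (U i x)) z = ip (U i (X x)) z"
  by (simp add: X_def A_def U_diff U_in V.ip_diff_left Q_U QQ_U)

lemma Xn_U: "i \<in> I \<Longrightarrow> x \<in> V \<Longrightarrow> z \<in> V \<Longrightarrow> ip ((X ^^ n) (U i x)) z = ip (U i ((X ^^ n) x)) z"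
proof (induction n arbitrary: z)
  case (Suc n)
  have "ip ((X ^^ Suc n) (U i x)) z = ip ((X ^^ n) (U i x)) (X z)"
    using Suc.prems by (simp add: X_sym U_in)
  also have "\<dots> = ip (X (U i ((X ^^ n) x))) z" using Suc by (simp add: X_sym U_in)
  finally show ?case using Suc.prems by (simp add: X_U)
qed simp

text \<open>Equivariance is inherited from the powers of \<open>X\<close> through \<open>BN\<close>.
  It is tested with vectors z because both sides are fixed only up to null vectors.\<close>

lemma B_U:
  assumes i: "i \<in> I" and x: "x \<in> V" and z: "z \<in> V"
  shows "ip (B (U i x)) z = ip (U i (B x)) z"
proof -
  have "ip (BN N (U i x)) z = ip (BN N x) (U (adj i) z)" for N
    using assms by (simp add: BN_ip U_in adj_in Xn_U U_adj)
  then have "(\<lambda>N. ip (BN N (U i x)) z) \<longlonglongrightarrow> ip (B x) (U (adj i) z)"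
    using B_ip[of x "U (adj i) z"] assms by (simp add: U_in adj_in)
  then show ?thesis
    using LIMSEQ_unique[OF B_ip[of "U i x" z]] assms by (simp add: U_in U_adj)
qed

section \<open>The isometry of the polar decomposition\<close>

definition "K = V.clos (B ` V)"
text \<open>The extension of B y -> S y to the closed range \<open>K\<close> of \<open>B\<close>,
  described by distances: t shall be as far from each \<open>S y\<close> as f is from
  \<open>B y\<close>. This fixes t up to null vectors and builds the isometry property into the
  definition.\<close>

definition "T f = (SOME t. t \<in> W \<and> (\<forall>y\<in>V. W.nrm (t - S y) = V.nrm (f - B y)))"

lemma BV: "B ` V \<subseteq> V" by auto

text \<open>For B(y n) -> f the vectors S(y n) form a Cauchy sequence because distances are
  preserved, and their limit inherits all the distances.\<close>

lemma T:
  assumes f: "f \<in> K"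
  shows "T f \<in> W" "\<And>y. y \<in> V \<Longrightarrow> W.nrm (T f - S y) = V.nrm (f - B y)"
proof -
  have fV: "f \<in> V" using f V.closD by (auto simp: K_def)
  have "\<exists>y\<in>V. V.nrm (f - B y) < 1 / Suc n" for n
    using V.closD(2)[OF f[unfolded K_def], of "1 / Suc n"] by auto
  then obtain y where y: "\<And>n. y n \<in> V" and yn: "\<And>n. V.nrm (f - B (y n)) < 1 / Suc n" by metis
  have inv: "(\<lambda>n. 1 / real (Suc n)) \<longlonglongrightarrow> 0" using LIMSEQ_inverse_real_of_nat by (simp add: inverse_eq_divide)
  have lim0: "(\<lambda>n. V.nrm (B (y n) - f)) \<longlonglongrightarrow> 0"
    using yn y fV by (intro Lim_null_comparison[OF _ inv]) (auto simp: V.nrm_minus_commute less_imp_le)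
  have "\<exists>t\<in>W. (\<lambda>n. W.nrm (S (y n) - t)) \<longlonglongrightarrow> 0"
    unfolding W.nrm_def
  proof (rule W.ip_complete)
    show "S (y n) \<in> W" for n using y by simp
    fix e :: real assume e: "e > 0"
    obtain N where N: "\<And>n. n \<ge> N \<Longrightarrow> V.nrm (B (y n) - f) < e / 2"
      using order_tendstoD(2)[OF lim0, of "e / 2"] e by (auto simp: eventually_sequentially)
    have "W.nrm (S (y m) - S (y n)) < e" if "m \<ge> N" "n \<ge> N" for m n
      using N[OF that(1)] N[OF that(2)] V.nrm_triangle3[of "B (y m)" f "B (y n)"] y fV
        V.nrm_minus_commute[of f "B (y n)"] S_diff[of "y m" "y n"] by auto
    then show "\<exists>N. \<forall>m\<ge>N. \<forall>n\<ge>N. sqrt (ipw (S (y m) - S (y n)) (S (y m) - S (y n))) < e"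
      unfolding W.nrm_def by blast
  qed
  then obtain t where t: "t \<in> W" and lim: "(\<lambda>n. W.nrm (S (y n) - t)) \<longlonglongrightarrow> 0" by blast
  have "W.nrm (t - S u) = V.nrm (f - B u)" if u: "u \<in> V" for u
  proof -
    have "(\<lambda>n. W.nrm (S (y n) - S u)) \<longlonglongrightarrow> W.nrm (t - S u)" using y t u by (intro W.nrm_tendsto lim) auto
    moreover have "(\<lambda>n. V.nrm (B (y n) - B u)) \<longlonglongrightarrow> V.nrm (f - B u)" using y fV u by (intro V.nrm_tendsto lim0) auto
    ultimately show ?thesis using LIMSEQ_unique y u by (simp add: S_diff)
  qed
  then have "\<exists>t. t \<in> W \<and> (\<forall>y\<in>V. W.nrm (t - S y) = V.nrm (f - B y))" using t by blast
  from someI_ex[OF this] show "T f \<in> W" "\<And>y. y \<in> V \<Longrightarrow> W.nrm (T f - S y) = V.nrm (f - B y)"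
    unfolding T_def by auto
qed

lemma K_approx: "f \<in> K \<Longrightarrow> e > 0 \<Longrightarrow> \<exists>y\<in>V. V.nrm (f - B y) < e"
  unfolding K_def using V.closD(2)[of f "B ` V" e] by auto

lemma K_V: "f \<in> K \<Longrightarrow> f \<in> V" unfolding K_def by (rule V.closD)

lemma K_closed: "x \<in> V \<Longrightarrow> (\<And>e. e > 0 \<Longrightarrow> \<exists>k\<in>K. V.nrm (x - k) < e) \<Longrightarrow> x \<in> K"
  unfolding K_def by (rule V.clos_closed[OF BV])

lemma KI: "x \<in> V \<Longrightarrow> (\<And>e. e > 0 \<Longrightarrow> \<exists>y\<in>V. V.nrm (x - B y) < e) \<Longrightarrow> x \<in> K"
  unfolding K_def by (rule V.closI) auto

lemma nrm_add_diff:
  assumes "f \<in> V" "h \<in> V" "u \<in> V" "v \<in> V"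
  shows "V.nrm ((f + h) - (u + v)) \<le> V.nrm (f - u) + V.nrm (h - v)"
  using V.nrm_triangle[of "f - u" "h - v"] assms by (simp add: algebra_simps)

lemma K_add:
  assumes "f \<in> K" "h \<in> K" shows "f + h \<in> K"
proof (rule KI)
  show "f + h \<in> V" using assms K_V by simp
  fix e :: real assume "e > 0"
  then obtain u v where uv: "u \<in> V" "V.nrm (f - B u) < e/2" "v \<in> V" "V.nrm (h - B v) < e/2"
    using K_approx[of _ "e/2"] assms by (metis half_gt_zero)
  have "V.nrm ((f + h) - B (u + v)) \<le> V.nrm (f - B u) + V.nrm (h - B v)"
    using uv assms K_V by (simp add: B_add nrm_add_diff)
  then show "\<exists>y\<in>V. V.nrm (f + h - B y) < e" using uv by (intro bexI[of _ "u + v"]) auto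
qed

lemma K_scale:
  assumes "f \<in> K" shows "r *\<^sub>R f \<in> K"
proof (rule KI)
  show "r *\<^sub>R f \<in> V" using assms K_V by simp
  fix e :: real assume e: "e > 0"
  then obtain u where u: "u \<in> V" "V.nrm (f - B u) < e / (\<bar>r\<bar> + 1)"
    using K_approx[of f "e / (\<bar>r\<bar> + 1)"] assms by auto
  have "V.nrm (r *\<^sub>R f - B (r *\<^sub>R u)) = \<bar>r\<bar> * V.nrm (f - B u)"
    using u assms K_V by (simp add: B_scale V.nrm_scale flip: scaleR_diff_right)
  also have "\<dots> \<le> \<bar>r\<bar> * (e / (\<bar>r\<bar> + 1))" using u by (intro mult_left_mono) auto
  also have "\<dots> < e" using e by (simp add: field_simps)
  finally show "\<exists>y\<in>V. V.nrm (r *\<^sub>R f - B y) < e" using u by (intro bexI[of _ "r *\<^sub>R u"]) auto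
qed

lemma K_U:
  assumes i: "i \<in> I" and f: "f \<in> K"
  shows "U i f \<in> K"
proof (rule KI)
  show "U i f \<in> V" using f K_V U_in i by simp
  fix e :: real assume e: "e > 0"
  obtain C where C: "C > 0" "\<And>x. x \<in> V \<Longrightarrow> V.nrm (U i x) \<le> C * V.nrm x" using U_bounded[OF i] by blast
  have "e / C > 0" using e C by simp
  then obtain u where u: "u \<in> V" "V.nrm (f - B u) < e / C" using K_approx[OF f] by blast
  have "V.nrm (U i f - B (U i u)) = V.nrm (U i f - U i (B u))"
    using i u f K_V by (intro V.eqv_nrm) (auto simp: U_in B_U)
  also have "\<dots> \<le> C * V.nrm (f - B u)" using C(2)[of "f - B u"] i u f K_V by (simp add: U_diff)
  also have "\<dots> < e" using u(2) C(1) by (simp add: field_simps)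
  finally show "\<exists>y\<in>V. V.nrm (U i f - B y) < e" using u U_in i by blast
qed

lemma T_add:
  assumes "f \<in> K" "h \<in> K" shows "W.nrm (T (f + h) - (T f + T h)) = 0"
proof (rule W.nrm_eq_0_approx)
  show "T (f + h) - (T f + T h) \<in> W" using assms T(1) K_add by auto
  fix e :: real assume "e > 0"
  then obtain u v where uv: "u \<in> V" "V.nrm (f - B u) < e/4" "v \<in> V" "V.nrm (h - B v) < e/4"
    using K_approx[of _ "e/4"] assms by (metis divide_pos_pos zero_less_numeral)
  have TW: "T f \<in> W" "T h \<in> W" "T (f + h) \<in> W" using assms T(1) K_add by auto
  have 1: "W.nrm (T (f + h) - S (u + v)) \<le> V.nrm (f - B u) + V.nrm (h - B v)"
    using uv assms K_V by (simp add: T(2)[OF K_add] B_add nrm_add_diff)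
  have 2: "W.nrm (T (f + h) - (S u + S v)) = W.nrm (T (f + h) - S (u + v))"
    using W.null_nrm[OF _ _ S_add[OF uv(1,3)], of "T (f + h)"] uv TW by simp
  have 3: "W.nrm ((S u + S v) - (T f + T h)) \<le> W.nrm (S u - T f) + W.nrm (S v - T h)"
    using W.nrm_triangle[of "S u - T f" "S v - T h"] uv TW by (simp add: algebra_simps)
  have 4: "W.nrm (S u - T f) = V.nrm (f - B u)" "W.nrm (S v - T h) = V.nrm (h - B v)"
    using T(2)[OF assms(1) uv(1)] T(2)[OF assms(2) uv(3)] TW uv W.nrm_minus_commute by auto
  have "W.nrm (T (f + h) - (T f + T h)) \<le> W.nrm (T (f + h) - (S u + S v)) + W.nrm ((S u + S v) - (T f + T h))"
    using TW uv by (intro W.nrm_triangle3) auto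
  then show "W.nrm (T (f + h) - (T f + T h)) \<le> e" using 1 2 3 4 uv by linarith
qed

text \<open>The distance condition at y = 0. Being chosen vectors, \<open>B 0\<close> and
  \<open>S 0\<close> are known to be null but not to be 0.\<close>

lemma T_nrm:
  assumes f: "f \<in> K" shows "W.nrm (T f) = V.nrm f"
proof -
  have "W.nrm (S 0) \<le> 0" using S_nrm[of 0] by simp
  then have "V.nrm (B 0) = 0" using B_nrm[of 0] W.nrm_nonneg[of "S 0"] by (simp del: W.nrm_nonneg)
  then have "V.nrm (B 0 - 0) = 0" "W.nrm (S 0 - 0) = 0" using B_nrm[of 0] by auto
  then show ?thesis
    using T(2)[OF f, of 0] V.null_nrm[of "B 0" 0 f] W.null_nrm[of "S 0" 0 "T f"] T(1)[OF f] K_V[OF f] by simp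
qed

lemma T_U:
  assumes i: "i \<in> I" and f: "f \<in> K"
  shows "W.nrm (T (U i f) - Uw i (T f)) = 0"
proof (rule W.nrm_eq_0_approx)
  obtain C where C: "C > 0" "\<And>x. x \<in> V \<Longrightarrow> V.nrm (U i x) \<le> C * V.nrm x" using U_bounded[OF i] by blast
  obtain C' where C': "C' > 0" "\<And>x. x \<in> W \<Longrightarrow> W.nrm (Uw i x) \<le> C' * W.nrm x" using Uw_bounded[OF i] by blast
  have fV: "f \<in> V" using f by (rule K_V)
  have TW: "T (U i f) \<in> W" "T f \<in> W" "Uw i (T f) \<in> W" using i f T(1) K_U Uw_in by auto
  then show "T (U i f) - Uw i (T f) \<in> W" by simp
  fix e :: real assume "e > 0"
  then have "e / (C + C') > 0" using C C' by simp
  then obtain u where u: "u \<in> V" "V.nrm (f - B u) < e / (C + C')" using K_approx[OF f] by blast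
  have US: "S (U i u) \<in> W" "Uw i (S u) \<in> W" using i u(1) U_in Uw_in by auto
  have "W.nrm (T (U i f) - S (U i u)) = V.nrm (U i f - B (U i u))"
    using T(2)[OF K_U[OF i f] U_in[OF i u(1)]] .
  also have "\<dots> = V.nrm (U i f - U i (B u))"
    using i u fV by (intro V.eqv_nrm) (auto simp: U_in B_U)
  also have "\<dots> \<le> C * V.nrm (f - B u)" using C(2)[of "f - B u"] i u fV by (simp add: U_diff)
  finally have 1: "W.nrm (T (U i f) - Uw i (S u)) \<le> C * V.nrm (f - B u)"
    using W.null_nrm[OF US QS_U(2)[OF i u(1)] TW(1)] by simp
  have "W.nrm (Uw i (S u) - Uw i (T f)) \<le> C' * W.nrm (S u - T f)"
    using C'(2)[of "S u - T f"] i u TW by (simp add: Uw_diff)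
  also have "W.nrm (S u - T f) = V.nrm (f - B u)"
    using T(2)[OF f u(1)] TW u W.nrm_minus_commute by auto
  finally have 2: "W.nrm (Uw i (S u) - Uw i (T f)) \<le> C' * V.nrm (f - B u)" .
  have "W.nrm (T (U i f) - Uw i (T f)) \<le> W.nrm (T (U i f) - Uw i (S u)) + W.nrm (Uw i (S u) - Uw i (T f))"
    using TW US by (intro W.nrm_triangle3) auto
  also have "\<dots> \<le> (C + C') * V.nrm (f - B u)" using 1 2 by (simp add: distrib_right)
  also have "\<dots> \<le> e" using u(2) C C' by (simp add: field_simps)
  finally show "W.nrm (T (U i f) - Uw i (T f)) \<le> e" .
qed

text \<open>If the corner \<open>S\<close> is null, then x agrees with Q x up to a null vector for
  each (x, w) in \<open>D\<close>, so (x, 0) is a limit of elements of \<open>D\<close>. Otherwise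
  the isometric part of \<open>S\<close> embeds the nonzero invariant space
  \<open>K\<close>.\<close>

theorem approx_or_embeds:
  "(\<forall>(x, w)\<in>D. \<forall>e>0. \<exists>(y, z)\<in>D. V.nrm (x - y) < e \<and> W.nrm z < e) \<or>
   (\<exists>K T. K \<subseteq> V \<and> subspace K \<and> (\<forall>x\<in>V. (\<forall>e>0. \<exists>k\<in>K. V.nrm (x - k) < e) \<longrightarrow> x \<in> K) \<and>
      (\<exists>k\<in>K. V.nrm k \<noteq> 0) \<and> (\<forall>i\<in>I. \<forall>k\<in>K. U i k \<in> K) \<and> (\<forall>k\<in>K. T k \<in> W) \<and>
      (\<forall>f\<in>K. \<forall>h\<in>K. W.nrm (T (f + h) - (T f + T h)) = 0) \<and>
      (\<forall>f\<in>K. W.nrm (T f) = V.nrm f) \<and>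
      (\<forall>i\<in>I. \<forall>f\<in>K. W.nrm (T (U i f) - Uw i (T f)) = 0))"
proof (cases "\<forall>x\<in>V. W.nrm (S x) = 0")
  case True
  have "\<exists>(y, z)\<in>D. V.nrm (x - y) < e \<and> W.nrm z < e" if xw: "(x, w) \<in> D" and e: "e > 0" for x w e
  proof -
    have x: "x \<in> V" and w: "w \<in> W" using xw D_sub by auto
    have xw': "(x, w) \<in> E.clos D"
      using xw D_sub by (intro E.closI) (auto intro!: bexI[of _ "(x, w)"] simp: E.nrm_def zero_prod_def)
    \<comment> \<open>The residual is tested with (x, w), the element of \<open>D\<close> that x
      comes from; the term with w drops out because S x is null.\<close>
    have "ip (x - Q x) x = 0"
      using proj(2)[OF x xw'] W.nrm_eq_0D[of "S x" w] True x w by simp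
    then have 1: "ip (Q x) x = ip x x" using x by (simp add: V.ip_diff_left)
    have "ip x (Q x) - ip (Q x) (Q x) = 0"
      using S_Q[OF x x] W.nrm_eq_0D[of "S x" "S x"] True x by simp
    then have "ip (x - Q x) (x - Q x) = 0"
      using 1 x V.ip_sym[of x "Q x"] by (simp add: V.ip_simps)
    then have nx: "V.nrm (x - Q x) = 0" by (simp add: V.nrm_def)
    obtain y z where yz: "(y, z) \<in> D" "E.nrm ((Q x, S x) - (y, z)) < e"
      using E.closD(2)[OF proj(1)[OF x] e] by auto
    have yz_in: "y \<in> V" "z \<in> W" using yz D_sub by auto
    have "V.nrm (Q x - y) < e" "W.nrm (S x - z) < e"
      using E_nrm[of "Q x - y" "S x - z"] yz yz_in x by auto
    moreover have "V.nrm (x - y) \<le> V.nrm (x - Q x) + V.nrm (Q x - y)" using x yz_in by (intro V.nrm_triangle3) auto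
    moreover have "W.nrm z \<le> W.nrm (z - S x) + W.nrm (S x)"
      using W.nrm_triangle[of "z - S x" "S x"] yz_in x by simp
    ultimately show ?thesis using nx True x yz yz_in W.nrm_minus_commute[of z "S x"]
      by (intro bexI[of _ "(y, z)"]) auto
  qed
  then show ?thesis by blast
next
  case False
  then obtain x where x: "x \<in> V" "W.nrm (S x) \<noteq> 0" by blast
  have "B x \<in> K" using x by (intro KI) (auto intro!: bexI[of _ x])
  then have nz: "\<exists>k\<in>K. V.nrm k \<noteq> 0" using x B_nrm[of x] by (intro bexI[of _ "B x"]) simp_all
  have "0 \<in> K" using K_scale[OF \<open>B x \<in> K\<close>, of 0] by simp
  then have sub: "subspace K" by (auto simp: subspace_def K_add K_scale)
  show ?thesis
    by (rule disjI2, rule exI[of _ K], rule exI[of _ T])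
      (use nz sub in \<open>auto simp: K_V T T_add T_nrm T_U K_U intro: K_closed\<close>)
qed

end

section \<open>The space of square integrable functions\<close>

text \<open>This lets \<open>L2 N\<close>, a set of functions with pointwise operations, serve as
  the carrier of \<open>semi_hilbert\<close>.\<close>

instantiation "fun" :: (type, real_vector) real_vector
begin
definition scaleR_fun :: "real \<Rightarrow> ('a \<Rightarrow> 'b) \<Rightarrow> 'a \<Rightarrow> 'b" where
  "scaleR_fun r f = (\<lambda>x. r *\<^sub>R f x)"
instance
  by standard (auto simp: scaleR_fun_def fun_eq_iff scaleR_add_left scaleR_add_right)
end

definition L2_ip :: "'y measure \<Rightarrow> ('y \<Rightarrow> complex) \<Rightarrow> ('y \<Rightarrow> complex) \<Rightarrow> real" where
  "L2_ip N f h = (\<integral>x. Re (f x * cnj (h x)) \<partial>N)"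

lemma L2_ip_self: "L2_ip N f f = (\<integral>x. (cmod (f x))\<^sup>2 \<partial>N)"
  by (simp add: L2_ip_def complex_mult_cnj cmod_power2)

lemma L2_norm_ip: "L2_norm N f = sqrt (L2_ip N f f)"
  by (simp add: L2_norm_def L2_ip_self)

lemma cmod_add_sq_le: "(cmod (a + b))\<^sup>2 \<le> 2 * (cmod a)\<^sup>2 + 2 * (cmod b)\<^sup>2"
proof -
  have "(cmod (a + b))\<^sup>2 \<le> (cmod a + cmod b)\<^sup>2" by (simp add: norm_triangle_ineq power_mono)
  also have "\<dots> \<le> 2 * (cmod a)\<^sup>2 + 2 * (cmod b)\<^sup>2"
    using zero_le_power2[of "cmod a - cmod b"] unfolding power2_sum power2_diff by linarith
  finally show ?thesis .
qed

lemma L2D: "f \<in> L2 N \<Longrightarrow> f \<in> borel_measurable N" "f \<in> L2 N \<Longrightarrow> integrable N (\<lambda>x. (cmod (f x))\<^sup>2)"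
  by (auto simp: L2_def)

lemma L2_add:
  assumes "f \<in> L2 N" "h \<in> L2 N"
  shows "(\<lambda>x. f x + h x) \<in> L2 N"
proof -
  note [measurable] = L2D(1)[OF assms(1)] L2D(1)[OF assms(2)]
  have "integrable N (\<lambda>x. (cmod (f x + h x))\<^sup>2)"
    by (rule Bochner_Integration.integrable_bound[of N "\<lambda>x. 2 * (cmod (f x))\<^sup>2 + 2 * (cmod (h x))\<^sup>2"])
      (use L2D(2)[OF assms(1)] L2D(2)[OF assms(2)] in \<open>auto simp: cmod_add_sq_le\<close>)
  then show ?thesis by (simp add: L2_def)
qed

lemma L2_mult: "f \<in> L2 N \<Longrightarrow> (\<lambda>x. c * f x) \<in> L2 N"
  by (auto simp: L2_def norm_mult power_mult_distrib)

lemma L2_diff: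
  assumes "f \<in> L2 N" "h \<in> L2 N"
  shows "(\<lambda>x. f x - h x) \<in> L2 N"
  using L2_add[OF assms(1) L2_mult[OF assms(2), of "-1"]] by simp

lemma L2_0: "(\<lambda>x. 0) \<in> L2 N"
  by (simp add: L2_def)

lemma L2_ip_integrable:
  assumes "f \<in> L2 N" "h \<in> L2 N"
  shows "integrable N (\<lambda>x. Re (f x * cnj (h x)))"
proof -
  note [measurable] = L2D(1)[OF assms(1)] L2D(1)[OF assms(2)]
  have "\<bar>Re (a * cnj b)\<bar> \<le> (cmod a)\<^sup>2 + (cmod b)\<^sup>2" for a b :: complex
  proof -
    have "\<bar>Re (a * cnj b)\<bar> \<le> cmod a * cmod b" using abs_Re_le_cmod[of "a * cnj b"] by (simp add: norm_mult)
    moreover have "0 \<le> cmod a * cmod b" "0 \<le> (cmod a - cmod b)\<^sup>2" by auto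
    ultimately show ?thesis unfolding power2_diff by linarith
  qed
  note bd = this
  have m: "(\<lambda>x. Re (f x * cnj (h x))) \<in> borel_measurable N" by simp
  show ?thesis
    by (rule Bochner_Integration.integrable_bound[of N "\<lambda>x. (cmod (f x))\<^sup>2 + (cmod (h x))\<^sup>2"])
      (use L2D(2)[OF assms(1)] L2D(2)[OF assms(2)] bd m in auto)
qed

lemma L2_norm_eq_0:
  assumes "f \<in> L2 N"
  shows "L2_norm N f = 0 \<longleftrightarrow> (AE x in N. f x = 0)"
  using integral_nonneg_eq_0_iff_AE[OF L2D(2)[OF assms]] by (simp add: L2_norm_def)

lemma L2_norm_sq_nn:
  assumes "f \<in> L2 N"
  shows "ennreal ((L2_norm N f)\<^sup>2) = (\<integral>\<^sup>+x. ennreal ((cmod (f x))\<^sup>2) \<partial>N)"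
proof -
  have "(L2_norm N f)\<^sup>2 = (\<integral>x. (cmod (f x))\<^sup>2 \<partial>N)" by (simp add: L2_norm_def)
  then show ?thesis using nn_integral_eq_integral[OF L2D(2)[OF assms]] by simp
qed

lemma ennreal_le_suminf: "t k \<le> (\<Sum>k. t k)" for t :: "nat \<Rightarrow> ennreal"
  using sum_le_suminf[of t "{k}"] by simp

text \<open>Riesz-Fischer by a weighted sum of squares. With the weights 4^k the integrals are at
  most (1/4)^k, so the pointwise sum is finite almost everywhere, and there the increments are
  O(2^-k).\<close>

lemma L2_complete_subseq:
  assumes X: "\<And>n. X n \<in> L2 N"
    and fast: "\<And>k. L2_norm N (\<lambda>x. X (Suc k) x - X k x) \<le> (1/4) ^ k"
  shows "AE x in N. convergent (\<lambda>k. X k x)"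
proof -
  have [measurable]: "X n \<in> borel_measurable N" for n using L2D(1)[OF X] .
  have D: "(\<lambda>x. X (Suc k) x - X k x) \<in> L2 N" for k using X by (intro L2_diff)
  let ?h = "\<lambda>x. \<Sum>k. ennreal (4 ^ k * (cmod (X (Suc k) x - X k x))\<^sup>2)"
  have "(\<integral>\<^sup>+x. ?h x \<partial>N) = (\<Sum>k. \<integral>\<^sup>+x. ennreal (4 ^ k * (cmod (X (Suc k) x - X k x))\<^sup>2) \<partial>N)"
    by (intro nn_integral_suminf) simp
  also have "\<dots> = (\<Sum>k. ennreal (4 ^ k * (L2_norm N (\<lambda>x. X (Suc k) x - X k x))\<^sup>2))"
    using L2_norm_sq_nn[OF D] by (simp add: ennreal_mult nn_integral_cmult)
  also have "\<dots> \<le> (\<Sum>k. ennreal ((1/4) ^ k))"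
  proof (intro suminf_le ennreal_leI)
    fix k
    have "(L2_norm N (\<lambda>x. X (Suc k) x - X k x))\<^sup>2 \<le> ((1/4) ^ k)\<^sup>2"
      using fast[of k] by (intro power_mono) (auto simp: L2_norm_def)
    then have "4 ^ k * (L2_norm N (\<lambda>x. X (Suc k) x - X k x))\<^sup>2 \<le> 4 ^ k * ((1/4) ^ k)\<^sup>2"
      by (intro mult_left_mono) auto
    also have "\<dots> = (1/4) ^ k" by (simp add: power2_eq_square flip: power_mult_distrib)
    finally show "4 ^ k * (L2_norm N (\<lambda>x. X (Suc k) x - X k x))\<^sup>2 \<le> (1/4) ^ k" .
  qed auto
  also have "\<dots> = ennreal (\<Sum>k. (1/4) ^ k)"
    by (rule suminf_ennreal2) (simp_all add: summable_geometric)
  also have "\<dots> < \<infinity>" by simp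
  finally have "(\<integral>\<^sup>+x. ?h x \<partial>N) \<noteq> \<infinity>" by simp
  then have fin_AE: "AE x in N. ?h x \<noteq> \<infinity>"
    by (rule nn_integral_PInf_AE[rotated]) simp
  have conv: "convergent (\<lambda>k. X k x)" if fin: "?h x \<noteq> \<infinity>" for x
  proof -
    define s where "s = enn2real (?h x)"
    have le: "cmod (X (Suc k) x - X k x) \<le> sqrt s * (1/2) ^ k" for k
    proof -
      let ?t = "\<lambda>k. ennreal (4 ^ k * (cmod (X (Suc k) x - X k x))\<^sup>2)"
      have "?t k \<le> ?h x" by (rule ennreal_le_suminf)
      also have "?h x = ennreal s"
        unfolding s_def by (rule ennreal_enn2real[symmetric]) (use fin in \<open>unfold infinity_ennreal_def top.not_eq_extremum\<close>)
      finally have "4 ^ k * (cmod (X (Suc k) x - X k x))\<^sup>2 \<le> s"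
        by (rule ennreal_le_iff[THEN iffD1, rotated]) (simp only: s_def enn2real_nonneg)
      moreover have "(2::real) ^ k * 2 ^ k = 4 ^ k" by (simp flip: power_mult_distrib)
      moreover have "(2 ^ k * cmod (X (Suc k) x - X k x))\<^sup>2 = (2 ^ k * 2 ^ k) * (cmod (X (Suc k) x - X k x))\<^sup>2"
        by (simp only: power2_eq_square mult_ac)
      ultimately have "(2 ^ k * cmod (X (Suc k) x - X k x))\<^sup>2 \<le> s" by simp
      then have "2 ^ k * cmod (X (Suc k) x - X k x) \<le> sqrt s" by (rule real_le_rsqrt)
      then show ?thesis by (simp add: field_simps power_one_over)
    qed
    have "summable (\<lambda>k. X (Suc k) x - X k x)"
      by (rule summable_comparison_test'[of "\<lambda>k. sqrt s * (1/2) ^ k" 0])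
        (use le in \<open>auto intro: summable_mult[OF summable_geometric]\<close>)
    then have "(\<lambda>n. \<Sum>k<n. X (Suc k) x - X k x) \<longlonglongrightarrow> (\<Sum>k. X (Suc k) x - X k x)"
      by (rule summable_LIMSEQ)
    then have "(\<lambda>n. X n x - X 0 x) \<longlonglongrightarrow> (\<Sum>k. X (Suc k) x - X k x)"
      by (simp only: sum_lessThan_telescope[of "\<lambda>n. X n x"])
    from tendsto_add[OF this tendsto_const[of "X 0 x"]]
    have "(\<lambda>n. X n x) \<longlonglongrightarrow> (\<Sum>k. X (Suc k) x - X k x) + X 0 x" by simp
    then show "convergent (\<lambda>k. X k x)" by (auto simp: convergent_def)
  qed
  show ?thesis using fin_AE by (rule eventually_mono) (rule conv)
qed

lemma L2_complete:
  assumes X: "\<And>n. X n \<in> L2 N"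
    and C: "\<And>e. e > 0 \<Longrightarrow> \<exists>K. \<forall>m\<ge>K. \<forall>n\<ge>K. L2_norm N (\<lambda>x. X m x - X n x) < e"
  shows "\<exists>l\<in>L2 N. (\<lambda>n. L2_norm N (\<lambda>x. X n x - l x)) \<longlonglongrightarrow> 0"
proof -
  have [measurable]: "X n \<in> borel_measurable N" for n using L2D(1)[OF X] .
  have "\<forall>k. \<exists>K. \<forall>m\<ge>K. \<forall>n\<ge>K. L2_norm N (\<lambda>x. X m x - X n x) < (1/4) ^ k"
    using C by simp
  then obtain M where M: "\<And>k m n. m \<ge> M k \<Longrightarrow> n \<ge> M k \<Longrightarrow> L2_norm N (\<lambda>x. X m x - X n x) < (1/4) ^ k"
    by metis
  \<comment> \<open>The sum dominates \<open>M\<close> at this and all smaller indices; the added k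
    forces r to infinity.\<close>
  define r where "r k = (\<Sum>i\<le>k. M i) + k" for k
  have rM: "r k \<ge> M k" "r k \<ge> k" for k unfolding r_def by (auto intro: trans_le_add1 member_le_sum)
  have rS: "r (Suc k) \<ge> M k" for k unfolding r_def by (intro trans_le_add1 member_le_sum) auto
  have "AE x in N. convergent (\<lambda>k. X (r k) x)"
  proof (rule L2_complete_subseq)
    show "X (r k) \<in> L2 N" for k by (rule X)
    show "L2_norm N (\<lambda>x. X (r (Suc k)) x - X (r k) x) \<le> (1/4) ^ k" for k
      using M[OF rS rM(1)] by (rule less_imp_le)
  qed
  then have conv: "AE x in N. (\<lambda>k. X (r k) x) \<longlonglongrightarrow> lim (\<lambda>k. X (r k) x)"
    by (simp add: convergent_LIMSEQ_iff)
  define l where "l x = lim (\<lambda>k. X (r k) x)" for x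
  have l_meas[measurable]: "l \<in> borel_measurable N" unfolding l_def by (rule borel_measurable_lim_metric) simp
  \<comment> \<open>Fatou along the subsequence bounds the distance of each late term from l. This
    yields both the square integrability of l and the convergence.\<close>
  have fatou: "(\<integral>\<^sup>+x. ennreal ((cmod (X n x - l x))\<^sup>2) \<partial>N) \<le> ennreal (e\<^sup>2)"
    if "e > 0" and K: "\<And>m. m \<ge> K \<Longrightarrow> L2_norm N (\<lambda>x. X n x - X m x) < e" for n e K
  proof -
    have "(\<integral>\<^sup>+x. ennreal ((cmod (X n x - l x))\<^sup>2) \<partial>N)
        = (\<integral>\<^sup>+x. liminf (\<lambda>k. ennreal ((cmod (X n x - X (r k) x))\<^sup>2)) \<partial>N)"
    proof (rule nn_integral_cong_AE, rule AE_mp[OF conv], intro AE_I2 impI)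
      fix x assume "(\<lambda>k. X (r k) x) \<longlonglongrightarrow> lim (\<lambda>k. X (r k) x)"
      then have "(\<lambda>k. ennreal ((cmod (X n x - X (r k) x))\<^sup>2)) \<longlonglongrightarrow> ennreal ((cmod (X n x - l x))\<^sup>2)"
        unfolding l_def by (intro tendsto_intros)
      then show "ennreal ((cmod (X n x - l x))\<^sup>2) = liminf (\<lambda>k. ennreal ((cmod (X n x - X (r k) x))\<^sup>2))"
        by (rule lim_imp_Liminf[symmetric, rotated]) simp
    qed
    also have "\<dots> \<le> liminf (\<lambda>k. \<integral>\<^sup>+x. ennreal ((cmod (X n x - X (r k) x))\<^sup>2) \<partial>N)"
      by (intro nn_integral_liminf) simp
    also have "\<dots> = liminf (\<lambda>k. ennreal ((L2_norm N (\<lambda>x. X n x - X (r k) x))\<^sup>2))"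
      by (simp add: L2_norm_sq_nn[OF L2_diff[OF X X]])
    also have "\<dots> \<le> liminf (\<lambda>k. ennreal (e\<^sup>2))"
    proof (rule Liminf_mono, rule eventually_sequentiallyI[of K])
      fix k assume "k \<ge> K"
      then have "r k \<ge> K" using rM(2)[of k] by simp
      then have "(L2_norm N (\<lambda>x. X n x - X (r k) x))\<^sup>2 \<le> e\<^sup>2"
        using K[of "r k"] by (intro power_mono) (auto simp: L2_norm_def)
      then show "ennreal ((L2_norm N (\<lambda>x. X n x - X (r k) x))\<^sup>2) \<le> ennreal (e\<^sup>2)" by (rule ennreal_leI)
    qed
    also have "\<dots> = ennreal (e\<^sup>2)" by (simp add: Liminf_const)
    finally show ?thesis .
  qed
  have diff_L2: "(\<lambda>x. X n x - l x) \<in> L2 N"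
    if "(\<integral>\<^sup>+x. ennreal ((cmod (X n x - l x))\<^sup>2) \<partial>N) \<le> ennreal (e\<^sup>2)" for n e
  proof -
    have "integrable N (\<lambda>x. (cmod (X n x - l x))\<^sup>2)"
      by (rule integrableI_bounded) (use le_less_trans[OF that] in auto)
    then show ?thesis by (simp add: L2_def)
  qed
  obtain K1 where K1: "\<forall>m\<ge>K1. \<forall>n\<ge>K1. L2_norm N (\<lambda>x. X m x - X n x) < 1" using C[of 1] by auto
  have "(\<lambda>x. X K1 x - l x) \<in> L2 N" using fatou[of 1 K1 K1] K1 by (intro diff_L2[of K1 1]) auto
  from L2_diff[OF X[of K1] this] have l: "l \<in> L2 N" by simp
  have "(\<lambda>n. L2_norm N (\<lambda>x. X n x - l x)) \<longlonglongrightarrow> 0"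
  proof (rule LIMSEQ_I)
    fix e :: real assume e: "0 < e"
    then obtain K where K: "\<forall>m\<ge>K. \<forall>n\<ge>K. L2_norm N (\<lambda>x. X m x - X n x) < e/2" using C[of "e/2"] by auto
    have "L2_norm N (\<lambda>x. X n x - l x) < e" if "n \<ge> K" for n
    proof -
      have "ennreal ((L2_norm N (\<lambda>x. X n x - l x))\<^sup>2) \<le> ennreal ((e/2)\<^sup>2)"
        using fatou[of "e/2" K n] K e that L2_norm_sq_nn[OF L2_diff[OF X l]] by auto
      then have "(L2_norm N (\<lambda>x. X n x - l x))\<^sup>2 \<le> (e/2)\<^sup>2" by (simp add: ennreal_le_iff)
      then have "L2_norm N (\<lambda>x. X n x - l x) \<le> e/2" by (rule power2_le_imp_le) (use e in simp)
      then show ?thesis using e by simp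
    qed
    then show "\<exists>K. \<forall>n\<ge>K. norm (L2_norm N (\<lambda>x. X n x - l x) - 0) < e" by (auto simp: L2_norm_def)
  qed
  then show ?thesis using l by blast
qed

lemma closed_subspace_L2: "closed_subspace N (L2 N)"
  by (auto simp: closed_subspace_def L2_0 L2_add L2_mult)

lemma scaleR_fun_complex: "r *\<^sub>R f = (\<lambda>x. complex_of_real r * f x)"
  by (auto simp: scaleR_fun_def scaleR_conv_of_real)

lemma closed_subspace_semi_hilbert:
  fixes N :: "'y measure"
  assumes H: "closed_subspace N H"
  shows "semi_hilbert H (L2_ip N)"
proof
  have L2: "f \<in> L2 N" if "f \<in> H" for f using H that by (auto simp: closed_subspace_def)
  show sub: "subspace H"
    using H unfolding subspace_def closed_subspace_def
    by (auto simp: zero_fun_def plus_fun_def scaleR_fun_complex)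
  fix x y z :: "'y \<Rightarrow> complex" assume "x \<in> H" "y \<in> H" "z \<in> H"
  then have i: "integrable N (\<lambda>t. Re (x t * cnj (z t)))" "integrable N (\<lambda>t. Re (y t * cnj (z t)))"
    by (auto intro!: L2_ip_integrable L2 simp del: times_complex.simps)
  have "L2_ip N (x + y) z = (\<integral>t. Re (x t * cnj (z t)) + Re (y t * cnj (z t)) \<partial>N)"
    by (simp only: L2_ip_def plus_fun_def distrib_right plus_complex.simps)
  then show "L2_ip N (x + y) z = L2_ip N x z + L2_ip N y z"
    using Bochner_Integration.integral_add[OF i] by (simp only: L2_ip_def)
next
  fix r and x z :: "'y \<Rightarrow> complex"
  have "Re (complex_of_real r * x t * cnj (z t)) = r * Re (x t * cnj (z t))" for t
    by (simp add: right_diff_distrib distrib_left mult.assoc)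
  then show "L2_ip N (r *\<^sub>R x) z = r * L2_ip N x z"
    by (simp add: L2_ip_def scaleR_fun_complex del: times_complex.simps)
next
  fix x y :: "'y \<Rightarrow> complex" show "L2_ip N x y = L2_ip N y x"
    by (simp add: L2_ip_def mult.commute)
next
  fix x :: "'y \<Rightarrow> complex" show "0 \<le> L2_ip N x x" by (simp add: L2_ip_self)
next
  have L2: "f \<in> L2 N" if "f \<in> H" for f using H that by (auto simp: closed_subspace_def)
  fix X :: "nat \<Rightarrow> 'y \<Rightarrow> complex" assume X: "\<And>n::nat. X n \<in> H"
    and C: "\<And>e. e > 0 \<Longrightarrow> \<exists>K. \<forall>m\<ge>K. \<forall>n\<ge>K. sqrt (L2_ip N (X m - X n) (X m - X n)) < e"
  have "\<exists>l\<in>L2 N. (\<lambda>n. L2_norm N (\<lambda>x. X n x - l x)) \<longlonglongrightarrow> 0"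
    using C by (intro L2_complete L2 X) (simp add: L2_norm_ip fun_diff_def)
  then obtain l where l: "l \<in> L2 N" "(\<lambda>n. L2_norm N (\<lambda>x. X n x - l x)) \<longlonglongrightarrow> 0" by blast
  have "l \<in> H"
  proof -
    have "\<exists>h\<in>H. L2_norm N (\<lambda>x. l x - h x) < e" if "e > 0" for e :: real
    proof -
      obtain n where "L2_norm N (\<lambda>x. X n x - l x) < e"
        using order_tendstoD(2)[OF l(2) \<open>e > 0\<close>] by (auto simp: eventually_sequentially)
      moreover have "L2_norm N (\<lambda>x. X n x - l x) = L2_norm N (\<lambda>x. l x - X n x)"
        by (simp add: L2_norm_def norm_minus_commute)
      ultimately show ?thesis using X by auto
    qed
    then show ?thesis using H l(1) unfolding closed_subspace_def by blast
  qed
  then show "\<exists>l\<in>H. (\<lambda>n. sqrt (L2_ip N (X n - l) (X n - l))) \<longlonglongrightarrow> 0"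
    using l(2) by (auto simp: L2_norm_ip fun_diff_def intro!: bexI[of _ l])
qed

lemma L2_compose:
  assumes "\<tau> \<in> measurable N N" "distr N N \<tau> = N" "f \<in> L2 N"
  shows "(\<lambda>x. f (\<tau> x)) \<in> L2 N"
proof -
  have "integrable (distr N N \<tau>) (\<lambda>x. (cmod (f x))\<^sup>2)" using assms L2D by simp
  then have "integrable N (\<lambda>x. (cmod (f (\<tau> x)))\<^sup>2)" using assms(1) by (rule integrable_distr[rotated])
  then show ?thesis using measurable_compose[OF assms(1) L2D(1)[OF assms(3)]] by (simp add: L2_def)
qed

lemma integral_compose_preserving:
  fixes f :: "'x \<Rightarrow> 'b::{banach, second_countable_topology}"
  assumes "\<tau> \<in> measurable N N" "distr N N \<tau> = N" "f \<in> borel_measurable N"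
  shows "(\<integral>x. f (\<tau> x) \<partial>N) = (\<integral>x. f x \<partial>N)"
  using integral_distr[OF assms(1,3)] assms(2) by simp

text \<open>Once h is written as h \<tau>' \<tau>, the whole integrand is a function of \<tau> x and
  the invariance of the measure applies.\<close>

lemma L2_ip_compose:
  assumes \<tau>: "\<tau> \<in> measurable N N" "distr N N \<tau> = N" and inv: "\<And>x. x \<in> space N \<Longrightarrow> \<tau>' (\<tau> x) = x"
    and f: "f \<in> L2 N" and h: "h \<in> L2 N" and \<tau>': "\<tau>' \<in> measurable N N"
  shows "L2_ip N (\<lambda>x. f (\<tau> x)) h = L2_ip N f (\<lambda>x. h (\<tau>' x))"
proof -
  note [measurable] = L2D(1)[OF f] L2D(1)[OF h] \<tau>'
  have "L2_ip N (\<lambda>x. f (\<tau> x)) h = (\<integral>x. Re (f (\<tau> x) * cnj (h (\<tau>' (\<tau> x)))) \<partial>N)"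
    unfolding L2_ip_def by (intro Bochner_Integration.integral_cong) (auto simp: inv)
  also have "\<dots> = L2_ip N f (\<lambda>x. h (\<tau>' x))"
    unfolding L2_ip_def
    by (rule integral_compose_preserving[OF \<tau>, of "\<lambda>x. Re (f x * cnj (h (\<tau>' x)))"]) simp
  finally show ?thesis .
qed

lemma L2_norm_compose:
  assumes \<tau>: "\<tau> \<in> measurable N N" "distr N N \<tau> = N" and f: "f \<in> L2 N"
  shows "L2_norm N (\<lambda>x. f (\<tau> x)) = L2_norm N f"
  using integral_compose_preserving[OF \<tau>, of "\<lambda>x. (cmod (f x))\<^sup>2"] L2D(1)[OF f] by (simp add: L2_norm_def)

lemma L2_ip_mult: "L2_ip N (\<lambda>x. c * f x) h = L2_ip N f (\<lambda>x. cnj c * h x)"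
  unfolding L2_ip_def by (intro Bochner_Integration.integral_cong refl arg_cong[where f = Re]) simp

lemma L2_norm_mult: "L2_norm N (\<lambda>x. c * f x) = cmod c * L2_norm N f"
  by (simp add: L2_norm_def norm_mult power_mult_distrib real_sqrt_mult)

section \<open>Approximation with small coefficients\<close>

lemma L2_norm_diff_AE:
  assumes "f \<in> L2 N" "h \<in> L2 N" "semi_hilbert.nrm (L2_ip N) (f - h) = 0"
    and "semi_hilbert (L2 N) (L2_ip N)"
  shows "AE x in N. f x = h x"
proof -
  have "L2_norm N (\<lambda>x. f x - h x) = 0"
    using assms(3) semi_hilbert.nrm_def[OF assms(4)] by (simp add: L2_norm_ip fun_diff_def)
  then show ?thesis using L2_norm_eq_0[OF L2_diff[OF assms(1,2)]] by simp
qed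

locale pmp_action = group G for G :: "('g, 'z) monoid_scheme" (structure) +
  fixes M :: "'x measure" and a :: "'g \<Rightarrow> 'x \<Rightarrow> 'x"
  assumes mpa: "measure_preserving_action G M a"
begin

lemma act: "group_action G (space M) a"
  using mpa by (simp add: measure_preserving_action_def)

lemma act_meas: "g \<in> carrier G \<Longrightarrow> a g \<in> measurable M M" and act_distr: "g \<in> carrier G \<Longrightarrow> distr M M (a g) = M"
  using mpa by (auto simp: measure_preserving_action_def)

lemma act_space: "g \<in> carrier G \<Longrightarrow> x \<in> space M \<Longrightarrow> a g x \<in> space M"
  using act_meas by (auto dest: measurable_space)

lemma act_mult: "g \<in> carrier G \<Longrightarrow> h \<in> carrier G \<Longrightarrow> x \<in> space M \<Longrightarrow> a (g \<otimes> h) x = a g (a h x)"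
  using group_action.composition_rule[OF act, of x g h] by simp

lemma act_one: "x \<in> space M \<Longrightarrow> a \<one> x = x"
  using group_action.id_eq_one[OF act] by (metis restrict_apply')

lemma act_inv: "g \<in> carrier G \<Longrightarrow> x \<in> space M \<Longrightarrow> a g (a (inv g) x) = x"
  using act_mult[of g "inv g" x] by (simp add: act_one)

lemma koopman_L2: "g \<in> carrier G \<Longrightarrow> f \<in> L2 M \<Longrightarrow> koopman G a g f \<in> L2 M"
  unfolding koopman_def by (rule L2_compose) (auto intro: act_meas simp: act_distr)

lemma koopman_norm: "g \<in> carrier G \<Longrightarrow> f \<in> L2 M \<Longrightarrow> L2_norm M (koopman G a g f) = L2_norm M f"
  unfolding koopman_def by (rule L2_norm_compose) (auto intro: act_meas simp: act_distr)

lemma koopman_adj: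
  assumes "g \<in> carrier G" "f \<in> L2 M" "h \<in> L2 M"
  shows "L2_ip M (koopman G a g f) h = L2_ip M f (koopman G a (inv g) h)"
  unfolding koopman_def using assms act_meas act_distr act_inv
  by (subst inv_inv, simp) (rule L2_ip_compose, auto)

section \<open>The regular representation and the relation of coefficients\<close>

abbreviation "cntG \<equiv> count_space (carrier G)"

lemma left_mult_distr:
  assumes "g \<in> carrier G"
  shows "(\<lambda>k. g \<otimes> k) \<in> measurable cntG cntG" "distr cntG cntG (\<lambda>k. g \<otimes> k) = cntG"
proof -
  have "bij_betw (\<lambda>k. g \<otimes> k) (carrier G) (carrier G)"
    by (rule bij_betw_byWitness[where f' = "\<lambda>k. inv g \<otimes> k"])
      (use assms in \<open>auto simp: m_assoc[symmetric]\<close>)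
  then show "distr cntG cntG (\<lambda>k. g \<otimes> k) = cntG" by (rule distr_bij_count_space)
  show "(\<lambda>k. g \<otimes> k) \<in> measurable cntG cntG" using assms by auto
qed

lemma left_regular_L2: "g \<in> carrier G \<Longrightarrow> f \<in> L2 cntG \<Longrightarrow> left_regular G g f \<in> L2 cntG"
  unfolding left_regular_def by (rule L2_compose) (auto intro: left_mult_distr)

lemma left_regular_norm: "g \<in> carrier G \<Longrightarrow> f \<in> L2 cntG \<Longrightarrow> L2_norm cntG (left_regular G g f) = L2_norm cntG f"
  unfolding left_regular_def by (rule L2_norm_compose) (auto intro: left_mult_distr)

lemma left_regular_adj:
  assumes "g \<in> carrier G" "f \<in> L2 cntG" "h \<in> L2 cntG"
  shows "L2_ip cntG (left_regular G g f) h = L2_ip cntG f (left_regular G (inv g) h)"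
  unfolding left_regular_def using assms left_mult_distr[of "inv g"] left_mult_distr[of g]
  by (subst inv_inv, simp) (rule L2_ip_compose, auto simp: m_assoc[symmetric])

text \<open>Finite support makes rho(c) \<xi> an algebraic expression for every vector \<xi>;
  infinite combinations enter only as limits. Equality almost everywhere reflects that a closed
  subspace contains all representatives of its elements.\<close>

definition coeff_graph :: "('x \<Rightarrow> complex) set \<Rightarrow> ('x \<Rightarrow> complex) \<Rightarrow> (('x \<Rightarrow> complex) \<times> ('g \<Rightarrow> complex)) set" where
  "coeff_graph H \<xi> = {(y, c). y \<in> H \<and> c \<in> L2 cntG \<and> (\<exists>F. finite F \<and> F \<subseteq> carrier G \<and>
     (\<forall>g\<in>carrier G - F. c g = 0) \<and> (AE x in M. y x = (\<Sum>g\<in>F. c g * \<xi> (a (inv g) x))))}"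

lemma coeff_graphE:
  assumes "(y, c) \<in> coeff_graph H \<xi>"
  obtains F where "y \<in> H" "c \<in> L2 cntG" "finite F" "F \<subseteq> carrier G" "\<forall>g\<in>carrier G - F. c g = 0"
    "AE x in M. y x = (\<Sum>g\<in>F. c g * \<xi> (a (inv g) x))"
  using assms by (auto simp: coeff_graph_def)

lemma coeff_graphI:
  assumes "y \<in> H" "c \<in> L2 cntG" "finite F" "F \<subseteq> carrier G" "\<And>g. g \<in> carrier G \<Longrightarrow> g \<notin> F \<Longrightarrow> c g = 0"
    "AE x in M. y x = (\<Sum>g\<in>F. c g * \<xi> (a (inv g) x))"
  shows "(y, c) \<in> coeff_graph H \<xi>"
  unfolding coeff_graph_def using assms by blast

lemma coeff_sum_mono:
  assumes "finite F'" "F \<subseteq> F'" "F' \<subseteq> carrier G" "\<forall>g\<in>carrier G - F. c g = (0::complex)"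
  shows "(\<Sum>g\<in>F. c g * f g) = (\<Sum>g\<in>F'. c g * f g)"
  using assms by (intro sum.mono_neutral_left) auto

lemma coeff_graph_subspace:
  assumes H: "closed_subspace M H"
  shows "subspace (coeff_graph H \<xi>)"
proof (rule subspaceI)
  have "(\<lambda>x. 0) \<in> H" using H by (simp add: closed_subspace_def)
  then have "((\<lambda>x. 0), (\<lambda>g. 0)) \<in> coeff_graph H \<xi>"
    by (rule coeff_graphI[where F = "{}"]) (auto simp: L2_0)
  then show "0 \<in> coeff_graph H \<xi>" by (simp add: zero_prod_def zero_fun_def)
next
  fix p q assume pq: "p \<in> coeff_graph H \<xi>" "q \<in> coeff_graph H \<xi>"
  obtain y c where p: "p = (y, c)" by (cases p)
  obtain z e where q: "q = (z, e)" by (cases q)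
  obtain F1 where
    1: "y \<in> H" "c \<in> L2 cntG" "finite F1" "F1 \<subseteq> carrier G" "\<forall>g\<in>carrier G - F1. c g = 0"
      "AE x in M. y x = (\<Sum>g\<in>F1. c g * \<xi> (a (inv g) x))"
    using pq(1) unfolding p by (rule coeff_graphE)
  obtain F2 where
    2: "z \<in> H" "e \<in> L2 cntG" "finite F2" "F2 \<subseteq> carrier G" "\<forall>g\<in>carrier G - F2. e g = 0"
      "AE x in M. z x = (\<Sum>g\<in>F2. e g * \<xi> (a (inv g) x))"
    using pq(2) unfolding q by (rule coeff_graphE)
  let ?F = "F1 \<union> F2"
  have "AE x in M. y x + z x = (\<Sum>g\<in>?F. (c g + e g) * \<xi> (a (inv g) x))"
    using 1(6) 2(6)
  proof eventually_elim
    case (elim x)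
    have "(\<Sum>g\<in>F1. c g * \<xi> (a (inv g) x)) = (\<Sum>g\<in>?F. c g * \<xi> (a (inv g) x))"
      "(\<Sum>g\<in>F2. e g * \<xi> (a (inv g) x)) = (\<Sum>g\<in>?F. e g * \<xi> (a (inv g) x))"
      using 1 2 by (auto intro!: coeff_sum_mono)
    then show ?case using elim by (simp add: distrib_right sum.distrib)
  qed
  moreover have "(\<lambda>x. y x + z x) \<in> H" using H 1 2 by (auto simp: closed_subspace_def)
  moreover have "(\<lambda>g. c g + e g) \<in> L2 cntG" using 1 2 by (intro L2_add)
  ultimately have "((\<lambda>x. y x + z x), (\<lambda>g. c g + e g)) \<in> coeff_graph H \<xi>"
    using 1(3-5) 2(3-5) by (intro coeff_graphI[where F = ?F]) auto
  then show "p + q \<in> coeff_graph H \<xi>" by (simp add: p q plus_fun_def)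
next
  fix r p assume pq: "p \<in> coeff_graph H \<xi>"
  obtain y c where p: "p = (y, c)" by (cases p)
  obtain F where
    1: "y \<in> H" "c \<in> L2 cntG" "finite F" "F \<subseteq> carrier G" "\<forall>g\<in>carrier G - F. c g = 0"
      "AE x in M. y x = (\<Sum>g\<in>F. c g * \<xi> (a (inv g) x))"
    using pq unfolding p by (rule coeff_graphE)
  have "AE x in M. complex_of_real r * y x = (\<Sum>g\<in>F. (complex_of_real r * c g) * \<xi> (a (inv g) x))"
    using 1(6) by eventually_elim (simp add: sum_distrib_left mult.assoc)
  moreover have "(\<lambda>x. complex_of_real r * y x) \<in> H" using H 1 by (auto simp: closed_subspace_def)
  moreover have "(\<lambda>g. complex_of_real r * c g) \<in> L2 cntG" using 1 by (intro L2_mult)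
  ultimately have "((\<lambda>x. complex_of_real r * y x), (\<lambda>g. complex_of_real r * c g)) \<in> coeff_graph H \<xi>"
    using 1(3-5) by (intro coeff_graphI[where F = F]) auto
  then show "r *\<^sub>R p \<in> coeff_graph H \<xi>" by (simp add: p scaleR_fun_complex)
qed

lemma coeff_graph_mult:
  assumes H: "closed_subspace M H" and "(y, c) \<in> coeff_graph H \<xi>"
  shows "((\<lambda>x. w * y x), (\<lambda>g. w * c g)) \<in> coeff_graph H \<xi>"
proof -
  obtain F where
    1: "y \<in> H" "c \<in> L2 cntG" "finite F" "F \<subseteq> carrier G" "\<forall>g\<in>carrier G - F. c g = 0"
      "AE x in M. y x = (\<Sum>g\<in>F. c g * \<xi> (a (inv g) x))"
    using assms(2) by (rule coeff_graphE)
  have "AE x in M. w * y x = (\<Sum>g\<in>F. (w * c g) * \<xi> (a (inv g) x))"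
    using 1(6) by eventually_elim (simp add: sum_distrib_left mult.assoc)
  moreover have "(\<lambda>x. w * y x) \<in> H" using H 1 by (auto simp: closed_subspace_def)
  moreover have "(\<lambda>g. w * c g) \<in> L2 cntG" using 1 by (intro L2_mult)
  ultimately show ?thesis
    using 1(3-5) by (intro coeff_graphI[where F = F]) auto
qed

text \<open>rho(h) rho(c) \<xi> = rho(h c) \<xi>, where h c is the translate of c, supported on h
  F.\<close>

lemma coeff_graph_koopman:
  assumes inv_H: "invariant_subspace G M (koopman G a) H" and "(y, c) \<in> coeff_graph H \<xi>"
    and h: "h \<in> carrier G"
  shows "(koopman G a h y, left_regular G h c) \<in> coeff_graph H \<xi>"
proof -
  obtain F where
    1: "y \<in> H" "c \<in> L2 cntG" "finite F" "F \<subseteq> carrier G" "\<forall>g\<in>carrier G - F. c g = 0"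
      "AE x in M. y x = (\<Sum>g\<in>F. c g * \<xi> (a (inv g) x))"
    using assms(2) by (rule coeff_graphE)
  let ?F = "(\<lambda>g. h \<otimes> g) ` F"
  \<comment> \<open>The identity for y holds off a null set; invariance of the measure allows it to
    be read at the point \<open>a (inv h) x\<close>.\<close>
  have "AE x in distr M M (a (inv h)). y x = (\<Sum>g\<in>F. c g * \<xi> (a (inv g) x))"
    unfolding act_distr[OF inv_closed[OF h]] by (rule 1(6))
  with act_meas[OF inv_closed[OF h]]
  have "AE x in M. y (a (inv h) x) = (\<Sum>g\<in>F. c g * \<xi> (a (inv g) (a (inv h) x)))"
    by (rule AE_distrD)
  then have "AE x in M. koopman G a h y x = (\<Sum>g\<in>?F. left_regular G h c g * \<xi> (a (inv g) x))"
  proof (rule AE_mp, intro AE_I2 impI)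
    fix x assume x: "x \<in> space M" and e: "y (a (inv h) x) = (\<Sum>g\<in>F. c g * \<xi> (a (inv g) (a (inv h) x)))"
    have "inj_on (\<lambda>g. h \<otimes> g) F" using 1(4) h by (auto simp: inj_on_def subset_iff)
    then have "(\<Sum>g\<in>?F. left_regular G h c g * \<xi> (a (inv g) x))
      = (\<Sum>g\<in>F. left_regular G h c (h \<otimes> g) * \<xi> (a (inv (h \<otimes> g)) x))"
      by (simp add: sum.reindex)
    also have "\<dots> = (\<Sum>g\<in>F. c g * \<xi> (a (inv g) (a (inv h) x)))"
      using 1(4) h x by (intro sum.cong refl)
        (auto simp: left_regular_def inv_mult_group act_mult m_assoc[symmetric] subset_iff)
    finally show "koopman G a h y x = (\<Sum>g\<in>?F. left_regular G h c g * \<xi> (a (inv g) x))"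
      using e by (simp add: koopman_def)
  qed
  moreover have "left_regular G h c g = 0" if "g \<in> carrier G - ?F" for g
  proof -
    have "inv h \<otimes> g \<notin> F"
    proof
      assume "inv h \<otimes> g \<in> F"
      moreover have "g = h \<otimes> (inv h \<otimes> g)" using that h by (simp add: m_assoc[symmetric])
      ultimately show False using that by blast
    qed
    then show ?thesis using that h 1(5) by (auto simp: left_regular_def)
  qed
  moreover have "koopman G a h y \<in> H" using inv_H h 1 by (auto simp: invariant_subspace_def)
  moreover have "left_regular G h c \<in> L2 cntG" using h 1 by (intro left_regular_L2)
  moreover have "?F \<subseteq> carrier G" "finite ?F" using 1 h by auto
  ultimately show ?thesis by (intro coeff_graphI[where F = ?F]) auto
qed

definition rep_op :: "('g + complex) \<Rightarrow> ('x \<Rightarrow> complex) \<Rightarrow> 'x \<Rightarrow> complex" where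
  "rep_op i = (case i of Inl g \<Rightarrow> koopman G a g | Inr c \<Rightarrow> (\<lambda>f x. c * f x))"

definition reg_op :: "('g + complex) \<Rightarrow> ('g \<Rightarrow> complex) \<Rightarrow> 'g \<Rightarrow> complex" where
  "reg_op i = (case i of Inl g \<Rightarrow> left_regular G g | Inr c \<Rightarrow> (\<lambda>f x. c * f x))"

text \<open>Multiplication by scalars is treated as part of the family of operators, so that the
  complex structure is covered by the real theory of \<open>hilbert_graph\<close>.\<close>

lemma hilbert_graph_coeff:
  assumes inv_H: "invariant_subspace G M (koopman G a) H"
  shows "hilbert_graph H (L2_ip M) (L2 cntG) (L2_ip cntG) (Inl ` carrier G \<union> range Inr) rep_op reg_op
    (map_sum (\<lambda>g. inv g) cnj) (coeff_graph H \<xi>)"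
proof -
  have H: "closed_subspace M H" using inv_H by (simp add: invariant_subspace_def)
  have HL2: "f \<in> L2 M" if "f \<in> H" for f using H that by (auto simp: closed_subspace_def)
  have HK: "koopman G a g f \<in> H" if "g \<in> carrier G" "f \<in> H" for g f using inv_H that by (auto simp: invariant_subspace_def)
  have HM: "(\<lambda>x. c * f x) \<in> H" if "f \<in> H" for c f using H that by (auto simp: closed_subspace_def)
  have shV: "semi_hilbert H (L2_ip M)" using H by (rule closed_subspace_semi_hilbert)
  have shW: "semi_hilbert (L2 cntG) (L2_ip cntG)" by (rule closed_subspace_semi_hilbert[OF closed_subspace_L2])
  interpret V: semi_hilbert H "L2_ip M" by fact
  interpret W: semi_hilbert "L2 cntG" "L2_ip cntG" by fact
  have Vn: "V.nrm f = L2_norm M f" and Wn: "W.nrm c = L2_norm cntG c" for f c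
    by (auto simp: V.nrm_def W.nrm_def L2_norm_ip)
  let ?I = "Inl ` carrier G \<union> range Inr :: ('g + complex) set"
  have rep_in: "rep_op i f \<in> H" if "i \<in> ?I" "f \<in> H" for i f
    using that HK HM by (auto simp: rep_op_def)
  show ?thesis
  proof (unfold_locales)
    fix i assume i: "i \<in> ?I"
    show "map_sum (\<lambda>g. inv g) cnj i \<in> ?I" using i by auto
    show "\<exists>C>0. \<forall>x\<in>H. V.nrm (rep_op i x) \<le> C * V.nrm x"
    proof (cases i)
      case (Inl g)
      then show ?thesis using i HL2 by (auto intro!: exI[of _ 1] simp: Vn rep_op_def koopman_norm)
    next
      case (Inr c)
      then show ?thesis
        by (intro exI[of _ "cmod c + 1"]) (auto simp: Vn rep_op_def L2_norm_mult L2_norm_def add_nonneg_pos intro!: mult_right_mono)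
    qed
    show "\<exists>C>0. \<forall>x\<in>L2 cntG. W.nrm (reg_op i x) \<le> C * W.nrm x"
    proof (cases i)
      case (Inl g)
      then show ?thesis using i by (auto intro!: exI[of _ 1] simp: Wn reg_op_def left_regular_norm)
    next
      case (Inr c)
      then show ?thesis
        by (intro exI[of _ "cmod c + 1"]) (auto simp: Wn reg_op_def L2_norm_mult L2_norm_def add_nonneg_pos intro!: mult_right_mono)
    qed
    fix x y assume x: "x \<in> H" and y: "y \<in> H"
    show "rep_op i x \<in> H" using rep_in[OF i x] .
    show "rep_op i (x - y) = rep_op i x - rep_op i y"
      by (auto simp: rep_op_def koopman_def fun_eq_iff algebra_simps split: sum.split)
    show "L2_ip M (rep_op i x) y = L2_ip M x (rep_op (map_sum (\<lambda>g. inv g) cnj i) y)"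
      using i x y HL2 by (auto simp: rep_op_def koopman_adj L2_ip_mult)
  next
    fix i assume i: "i \<in> ?I"
    fix x y assume x: "x \<in> L2 cntG" and y: "y \<in> L2 cntG"
    show "reg_op i x \<in> L2 cntG" using i x by (auto simp: reg_op_def left_regular_L2 L2_mult)
    show "reg_op i (x - y) = reg_op i x - reg_op i y"
      by (auto simp: reg_op_def left_regular_def fun_eq_iff algebra_simps split: sum.split)
    show "L2_ip cntG (reg_op i x) y = L2_ip cntG x (reg_op (map_sum (\<lambda>g. inv g) cnj i) y)"
      using i x y by (auto simp: reg_op_def left_regular_adj L2_ip_mult)
  next
    show "coeff_graph H \<xi> \<subseteq> H \<times> L2 cntG" by (auto simp: coeff_graph_def)
    show "subspace (coeff_graph H \<xi>)" using H by (rule coeff_graph_subspace)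
    fix i x y assume "i \<in> ?I" "(x, y) \<in> coeff_graph H \<xi>"
    then show "(rep_op i x, reg_op i y) \<in> coeff_graph H \<xi>"
      using coeff_graph_mult[OF H] coeff_graph_koopman[OF inv_H] by (auto simp: rep_op_def reg_op_def)
  qed
qed

text \<open>\<xi> itself has the coefficient function concentrated at the identity, so the dichotomy
  of \<open>approx_or_embeds\<close> applies to it; singularity excludes the embedding.\<close>

theorem small_coefficients:
  assumes inv_H: "invariant_subspace G M (koopman G a) H"
    and sing: "singular_reps G M (koopman G a) H cntG (left_regular G) (L2 cntG)"
    and \<xi>: "\<xi> \<in> H" and e: "e > 0"
  shows "\<exists>F c. finite F \<and> F \<subseteq> carrier G \<and> (\<Sum>g\<in>F. (cmod (c g))\<^sup>2) < e\<^sup>2 \<and>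
    L2_norm M (\<lambda>x. \<xi> x - (\<Sum>g\<in>F. c g * \<xi> (a (inv g) x))) < e"
proof -
  have H: "closed_subspace M H" using inv_H by (simp add: invariant_subspace_def)
  have HL2: "f \<in> L2 M" if "f \<in> H" for f using H that by (auto simp: closed_subspace_def)
  let ?D = "coeff_graph H \<xi>" and ?I = "Inl ` carrier G \<union> range Inr :: ('g + complex) set"
  interpret hg: hilbert_graph H "L2_ip M" "L2 cntG" "L2_ip cntG" ?I rep_op reg_op "map_sum (\<lambda>g. inv g) cnj" ?D
    by (rule hilbert_graph_coeff[OF inv_H])
  have Vn: "hg.V.nrm f = L2_norm M f" and Wn: "hg.W.nrm c = L2_norm cntG c" for f c
    by (auto simp: hg.V.nrm_def hg.W.nrm_def L2_norm_ip)
  have AE_W: "AE y in cntG. f y = h y" if "f \<in> L2 cntG" "h \<in> L2 cntG" "hg.W.nrm (f - h) = 0" for f h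
    using that by (intro L2_norm_diff_AE hg.W.semi_hilbert_axioms)
  have "\<not> (\<exists>K T. K \<subseteq> H \<and> subspace K \<and> (\<forall>x\<in>H. (\<forall>e>0. \<exists>k\<in>K. hg.V.nrm (x - k) < e) \<longrightarrow> x \<in> K) \<and>
      (\<exists>k\<in>K. hg.V.nrm k \<noteq> 0) \<and> (\<forall>i\<in>?I. \<forall>k\<in>K. rep_op i k \<in> K) \<and> (\<forall>k\<in>K. T k \<in> L2 cntG) \<and>
      (\<forall>f\<in>K. \<forall>h\<in>K. hg.W.nrm (T (f + h) - (T f + T h)) = 0) \<and>
      (\<forall>f\<in>K. hg.W.nrm (T f) = hg.V.nrm f) \<and>
      (\<forall>i\<in>?I. \<forall>f\<in>K. hg.W.nrm (T (rep_op i f) - reg_op i (T f)) = 0))"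
  proof (intro notI, elim exE conjE)
    fix K T
    assume K: "K \<subseteq> H" "subspace K" and K_closed: "\<forall>x\<in>H. (\<forall>e>0. \<exists>k\<in>K. hg.V.nrm (x - k) < e) \<longrightarrow> x \<in> K"
      and nz: "\<exists>k\<in>K. hg.V.nrm k \<noteq> 0" and KI: "\<forall>i\<in>?I. \<forall>k\<in>K. rep_op i k \<in> K"
      and T: "\<forall>k\<in>K. T k \<in> L2 cntG"
      and T_add: "\<forall>f\<in>K. \<forall>h\<in>K. hg.W.nrm (T (f + h) - (T f + T h)) = 0"
      and T_nrm: "\<forall>f\<in>K. hg.W.nrm (T f) = hg.V.nrm f"
      and T_op: "\<forall>i\<in>?I. \<forall>f\<in>K. hg.W.nrm (T (rep_op i f) - reg_op i (T f)) = 0"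
    have K_mult: "(\<lambda>x. c * f x) \<in> K" if "f \<in> K" for c f
    proof -
      have "Inr c \<in> ?I" by simp
      then have "rep_op (Inr c) f \<in> K" using KI that by blast
      then show ?thesis by (simp add: rep_op_def)
    qed
    have K_koop: "koopman G a g f \<in> K" if "f \<in> K" "g \<in> carrier G" for g f
    proof -
      have "Inl g \<in> ?I" using that by simp
      then have "rep_op (Inl g) f \<in> K" using KI that by blast
      then show ?thesis by (simp add: rep_op_def)
    qed
    have K_add: "(\<lambda>x. f x + h x) \<in> K" if "f \<in> K" "h \<in> K" for f h
      using subspace_add[OF K(2) that] by (simp add: plus_fun_def)
    \<comment> \<open>\<open>K\<close> is known to be closed relative to \<open>H\<close>, and
      \<open>H\<close> is closed in L2.\<close>
    have "f \<in> K" if f: "f \<in> L2 M" and ap: "\<forall>\<epsilon>>0. \<exists>h\<in>K. L2_norm M (\<lambda>x. f x - h x) < \<epsilon>" for f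
    proof -
      have "\<forall>\<epsilon>>0. \<exists>h\<in>H. L2_norm M (\<lambda>x. f x - h x) < \<epsilon>" using ap K(1) by (meson subsetD)
      then have "f \<in> H" using H f by (simp add: closed_subspace_def)
      then show ?thesis using K_closed ap by (auto simp: Vn fun_diff_def)
    qed
    then have "closed_subspace M K"
      unfolding closed_subspace_def using K HL2 K_mult K_add subspace_0[OF K(2)] by (auto simp: zero_fun_def)
    then have "invariant_subspace G M (koopman G a) K"
      using K_koop by (simp add: invariant_subspace_def)
    moreover obtain k where k: "k \<in> K" "hg.V.nrm k \<noteq> 0" using nz by blast
    then have "\<not> (AE x in M. k x = 0)" using L2_norm_eq_0[of k M] K HL2 by (auto simp: Vn)
    moreover have "rep_embeds G M (koopman G a) K cntG (left_regular G) (L2 cntG)"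
      unfolding rep_embeds_def
    proof (intro exI[of _ T] conjI ballI allI)
      fix f h assume f: "f \<in> K" and h: "h \<in> K"
      have "hg.W.nrm (T (\<lambda>x. f x + h x) - (\<lambda>y. T f y + T h y)) = 0"
        using T_add f h by (simp add: plus_fun_def)
      then show "AE y in cntG. T (\<lambda>x. f x + h x) y = T f y + T h y"
        using f h T K_add by (intro AE_W[OF _ L2_add]) simp_all
    next
      fix c f assume f: "f \<in> K"
      have "hg.W.nrm (T (rep_op (Inr c) f) - reg_op (Inr c) (T f)) = 0" using T_op f by auto
      then have "hg.W.nrm (T (\<lambda>x. c * f x) - (\<lambda>y. c * T f y)) = 0" by (simp add: rep_op_def reg_op_def)
      then show "AE y in cntG. T (\<lambda>x. c * f x) y = c * T f y"
        using f T K_mult by (intro AE_W[OF _ L2_mult]) simp_all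
    next
      fix g f assume g: "g \<in> carrier G" and f: "f \<in> K"
      have "hg.W.nrm (T (rep_op (Inl g) f) - reg_op (Inl g) (T f)) = 0" using T_op f g by blast
      then have "hg.W.nrm (T (koopman G a g f) - left_regular G g (T f)) = 0" by (simp add: rep_op_def reg_op_def)
      then show "AE y in cntG. T (koopman G a g f) y = left_regular G g (T f) y"
        using f g T K_koop by (intro AE_W[OF _ left_regular_L2]) simp_all
    next
      fix f assume "f \<in> K" then show "L2_norm cntG (T f) = L2_norm M f" using T_nrm by (simp add: Vn Wn)
    qed (use T in auto)
    ultimately show False using sing k K(1) unfolding singular_reps_def by blast
  qed
  then have approx: "\<forall>(x, w)\<in>?D. \<forall>e>0. \<exists>(y, z)\<in>?D. hg.V.nrm (x - y) < e \<and> hg.W.nrm z < e"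
    using hg.approx_or_embeds by blast
  define \<delta> where "\<delta> g = (if g = \<one> then 1 else 0 :: complex)" for g
  have "integrable cntG (\<lambda>g. (cmod (\<delta> g))\<^sup>2)"
  proof -
    have "(\<lambda>g. (cmod (\<delta> g))\<^sup>2) = indicator {\<one>}"
      by (auto simp: \<delta>_def fun_eq_iff)
    moreover have "integrable cntG (indicator {\<one>} :: _ \<Rightarrow> real)"
      by (rule integrable_real_indicator) (auto simp: emeasure_count_space)
    ultimately show ?thesis by simp
  qed
  then have "\<delta> \<in> L2 cntG" by (simp add: L2_def)
  moreover have "AE x in M. \<xi> x = (\<Sum>g\<in>{\<one>}. \<delta> g * \<xi> (a (inv g) x))"
    by (rule AE_I2) (simp add: act_one \<delta>_def)
  ultimately have "(\<xi>, \<delta>) \<in> ?D"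
    using \<xi> by (intro coeff_graphI[where F = "{\<one>}"]) (auto simp: \<delta>_def)
  with approx e obtain y c where yc: "(y, c) \<in> ?D" "hg.V.nrm (\<xi> - y) < e" "hg.W.nrm c < e" by fast
  from yc(1) obtain F where F: "y \<in> H" "c \<in> L2 cntG" "finite F" "F \<subseteq> carrier G" "\<forall>g\<in>carrier G - F. c g = 0"
    "AE x in M. y x = (\<Sum>g\<in>F. c g * \<xi> (a (inv g) x))"
    by (rule coeff_graphE)
  have "(L2_norm cntG c)\<^sup>2 = (\<integral>g. (cmod (c g))\<^sup>2 \<partial>cntG)" by (simp add: L2_norm_def)
  also have "\<dots> = (\<Sum>g | g \<in> carrier G \<and> (cmod (c g))\<^sup>2 \<noteq> 0. (cmod (c g))\<^sup>2)"
    by (rule lebesgue_integral_count_space_finite_support, rule finite_subset[OF _ F(3)]) (use F(5) in auto)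
  also have "\<dots> = (\<Sum>g\<in>F. (cmod (c g))\<^sup>2)"
    by (rule sum.mono_neutral_left) (use F in auto)
  finally have "(\<Sum>g\<in>F. (cmod (c g))\<^sup>2) = (L2_norm cntG c)\<^sup>2" by simp
  also have "\<dots> < e\<^sup>2" using yc(3) by (intro power_strict_mono) (auto simp: Wn L2_norm_def)
  finally have s: "(\<Sum>g\<in>F. (cmod (c g))\<^sup>2) < e\<^sup>2" .
  have "L2_norm M (\<lambda>x. \<xi> x - (\<Sum>g\<in>F. c g * \<xi> (a (inv g) x))) = L2_norm M (\<lambda>x. \<xi> x - y x)"
    unfolding L2_norm_def
  proof (rule arg_cong[where f = sqrt], rule integral_cong_AE)
    have [measurable]: "\<xi> \<in> borel_measurable M" "y \<in> borel_measurable M" using L2D(1)[OF HL2[OF \<xi>]] L2D(1)[OF HL2[OF F(1)]] .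
    have [measurable]: "(\<lambda>x. \<xi> (a (inv g) x)) \<in> borel_measurable M" if "g \<in> F" for g
      by (rule measurable_compose[OF act_meas]) (use that F(4) in auto)
    show "(\<lambda>x. (cmod (\<xi> x - (\<Sum>g\<in>F. c g * \<xi> (a (inv g) x))))\<^sup>2) \<in> borel_measurable M"
      by (intro borel_measurable_power borel_measurable_norm borel_measurable_diff borel_measurable_sum borel_measurable_times) auto
    show "(\<lambda>x. (cmod (\<xi> x - y x))\<^sup>2) \<in> borel_measurable M" by measurable
    show "AE x in M. (cmod (\<xi> x - (\<Sum>g\<in>F. c g * \<xi> (a (inv g) x))))\<^sup>2 = (cmod (\<xi> x - y x))\<^sup>2"
      using F(6) by eventually_elim simp
  qed
  also have "\<dots> < e" using yc(2) by (simp add: Vn fun_diff_def)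
  finally show ?thesis using F s by blast
qed

end

section \<open>Counting and rounding\<close>

text \<open>Counting with exponential weights: the number of elements of weight at most \<open>m\<close> is at most
  \<open>exp (\<theta> m)\<close> times the sum of \<open>exp (- \<theta> weight)\<close>, and the latter sum is a product.\<close>

lemma card_le_weighted_PiE:
  fixes w :: "'j \<Rightarrow> 'c \<Rightarrow> real"
  assumes J: "finite J" and C: "finite C" and \<theta>: "\<theta> \<ge> 0"
    and B: "\<And>j. j \<in> J \<Longrightarrow> (\<Sum>c\<in>C. exp (- \<theta> * w j c)) \<le> 1 + b"
  shows "real (card {y \<in> J \<rightarrow>\<^sub>E C. (\<Sum>j\<in>J. w j (y j)) \<le> m}) \<le> exp (\<theta> * m) * exp (b * card J)"
proof -
  let ?Y = "{y \<in> J \<rightarrow>\<^sub>E C. (\<Sum>j\<in>J. w j (y j)) \<le> m}"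
  have fin: "finite (J \<rightarrow>\<^sub>E C)" using J C by (intro finite_PiE) auto
  have "real (card ?Y) * exp (- \<theta> * m) = (\<Sum>y\<in>?Y. exp (- \<theta> * m))" by simp
  also have "\<dots> \<le> (\<Sum>y\<in>?Y. exp (- \<theta> * (\<Sum>j\<in>J. w j (y j))))"
    using \<theta> by (intro sum_mono) (auto intro: mult_left_mono)
  also have "\<dots> \<le> (\<Sum>y\<in>J \<rightarrow>\<^sub>E C. exp (- \<theta> * (\<Sum>j\<in>J. w j (y j))))"
    using fin by (intro sum_mono2) auto
  also have "\<dots> = (\<Sum>y\<in>J \<rightarrow>\<^sub>E C. \<Prod>j\<in>J. exp (- \<theta> * w j (y j)))"
    using J by (simp add: exp_sum[symmetric] sum_distrib_left sum_negf)
  also have "\<dots> = (\<Prod>j\<in>J. \<Sum>c\<in>C. exp (- \<theta> * w j c))"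
    using J C by (intro prod_sum_PiE[symmetric]) auto
  also have "\<dots> \<le> (\<Prod>j\<in>J. 1 + b)" using B by (intro prod_mono) (auto intro: sum_nonneg)
  also have "\<dots> \<le> (\<Prod>j\<in>J. exp b)"
  proof (intro prod_mono conjI)
    fix j assume "j \<in> J"
    then show "0 \<le> 1 + b" using B[of j] by (meson exp_ge_zero order_trans sum_nonneg)
  qed (rule exp_ge_add_one_self)
  also have "\<dots> = exp (b * card J)" by (simp add: exp_of_nat_mult[symmetric] mult.commute)
  finally show ?thesis by (simp add: exp_minus field_simps)
qed

text \<open>The choice exp(-\<theta>) = 1 / (2 + K / \<kappa>) meets both bounds at once; \<theta>
  will be the cost per error in the counting arguments.\<close>

lemma exp_weight:
  fixes K \<kappa> :: real
  assumes "K \<ge> 0" "\<kappa> > 0"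
  obtains \<theta> where "\<theta> > 0" "K * exp (- \<theta>) \<le> \<kappa>" "exp (- \<theta>) \<le> 1/2"
proof
  let ?\<theta> = "ln (2 + K / \<kappa>)"
  have pos: "2 + K / \<kappa> > 1" using assms by (smt (verit) divide_nonneg_pos)
  then show "?\<theta> > 0" by simp
  have e: "exp (- ?\<theta>) = 1 / (2 + K / \<kappa>)" using pos by (simp add: exp_minus inverse_eq_divide)
  have "0 \<le> K / \<kappa>" using assms by simp
  then show "exp (- ?\<theta>) \<le> 1/2" unfolding e by (intro frac_le) auto
  have "K \<le> \<kappa> * (2 + K / \<kappa>)" using assms by (simp add: distrib_left)
  then show "K * exp (- ?\<theta>) \<le> \<kappa>" unfolding e using pos by (simp add: divide_le_eq)
qed

text \<open>A letter costs 0 if it agrees with the centre and 1 otherwise. The radius \<kappa> / (2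
  \<theta>) lets the factor exp(\<theta> m) and the product cost \<kappa> / 2 each. It depends on K
  and \<kappa> alone, so it can be fixed before the observables that produce the words.\<close>

lemma hamming_ball_entropy:
  fixes K \<kappa> :: real
  assumes "K \<ge> 0" "\<kappa> > 0"
  obtains \<eta> :: real where "\<eta> > 0"
    "\<And>(J::'j set) (C::'c set) (y0 :: 'j \<Rightarrow> 'c). finite J \<Longrightarrow> finite C \<Longrightarrow> real (card C) \<le> K \<Longrightarrow>
      real (card {y \<in> J \<rightarrow>\<^sub>E C. real (card {j\<in>J. y j \<noteq> y0 j}) \<le> \<eta> * card J}) \<le> exp (\<kappa> * card J)"
proof -
  obtain \<theta> where \<theta>: "\<theta> > 0" "K * exp (- \<theta>) \<le> \<kappa> / 2" using exp_weight[of K "\<kappa> / 2"] assms by auto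
  show thesis
  proof (rule that[of "\<kappa> / (2 * \<theta>)"])
    show "\<kappa> / (2 * \<theta>) > 0" using \<theta> assms by simp
    fix J :: "'j set" and C :: "'c set" and y0 :: "'j \<Rightarrow> 'c"
    assume J: "finite J" and C: "finite C" "real (card C) \<le> K"
    let ?w = "\<lambda>j c. if c = y0 j then 0 else 1 :: real"
    have "real (card {y \<in> J \<rightarrow>\<^sub>E C. (\<Sum>j\<in>J. ?w j (y j)) \<le> \<kappa> / (2 * \<theta>) * card J})
      \<le> exp (\<theta> * (\<kappa> / (2 * \<theta>) * card J)) * exp (\<kappa> / 2 * card J)"
    proof (rule card_le_weighted_PiE[OF J C(1)])
      fix j
      have "(\<Sum>c\<in>C. exp (- \<theta> * ?w j c)) \<le> (\<Sum>c\<in>C. (if c = y0 j then 1 else 0) + exp (- \<theta>))"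
        by (intro sum_mono) auto
      also have "\<dots> \<le> 1 + card C * exp (- \<theta>)" using C(1) by (simp add: sum.distrib sum.delta')
      also have "\<dots> \<le> 1 + K * exp (- \<theta>)" using C by (intro add_left_mono mult_right_mono) auto
      finally show "(\<Sum>c\<in>C. exp (- \<theta> * ?w j c)) \<le> 1 + \<kappa> / 2" using \<theta> by simp
    qed (use \<theta> in simp)
    also have "\<dots> = exp (\<kappa> * card J)" using \<theta> by (simp add: exp_add[symmetric])
    moreover have "(\<Sum>j\<in>J. ?w j (y j)) = real (card {j\<in>J. y j \<noteq> y0 j})" for y
      using J by (simp add: sum.If_cases Int_def)
    ultimately show "real (card {y \<in> J \<rightarrow>\<^sub>E C. real (card {j\<in>J. y j \<noteq> y0 j}) \<le> \<kappa> / (2 * \<theta>) * card J}) \<le> exp (\<kappa> * card J)"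
      by simp
  qed
qed

text \<open>The two-sided geometric series is 1 + 2 q / (1 - q) <= 1 + 4 q for q <= 1/2. The
  subtracted power is the slack that carries the induction.\<close>

lemma sum_power_abs_le:
  fixes q :: real
  assumes "0 \<le> q" "q \<le> 1/2"
  shows "(\<Sum>c\<in>{- int N..int N}. q ^ nat \<bar>c\<bar>) \<le> 1 + 4 * q - 4 * q ^ Suc N"
proof (induction N)
  case (Suc N)
  have "{- int (Suc N)..int (Suc N)} = insert (- int (Suc N)) (insert (int (Suc N)) {- int N..int N})"
    by auto
  then have "(\<Sum>c\<in>{- int (Suc N)..int (Suc N)}. q ^ nat \<bar>c\<bar>) = 2 * q ^ Suc N + (\<Sum>c\<in>{- int N..int N}. q ^ nat \<bar>c\<bar>)"
    by (simp add: nat_add_distrib)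
  also have "\<dots> \<le> 1 + 4 * q - 2 * q ^ Suc N" using Suc by simp
  also have "\<dots> \<le> 1 + 4 * q - 4 * q ^ Suc (Suc N)"
    using mult_left_mono[OF assms(2), of "q ^ Suc N"] assms by (simp add: mult.commute)
  finally show ?case .
qed simp

text \<open>The Hamming argument with cost |c| for the entry c: the alphabet is infinite, but the
  geometric series of the costs converges, uniformly in the height of the entries.\<close>

lemma lattice_entropy:
  fixes \<kappa> :: real
  assumes "\<kappa> > 0"
  obtains \<eta> :: real where "\<eta> > 0"
    "\<And>J::'j set. finite J \<Longrightarrow> finite {a \<in> J \<rightarrow>\<^sub>E (UNIV::int set). (\<Sum>j\<in>J. \<bar>real_of_int (a j)\<bar>) \<le> \<eta> * card J} \<and>
      real (card {a \<in> J \<rightarrow>\<^sub>E (UNIV::int set). (\<Sum>j\<in>J. \<bar>real_of_int (a j)\<bar>) \<le> \<eta> * card J}) \<le> exp (\<kappa> * card J)"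
proof -
  obtain \<theta> where \<theta>: "\<theta> > 0" "4 * exp (- \<theta>) \<le> \<kappa> / 2" "exp (- \<theta>) \<le> 1/2" using exp_weight[of 4 "\<kappa> / 2"] assms by auto
  show thesis
  proof (rule that[of "\<kappa> / (2 * \<theta>)"])
    show "\<kappa> / (2 * \<theta>) > 0" using \<theta> assms by simp
    fix J :: "'j set" assume J: "finite J"
    define m where "m = \<kappa> / (2 * \<theta>) * card J"
    \<comment> \<open>A vector of l1 norm at most m has entries at most m in absolute value, which
      cuts the alphabet down to a finite one.\<close>
    define C where "C = {- int (nat \<lfloor>m\<rfloor>)..int (nat \<lfloor>m\<rfloor>)}"
    have m: "m \<ge> 0" using \<theta> assms by (simp add: m_def)
    let ?A = "{a \<in> J \<rightarrow>\<^sub>E (UNIV::int set). (\<Sum>j\<in>J. \<bar>real_of_int (a j)\<bar>) \<le> m}"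
    let ?B = "{a \<in> J \<rightarrow>\<^sub>E C. (\<Sum>j\<in>J. \<bar>real_of_int (a j)\<bar>) \<le> m}"
    have "?A \<subseteq> ?B"
    proof
      fix a assume a: "a \<in> ?A"
      have "a j \<in> C" if "j \<in> J" for j
      proof -
        have "\<bar>real_of_int (a j)\<bar> \<le> (\<Sum>j\<in>J. \<bar>real_of_int (a j)\<bar>)"
          using J that by (intro member_le_sum) auto
        then have "\<bar>real_of_int (a j)\<bar> \<le> m" using a by simp
        then have "\<bar>a j\<bar> \<le> \<lfloor>m\<rfloor>" by (simp add: le_floor_iff)
        then show ?thesis unfolding C_def using m by auto
      qed
      then show "a \<in> ?B" using a by (auto simp: PiE_iff)
    qed
    then have AB: "?A = ?B" by (auto simp: PiE_iff)
    have "finite (J \<rightarrow>\<^sub>E C)" using J by (intro finite_PiE) (auto simp: C_def)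
    then have fin: "finite ?A" unfolding AB by simp
    have "real (card ?B) \<le> exp (\<theta> * m) * exp (\<kappa> / 2 * card J)"
    proof (rule card_le_weighted_PiE[OF J])
      have q: "exp (- \<theta> * \<bar>real_of_int c\<bar>) = exp (- \<theta>) ^ nat \<bar>c\<bar>" for c
        by (simp add: exp_of_nat_mult[symmetric] mult.commute)
      have "(\<Sum>c\<in>C. exp (- \<theta>) ^ nat \<bar>c\<bar>) \<le> 1 + 4 * exp (- \<theta>) - 4 * exp (- \<theta>) ^ Suc (nat \<lfloor>m\<rfloor>)"
        unfolding C_def using \<theta> by (intro sum_power_abs_le) auto
      also have "\<dots> \<le> 1 + 4 * exp (- \<theta>)" by simp
      finally show "(\<Sum>c\<in>C. exp (- \<theta> * \<bar>real_of_int c\<bar>)) \<le> 1 + \<kappa> / 2" unfolding q using \<theta> by simp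
    qed (use \<theta> in \<open>auto simp: C_def\<close>)
    also have "\<dots> = exp (\<kappa> * card J)" using \<theta> by (simp add: m_def exp_add[symmetric])
    finally show "finite {a \<in> J \<rightarrow>\<^sub>E (UNIV::int set). (\<Sum>j\<in>J. \<bar>real_of_int (a j)\<bar>) \<le> \<kappa> / (2 * \<theta>) * card J} \<and>
      real (card {a \<in> J \<rightarrow>\<^sub>E (UNIV::int set). (\<Sum>j\<in>J. \<bar>real_of_int (a j)\<bar>) \<le> \<kappa> / (2 * \<theta>) * card J}) \<le> exp (\<kappa> * card J)"
      using fin AB unfolding m_def by simp
  qed
qed

section \<open>Rounding to a sparse lattice\<close>

lemma convex_comb_choice:
  fixes x y z p :: real
  assumes "0 \<le> p" "p \<le> 1" "(1 - p) * x + p * y \<le> z"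
  shows "x \<le> z \<or> y \<le> z"
proof (rule ccontr)
  assume "\<not> (x \<le> z \<or> y \<le> z)"
  then have "x > z" "y > z" by auto
  then have "(1 - p) * (x - z) \<ge> 0" "p * (y - z) \<ge> 0" "(1 - p) * (x - z) > 0 \<or> p * (y - z) > 0"
    using assms by (cases "p = 0"; auto)+
  then show False using assms(3) by (simp add: algebra_simps)
qed

text \<open>Randomised rounding, derandomised one coordinate at a time: rounding \<open>r\<close> up with
  probability \<open>frac r\<close> keeps the mean, and adds a variance of at most \<open>1/4\<close>.\<close>

lemma rounding:
  fixes r :: "'j \<Rightarrow> real" and t :: "'j \<Rightarrow> 'k \<Rightarrow> complex" and u :: "'k \<Rightarrow> complex" and \<omega> :: real
  assumes J: "finite J" and K: "finite K" and \<omega>: "\<omega> \<ge> 0"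
  shows "\<exists>a :: 'j \<Rightarrow> int.
    (\<Sum>k\<in>K. (cmod (u k + (\<Sum>j\<in>J. of_real (of_int (a j) - r j) * t j k)))\<^sup>2) + \<omega> * (\<Sum>j\<in>J. \<bar>real_of_int (a j)\<bar>)
    \<le> (\<Sum>k\<in>K. (cmod (u k))\<^sup>2) + (\<Sum>j\<in>J. \<Sum>k\<in>K. (cmod (t j k))\<^sup>2) / 4 + \<omega> * (\<Sum>j\<in>J. \<bar>r j\<bar>)"
  using J
proof (induction J arbitrary: u rule: finite_induct)
  case (insert i J)
  define p where "p = frac (r i)"
  define n where "n = \<lfloor>r i\<rfloor>"
  have p: "0 \<le> p" "p < 1" "r i = n + p" by (auto simp: p_def n_def frac_def) linarith
  \<comment> \<open>\<open>u0\<close> and \<open>u1\<close> are the accumulated errors after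
    rounding coordinate i down or up.\<close>
  define u0 where "u0 k = u k - of_real p * t i k" for k
  define u1 where "u1 k = u k + of_real (1 - p) * t i k" for k
  let ?U = "\<lambda>u. \<Sum>k\<in>K. (cmod (u k))\<^sup>2"
  have pt: "(1 - p) * (cmod (x - of_real p * y))\<^sup>2 + p * (cmod (x + of_real (1 - p) * y))\<^sup>2
      = (cmod x)\<^sup>2 + p * (1 - p) * (cmod y)\<^sup>2" for x y
    by (simp add: cmod_power2) (simp add: power2_eq_square algebra_simps)
  have "(1 - p) * ?U u0 + p * ?U u1 = (\<Sum>k\<in>K. (cmod (u k))\<^sup>2 + p * (1 - p) * (cmod (t i k))\<^sup>2)"
    unfolding sum_distrib_left sum.distrib[symmetric] u0_def u1_def pt ..
  also have "\<dots> = ?U u + p * (1 - p) * ?U (t i)" by (simp add: sum.distrib sum_distrib_left)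
  also have "p * (1 - p) * ?U (t i) \<le> 1/4 * ?U (t i)"
  proof (rule mult_right_mono)
    have "0 \<le> (p - 1/2)\<^sup>2" by simp
    then show "p * (1 - p) \<le> 1/4" by (simp add: power2_eq_square algebra_simps)
  qed (auto intro: sum_nonneg)
  finally have U: "(1 - p) * ?U u0 + p * ?U u1 \<le> ?U u + ?U (t i) / 4" by simp
  \<comment> \<open>The absolute value is affine between consecutive integers, so the l1 term is
    preserved in the mean as well.\<close>
  have A: "(1 - p) * \<bar>real_of_int n\<bar> + p * \<bar>real_of_int (n + 1)\<bar> = \<bar>r i\<bar>"
  proof (cases "n \<ge> 0")
    case True
    then show ?thesis using p by (simp add: algebra_simps)
  next
    case False
    then have "\<bar>real_of_int n\<bar> = - real_of_int n" "\<bar>real_of_int (n + 1)\<bar> = - real_of_int n - 1" by auto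
    moreover have "\<bar>r i\<bar> = - (n + p)" using p False by linarith
    ultimately show ?thesis by (simp add: algebra_simps)
  qed
  have "(1 - p) * (?U u0 + \<omega> * \<bar>real_of_int n\<bar>) + p * (?U u1 + \<omega> * \<bar>real_of_int (n + 1)\<bar>)
      = (1 - p) * ?U u0 + p * ?U u1 + \<omega> * ((1 - p) * \<bar>real_of_int n\<bar> + p * \<bar>real_of_int (n + 1)\<bar>)"
    by (simp add: algebra_simps)
  then have "(1 - p) * (?U u0 + \<omega> * \<bar>real_of_int n\<bar>) + p * (?U u1 + \<omega> * \<bar>real_of_int (n + 1)\<bar>)
      \<le> ?U u + ?U (t i) / 4 + \<omega> * \<bar>r i\<bar>" using U A by simp
  then have "?U u0 + \<omega> * \<bar>real_of_int n\<bar> \<le> ?U u + ?U (t i) / 4 + \<omega> * \<bar>r i\<bar> \<or>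
      ?U u1 + \<omega> * \<bar>real_of_int (n + 1)\<bar> \<le> ?U u + ?U (t i) / 4 + \<omega> * \<bar>r i\<bar>"
    using p by (intro convex_comb_choice[of p]) auto
  moreover have ueq: "u0 = (\<lambda>k. u k + of_real (of_int n - r i) * t i k)"
    "u1 = (\<lambda>k. u k + of_real (of_int (n + 1) - r i) * t i k)"
    using p by (auto simp: u0_def u1_def algebra_simps fun_eq_iff)
  ultimately have "\<exists>b::int. (\<Sum>k\<in>K. (cmod (u k + of_real (of_int b - r i) * t i k))\<^sup>2) + \<omega> * \<bar>real_of_int b\<bar>
      \<le> ?U u + ?U (t i) / 4 + \<omega> * \<bar>r i\<bar>"
    unfolding ueq by (elim disjE) (rule exI, assumption)+
  then obtain b :: int where b:
    "(\<Sum>k\<in>K. (cmod (u k + of_real (of_int b - r i) * t i k))\<^sup>2) + \<omega> * \<bar>real_of_int b\<bar>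
      \<le> ?U u + ?U (t i) / 4 + \<omega> * \<bar>r i\<bar>" by blast
  obtain a :: "'j \<Rightarrow> int" where a:
    "(\<Sum>k\<in>K. (cmod ((u k + of_real (of_int b - r i) * t i k) + (\<Sum>j\<in>J. of_real (of_int (a j) - r j) * t j k)))\<^sup>2)
      + \<omega> * (\<Sum>j\<in>J. \<bar>real_of_int (a j)\<bar>)
    \<le> (\<Sum>k\<in>K. (cmod (u k + of_real (of_int b - r i) * t i k))\<^sup>2)
      + (\<Sum>j\<in>J. \<Sum>k\<in>K. (cmod (t j k))\<^sup>2) / 4 + \<omega> * (\<Sum>j\<in>J. \<bar>r j\<bar>)"
    using insert.IH[of "\<lambda>k. u k + of_real (of_int b - r i) * t i k"] by blast
  have "(\<Sum>j\<in>J. of_real (of_int ((a(i := b)) j) - r j) * t j k) = (\<Sum>j\<in>J. of_real (of_int (a j) - r j) * t j k)" for k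
    using insert.hyps by (intro sum.cong) auto
  moreover have "(\<Sum>j\<in>J. \<bar>real_of_int ((a(i := b)) j)\<bar>) = (\<Sum>j\<in>J. \<bar>real_of_int (a j)\<bar>)"
    using insert.hyps by (intro sum.cong) auto
  ultimately show ?case
    using a b insert.hyps
    by (intro exI[of _ "a(i := b)"]) (simp add: add.assoc distrib_left add_divide_distrib)
qed auto

text \<open>The image, under the matrix with columns \<open>t j\<close>, of the vector with entries
  L (a(j, False) + i a(j, True)); the boolean separates real from imaginary parts.\<close>

definition lattice_vector :: "real \<Rightarrow> nat \<Rightarrow> (nat \<Rightarrow> nat \<Rightarrow> complex) \<Rightarrow> (nat \<times> bool \<Rightarrow> int) \<Rightarrow> nat \<Rightarrow> complex" where
  "lattice_vector L d t a k = (\<Sum>(j, b)\<in>{1..d} \<times> UNIV.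
     of_int (a (j, b)) * (of_real L * (if b then \<i> else 1) * t j k))"

text \<open>One rounding has to be good in two respects, small mean square error and small l1 norm,
  so \<open>rounding\<close> is applied to their sum with a weight \<omega>.\<close>

lemma rounding_complex:
  fixes v :: "nat \<Rightarrow> complex" and t :: "nat \<Rightarrow> nat \<Rightarrow> complex" and \<eta> R s L :: real
  assumes pos: "\<eta> > 0" "R > 0" "s > 0" and L: "L = 2 * R / \<eta>"
    and t: "(\<Sum>j\<in>{1..d}. \<Sum>k\<in>{1..d}. (cmod (t j k))\<^sup>2) \<le> s\<^sup>2 / L\<^sup>2 * d"
    and v: "(\<Sum>j\<in>{1..d}. cmod (v j)) \<le> R * d"
  obtains a where "a \<in> ({1..d} \<times> UNIV) \<rightarrow>\<^sub>E (UNIV::int set)"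
    "(\<Sum>p\<in>{1..d} \<times> UNIV. \<bar>real_of_int (a p)\<bar>) \<le> \<eta> * card ({1..d} \<times> (UNIV::bool set))"
    "(\<Sum>k\<in>{1..d}. (cmod (lattice_vector L d t a k - (\<Sum>j\<in>{1..d}. v j * t j k)))\<^sup>2) \<le> s\<^sup>2 * d"
proof -
  let ?J = "{1..d} \<times> (UNIV::bool set)"
  have L0: "L > 0" using pos L by simp
  define r where "r p = (if snd p then Im (v (fst p)) else Re (v (fst p))) / L" for p
  define t' where "t' p k = of_real L * (if snd p then \<i> else 1) * t (fst p) k" for p k
  \<comment> \<open>This weight splits the budget s^2 d evenly: the variance and the l1 norm of r
    contribute at most s^2 d / 2 each. Conversely s^2 d / \<omega> = 2 \<eta> d, which is \<eta>
    times the number of coordinates.\<close>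
  define \<omega> where "\<omega> = s\<^sup>2 * L / (4 * R)"
  have \<omega>: "\<omega> > 0" using pos L0 by (simp add: \<omega>_def)
  obtain a0 :: "nat \<times> bool \<Rightarrow> int" where a0:
    "(\<Sum>k\<in>{1..d}. (cmod (0 + (\<Sum>p\<in>?J. of_real (of_int (a0 p) - r p) * t' p k)))\<^sup>2) + \<omega> * (\<Sum>p\<in>?J. \<bar>real_of_int (a0 p)\<bar>)
    \<le> (\<Sum>k\<in>{1..d}. (cmod 0)\<^sup>2) + (\<Sum>p\<in>?J. \<Sum>k\<in>{1..d}. (cmod (t' p k))\<^sup>2) / 4 + \<omega> * (\<Sum>p\<in>?J. \<bar>r p\<bar>)"
    using rounding[of ?J "{1..d}" \<omega> "\<lambda>k. 0" r t'] \<omega> by auto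
  define a where "a = restrict a0 ?J"
  have pairs: "(\<Sum>p\<in>?J. f p) = (\<Sum>j\<in>{1..d}. f (j, False) + f (j, True))" for f :: "nat \<times> bool \<Rightarrow> 'z::comm_monoid_add"
    using sum.cartesian_product[of "\<lambda>j b. f (j, b)" UNIV "{1..d}", symmetric]
    by (simp add: UNIV_bool add.commute del: atLeastAtMost_iff)
  have "(\<Sum>p\<in>?J. \<Sum>k\<in>{1..d}. (cmod (t' p k))\<^sup>2) = 2 * L\<^sup>2 * (\<Sum>j\<in>{1..d}. \<Sum>k\<in>{1..d}. (cmod (t j k))\<^sup>2)"
    unfolding pairs using L0
    by (simp add: t'_def norm_mult power_mult_distrib sum_distrib_left sum.distrib[symmetric] mult.assoc)
  also have "\<dots> \<le> 2 * L\<^sup>2 * (s\<^sup>2 / L\<^sup>2 * d)" using t by (intro mult_left_mono) auto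
  also have "\<dots> = 2 * s\<^sup>2 * d" using L0 by simp
  finally have T: "(\<Sum>p\<in>?J. \<Sum>k\<in>{1..d}. (cmod (t' p k))\<^sup>2) / 4 \<le> s\<^sup>2 * d / 2" by simp
  have "(\<Sum>p\<in>?J. \<bar>r p\<bar>) \<le> (\<Sum>j\<in>{1..d}. 2 / L * cmod (v j))"
    unfolding pairs
  proof (intro sum_mono)
    fix j
    have "\<bar>Re (v j)\<bar> / L + \<bar>Im (v j)\<bar> / L \<le> cmod (v j) / L + cmod (v j) / L"
      using L0 abs_Re_le_cmod abs_Im_le_cmod by (intro add_mono divide_right_mono) auto
    then show "\<bar>r (j, False)\<bar> + \<bar>r (j, True)\<bar> \<le> 2 / L * cmod (v j)"
      using L0 by (simp add: r_def)
  qed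
  also have "\<dots> \<le> 2 / L * (R * d)" unfolding sum_distrib_left[symmetric] using v L0 by (intro mult_left_mono) auto
  finally have "\<omega> * (\<Sum>p\<in>?J. \<bar>r p\<bar>) \<le> \<omega> * (2 / L * (R * d))" using \<omega> by (intro mult_left_mono) auto
  also have "\<dots> = s\<^sup>2 * d / 2" using pos L0 by (simp add: \<omega>_def)
  finally have tot: "(\<Sum>k\<in>{1..d}. (cmod (\<Sum>p\<in>?J. of_real (of_int (a0 p) - r p) * t' p k))\<^sup>2) + \<omega> * (\<Sum>p\<in>?J. \<bar>real_of_int (a0 p)\<bar>) \<le> s\<^sup>2 * d"
    using a0 T by simp
  have n1: "0 \<le> (\<Sum>k\<in>{1..d}. (cmod (\<Sum>p\<in>?J. of_real (of_int (a0 p) - r p) * t' p k))\<^sup>2)"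
    and n2: "0 \<le> \<omega> * (\<Sum>p\<in>?J. \<bar>real_of_int (a0 p)\<bar>)" using \<omega> by (auto intro!: sum_nonneg mult_nonneg_nonneg)
  have "\<omega> * (\<Sum>p\<in>?J. \<bar>real_of_int (a0 p)\<bar>) \<le> s\<^sup>2 * d" using tot n1 by linarith
  then have "(\<Sum>p\<in>?J. \<bar>real_of_int (a0 p)\<bar>) \<le> s\<^sup>2 * d / \<omega>" using \<omega> by (simp add: pos_le_divide_eq mult.commute)
  also have "\<dots> = \<eta> * card ?J" using pos by (simp add: \<omega>_def L card_cartesian_product)
  finally have A: "(\<Sum>p\<in>?J. \<bar>real_of_int (a0 p)\<bar>) \<le> \<eta> * card ?J" .
  have rt: "(\<Sum>p\<in>?J. of_real (r p) * t' p k) = (\<Sum>j\<in>{1..d}. v j * t j k)" for k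
    unfolding pairs
  proof (intro sum.cong refl)
    fix j
    have "of_real (r (j, False)) * t' (j, False) k + of_real (r (j, True)) * t' (j, True) k
      = (of_real (Re (v j)) + \<i> * of_real (Im (v j))) * t j k"
      using L0 by (simp add: r_def t'_def distrib_left distrib_right mult_ac)
    then show "of_real (r (j, False)) * t' (j, False) k + of_real (r (j, True)) * t' (j, True) k = v j * t j k"
      using complex_eq[of "v j"] by simp
  qed
  have lv: "lattice_vector L d t a k - (\<Sum>j\<in>{1..d}. v j * t j k) = (\<Sum>p\<in>?J. of_real (of_int (a0 p) - r p) * t' p k)" for k
  proof -
    have "lattice_vector L d t a k = (\<Sum>p\<in>?J. of_int (a0 p) * t' p k)"
      unfolding lattice_vector_def a_def t'_def by (intro sum.cong) auto
    then show ?thesis unfolding rt[symmetric] by (simp add: left_diff_distrib sum_subtractf)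
  qed
  show thesis
  proof (rule that[of a])
    show "a \<in> ?J \<rightarrow>\<^sub>E UNIV" by (simp add: a_def)
    show "(\<Sum>p\<in>?J. \<bar>real_of_int (a p)\<bar>) \<le> \<eta> * card ?J" using A by (simp add: a_def)
    show "(\<Sum>k\<in>{1..d}. (cmod (lattice_vector L d t a k - (\<Sum>j\<in>{1..d}. v j * t j k)))\<^sup>2) \<le> s\<^sup>2 * d"
      unfolding lv using tot n2 by linarith
  qed
qed

text \<open>The words attached to one z lie in the ball around any one of them, so a word of the
  class itself can serve as the centre.\<close>

lemma card_le_classes:
  fixes Y :: "('j \<Rightarrow> 'c) set"
  assumes Y: "Y \<subseteq> J \<rightarrow>\<^sub>E C" and Z: "finite Z" and P: "\<And>y. y \<in> Y \<Longrightarrow> \<exists>z\<in>Z. P y z"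
    and close: "\<And>y y' z. y \<in> Y \<Longrightarrow> y' \<in> Y \<Longrightarrow> z \<in> Z \<Longrightarrow> P y z \<Longrightarrow> P y' z \<Longrightarrow> real (card {j\<in>J. y j \<noteq> y' j}) \<le> m"
    and fin: "finite (J \<rightarrow>\<^sub>E C)"
    and ball: "\<And>y0. real (card {y \<in> J \<rightarrow>\<^sub>E C. real (card {j\<in>J. y j \<noteq> y0 j}) \<le> m}) \<le> b"
  shows "real (card Y) \<le> real (card Z) * b"
proof -
  have "Y \<subseteq> (\<Union>z\<in>Z. {y\<in>Y. P y z})" using P by auto
  then have "card Y \<le> card (\<Union>z\<in>Z. {y\<in>Y. P y z})"
    using Z finite_subset[OF Y fin] by (intro card_mono) auto
  also have "\<dots> \<le> (\<Sum>z\<in>Z. card {y\<in>Y. P y z})" using Z by (rule card_UN_le)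
  finally have "real (card Y) \<le> (\<Sum>z\<in>Z. real (card {y\<in>Y. P y z}))"
    by (metis of_nat_le_iff of_nat_sum)
  also have "\<dots> \<le> (\<Sum>z\<in>Z. b)"
  proof (rule sum_mono)
    fix z assume z: "z \<in> Z"
    have "0 \<le> b" using order_trans[OF of_nat_0_le_iff ball[of undefined]] .
    show "real (card {y\<in>Y. P y z}) \<le> b"
    proof (cases "{y\<in>Y. P y z} = {}")
      case True
      show ?thesis unfolding True using \<open>0 \<le> b\<close> by simp
    next
      case False
      then obtain y0 where y0: "y0 \<in> Y" "P y0 z" by auto
      have "{y\<in>Y. P y z} \<subseteq> {y \<in> J \<rightarrow>\<^sub>E C. real (card {j\<in>J. y j \<noteq> y0 j}) \<le> m}"
        using Y close z y0 by auto
      then have "card {y\<in>Y. P y z} \<le> card {y \<in> J \<rightarrow>\<^sub>E C. real (card {j\<in>J. y j \<noteq> y0 j}) \<le> m}"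
        using fin by (intro card_mono) auto
      then show ?thesis using ball[of y0] by linarith
    qed
  qed
  finally show ?thesis by simp
qed

section \<open>Functions without entropy\<close>

locale sofic_pmp = pmp_action G M a + prob_space M
  for G :: "('g, 'z) monoid_scheme" (structure) and M :: "'x measure" and a :: "'g \<Rightarrow> 'x \<Rightarrow> 'x" +
  fixes d :: "nat \<Rightarrow> nat" and \<sigma> :: "nat \<Rightarrow> 'g \<Rightarrow> nat \<Rightarrow> nat"
  assumes sofic: "sofic_approximation G d \<sigma>"
begin

lemma d_pos: "d i > 0" using sofic by (simp add: sofic_approximation_def)
lemma \<sigma>_perm: "g \<in> carrier G \<Longrightarrow> \<sigma> i g permutes {1..d i}" using sofic by (simp add: sofic_approximation_def)

abbreviation "pat \<beta> F \<equiv> observable_pattern G a \<beta> F"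

section \<open>Statistics of approximate microstates\<close>

definition window :: "'g set \<Rightarrow> bool" where
  "window F \<longleftrightarrow> finite F \<and> F \<subseteq> carrier G \<and> \<one> \<in> F"

lemma window_Un: "window F \<Longrightarrow> window F' \<Longrightarrow> window (F \<union> F')"
  by (auto simp: window_def)

lemma obs_finite: "(B, \<beta>) \<in> observables M \<Longrightarrow> finite B"
  and obs_in: "(B, \<beta>) \<in> observables M \<Longrightarrow> x \<in> space M \<Longrightarrow> \<beta> x \<in> B"
  and obs_meas: "(B, \<beta>) \<in> observables M \<Longrightarrow> \<beta> \<in> measurable M (count_space B)"
  by (auto simp: observables_def dest: measurable_space)

lemma pat_in: "(B, \<beta>) \<in> observables M \<Longrightarrow> window F \<Longrightarrow> x \<in> space M \<Longrightarrow> pat \<beta> F x \<in> F \<rightarrow>\<^sub>E B"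
  by (auto simp: observable_pattern_def window_def intro!: obs_in act_space)

lemma pat_one: "window F \<Longrightarrow> x \<in> space M \<Longrightarrow> pat \<beta> F x \<one> = \<beta> x"
  by (simp add: observable_pattern_def window_def act_one)

lemma finite_patterns: "finite B \<Longrightarrow> window F \<Longrightarrow> finite (F \<rightarrow>\<^sub>E B)"
  by (intro finite_PiE) (auto simp: window_def)

lemma pat_meas:
  assumes B: "(B, \<beta>) \<in> observables M" and F: "window F"
  shows "pat \<beta> F \<in> measurable M (count_space (F \<rightarrow>\<^sub>E B))"
proof (rule measurable_count_space_eq2[THEN iffD2])
  show "finite (F \<rightarrow>\<^sub>E B)" using finite_patterns[OF obs_finite[OF B] F] .
  show "pat \<beta> F \<in> space M \<rightarrow> F \<rightarrow>\<^sub>E B \<and> (\<forall>b\<in>F \<rightarrow>\<^sub>E B. pat \<beta> F -` {b} \<inter> space M \<in> sets M)"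
  proof (intro conjI ballI)
    fix b assume b: "b \<in> F \<rightarrow>\<^sub>E B"
    have "pat \<beta> F -` {b} \<inter> space M = {x\<in>space M. \<forall>g\<in>F. \<beta> (a (inv g) x) = b g}"
    proof (intro equalityI subsetI)
      fix x assume "x \<in> {x\<in>space M. \<forall>g\<in>F. \<beta> (a (inv g) x) = b g}"
      then have "pat \<beta> F x = restrict b F" by (auto simp: observable_pattern_def restrict_def)
      then show "x \<in> pat \<beta> F -` {b} \<inter> space M"
        using \<open>x \<in> _\<close> PiE_restrict[OF b] by auto
    qed (auto simp: observable_pattern_def)
    also have "\<dots> \<in> sets M"
    proof (rule sets.sets_Collect_finite_All)
      show "finite F" using F by (auto simp: window_def)
      fix g assume g: "g \<in> F"
      have "(\<lambda>x. \<beta> (a (inv g) x)) \<in> measurable M (count_space B)"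
        by (rule measurable_compose[OF act_meas obs_meas[OF B]]) (use g F in \<open>auto simp: window_def\<close>)
      then have "(\<lambda>x. \<beta> (a (inv g) x)) -` {b g} \<inter> space M \<in> sets M"
        by (rule measurable_sets) (use g b in auto)
      moreover have "(\<lambda>x. \<beta> (a (inv g) x)) -` {b g} \<inter> space M = {x\<in>space M. \<beta> (a (inv g) x) = b g}" by auto
      ultimately show "{x\<in>space M. \<beta> (a (inv g) x) = b g} \<in> sets M" by simp
    qed
    finally show "pat \<beta> F -` {b} \<inter> space M \<in> sets M" .
  qed (use pat_in[OF B F] in auto)
qed

lemma pat_expectation:
  fixes \<Theta> :: "('g \<Rightarrow> nat) \<Rightarrow> real"
  assumes B: "(B, \<beta>) \<in> observables M" and F: "window F"
  shows "(\<integral>x. \<Theta> (pat \<beta> F x) \<partial>M) = (\<Sum>b\<in>F \<rightarrow>\<^sub>E B. \<Theta> b * measure M (pat \<beta> F -` {b} \<inter> space M))"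
proof -
  let ?P = "F \<rightarrow>\<^sub>E B"
  have fin: "finite ?P" using finite_patterns[OF obs_finite[OF B] F] .
  have sets: "pat \<beta> F -` {b} \<inter> space M \<in> sets M" if "b \<in> ?P" for b
    using measurable_sets[OF pat_meas[OF B F], of "{b}"] that by simp
  have "(\<integral>x. \<Theta> (pat \<beta> F x) \<partial>M) = (\<integral>x. (\<Sum>b\<in>?P. \<Theta> b * indicator (pat \<beta> F -` {b} \<inter> space M) x) \<partial>M)"
  proof (rule Bochner_Integration.integral_cong)
    fix x assume x: "x \<in> space M"
    have "(\<Sum>b\<in>?P. \<Theta> b * indicator (pat \<beta> F -` {b} \<inter> space M) x) = (\<Sum>b\<in>?P. if b = pat \<beta> F x then \<Theta> b else 0)"
      using x by (intro sum.cong) (auto simp: indicator_def)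
    also have "\<dots> = \<Theta> (pat \<beta> F x)" using fin pat_in[OF B F x] by (simp add: sum.delta)
    finally show "\<Theta> (pat \<beta> F x) = (\<Sum>b\<in>?P. \<Theta> b * indicator (pat \<beta> F -` {b} \<inter> space M) x)" by simp
  qed simp
  also have "\<dots> = (\<Sum>b\<in>?P. \<integral>x. \<Theta> b * indicator (pat \<beta> F -` {b} \<inter> space M) x \<partial>M)"
    by (intro Bochner_Integration.integral_sum) (auto intro!: integrable_real_mult_indicator sets simp: emeasure_eq_measure)
  also have "\<dots> = (\<Sum>b\<in>?P. \<Theta> b * measure M (pat \<beta> F -` {b} \<inter> space M))"
    using sets by (intro sum.cong) (auto simp: Int_absorb1)
  finally show ?thesis .
qed

lemma unif_measure: "n > 0 \<Longrightarrow> A \<subseteq> {1..n} \<Longrightarrow> measure (unif n) A = card A / n"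
  by (subst measure_uniform_count_measure) auto

lemma unif_expectation:
  fixes \<Theta> :: "'c \<Rightarrow> real"
  assumes P: "finite P" and \<phi>: "\<And>j. j \<in> {1..n} \<Longrightarrow> \<phi> j \<in> P" and n: "n > 0"
  shows "(\<Sum>j\<in>{1..n}. \<Theta> (\<phi> j)) / n = (\<Sum>b\<in>P. \<Theta> b * measure (unif n) (\<phi> -` {b} \<inter> {1..n}))"
proof -
  have "(\<Sum>j\<in>{1..n}. \<Theta> (\<phi> j)) = (\<Sum>b\<in>P. \<Sum>j\<in>{j\<in>{1..n}. \<phi> j = b}. \<Theta> (\<phi> j))"
    by (rule sum.group[symmetric]) (use P \<phi> in auto)
  also have "\<dots> = (\<Sum>b\<in>P. \<Theta> b * card (\<phi> -` {b} \<inter> {1..n}))"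
  proof (rule sum.cong[OF refl])
    fix b
    have "(\<Sum>j\<in>{j\<in>{1..n}. \<phi> j = b}. \<Theta> (\<phi> j)) = (\<Sum>j\<in>\<phi> -` {b} \<inter> {1..n}. \<Theta> b)"
      by (rule sum.cong) auto
    then show "(\<Sum>j\<in>{j\<in>{1..n}. \<phi> j = b}. \<Theta> (\<phi> j)) = \<Theta> b * card (\<phi> -` {b} \<inter> {1..n})" by simp
  qed
  finally have S: "(\<Sum>j\<in>{1..n}. \<Theta> (\<phi> j)) = (\<Sum>b\<in>P. \<Theta> b * card (\<phi> -` {b} \<inter> {1..n}))" .
  have u: "measure (unif n) (\<phi> -` {b} \<inter> {1..n}) = card (\<phi> -` {b} \<inter> {1..n}) / n" for b
    using n by (intro unif_measure) auto
  show ?thesis unfolding S u by (simp add: sum_divide_distrib)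
qed

lemma AP_D:
  assumes "\<phi> \<in> AP G M a B \<beta> F \<delta> n s"
  shows "\<phi> \<in> {1..n} \<rightarrow>\<^sub>E (F \<rightarrow>\<^sub>E B)"
    "(\<Sum>b \<in> F \<rightarrow>\<^sub>E B. \<bar>measure (unif n) (\<phi> -` {b} \<inter> {1..n}) - measure M (pat \<beta> F -` {b} \<inter> space M)\<bar>) < \<delta>"
    "\<And>g. g \<in> F \<Longrightarrow> measure (unif n) {j\<in>{1..n}. \<phi> j g \<noteq> \<phi> (inv_into {1..n} (s g) j) \<one>} < \<delta>"
  using assms by (auto simp: AP_def)

text \<open>The averages over a microstate and over \<open>M\<close> are sums against two pattern
  distributions that are \<delta>-close in l1, so they differ by at most the sup norm times
  \<delta>.\<close>

lemma AP_expectation: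
  fixes \<Theta> :: "('g \<Rightarrow> nat) \<Rightarrow> real"
  assumes B: "(B, \<beta>) \<in> observables M" and F: "window F" and n: "n > 0"
    and \<phi>: "\<phi> \<in> AP G M a B \<beta> F \<delta> n s" and C: "\<And>b. b \<in> F \<rightarrow>\<^sub>E B \<Longrightarrow> \<bar>\<Theta> b\<bar> \<le> C" "C \<ge> 0"
  shows "(\<Sum>j\<in>{1..n}. \<Theta> (\<phi> j)) \<le> ((\<integral>x. \<Theta> (pat \<beta> F x) \<partial>M) + C * \<delta>) * n"
proof -
  let ?P = "F \<rightarrow>\<^sub>E B"
  let ?u = "\<lambda>b. measure (unif n) (\<phi> -` {b} \<inter> {1..n})" and ?m = "\<lambda>b. measure M (pat \<beta> F -` {b} \<inter> space M)"
  have "(\<Sum>j\<in>{1..n}. \<Theta> (\<phi> j)) / n - (\<integral>x. \<Theta> (pat \<beta> F x) \<partial>M) = (\<Sum>b\<in>?P. \<Theta> b * ?u b) - (\<Sum>b\<in>?P. \<Theta> b * ?m b)"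
    using unif_expectation[of ?P n \<phi> \<Theta>] pat_expectation[OF B F, of \<Theta>] finite_patterns[OF obs_finite[OF B] F] AP_D(1)[OF \<phi>] n
    by (auto simp: PiE_iff)
  also have "\<dots> = (\<Sum>b\<in>?P. \<Theta> b * (?u b - ?m b))" by (simp add: sum_subtractf right_diff_distrib)
  also have "\<dots> \<le> (\<Sum>b\<in>?P. C * \<bar>?u b - ?m b\<bar>)"
  proof (rule sum_mono)
    fix b assume "b \<in> ?P"
    then have "\<bar>\<Theta> b\<bar> * \<bar>?u b - ?m b\<bar> \<le> C * \<bar>?u b - ?m b\<bar>" using C by (intro mult_right_mono) auto
    then show "\<Theta> b * (?u b - ?m b) \<le> C * \<bar>?u b - ?m b\<bar>" by (simp flip: abs_mult)
  qed
  also have "\<dots> = C * (\<Sum>b\<in>?P. \<bar>?u b - ?m b\<bar>)" by (simp add: sum_distrib_left)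
  also have "\<dots> \<le> C * \<delta>" using AP_D(2)[OF \<phi>] C by (intro mult_left_mono) auto
  finally have "(\<Sum>j\<in>{1..n}. \<Theta> (\<phi> j)) / n \<le> (\<integral>x. \<Theta> (pat \<beta> F x) \<partial>M) + C * \<delta>" by simp
  then show ?thesis using n by (simp add: pos_divide_le_eq)
qed

lemma AP_count:
  assumes B: "(B, \<beta>) \<in> observables M" and F: "window F" and n: "n > 0"
    and \<phi>: "\<phi> \<in> AP G M a B \<beta> F \<delta> n s"
  shows "real (card {j\<in>{1..n}. Q (\<phi> j \<one>)}) \<le> (measure M {x\<in>space M. Q (\<beta> x)} + \<delta>) * n"
proof -
  have "real (card {j\<in>{1..n}. Q (\<phi> j \<one>)}) = (\<Sum>j\<in>{1..n}. if Q (\<phi> j \<one>) then 1 else 0)"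
    by (simp add: sum.If_cases Int_def)
  also have "\<dots> \<le> ((\<integral>x. (if Q (pat \<beta> F x \<one>) then 1 else 0) \<partial>M) + 1 * \<delta>) * n"
    by (rule AP_expectation[OF B F n \<phi>]) auto
  also have "(\<integral>x. (if Q (pat \<beta> F x \<one>) then 1 else 0) \<partial>M) = (\<integral>x. indicator {x\<in>space M. Q (\<beta> x)} x \<partial>M)"
    using pat_one[OF F] by (intro Bochner_Integration.integral_cong) (auto simp: indicator_def)
  also have "\<dots> = measure M {x\<in>space M. Q (\<beta> x)}"
    by (simp add: Int_absorb2 subset_eq)
  finally show ?thesis by simp
qed

lemma AP_mono: "\<delta> \<le> \<delta>' \<Longrightarrow> AP G M a B \<beta> F \<delta> n s \<subseteq> AP G M a B \<beta> F \<delta>' n s"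
  by (force simp: AP_def)

lemma AP_finite: "finite B \<Longrightarrow> window F \<Longrightarrow> finite (AP G M a B \<beta> F \<delta> n s)"
  by (rule finite_subset[of _ "{1..n} \<rightarrow>\<^sub>E (F \<rightarrow>\<^sub>E B)"]) (auto simp: AP_def intro!: finite_PiE finite_patterns)

lemma inv_perm_in:
  assumes "s permutes {1..n}" "j \<in> {1..n}"
  shows "inv_into {1..n} s j \<in> {1..n}"
  using inv_into_into[of j s "{1..n}"] permutes_image[OF assms(1)] assms(2) by simp

text \<open>Coarse graining is a map on patterns: pushing both distributions forward does not
  increase their l1 distance, and labels that agree still agree after \<open>p\<close>.\<close>

lemma AP_project:
  assumes B: "(B, \<beta>) \<in> observables M" and B': "(B', \<beta>') \<in> observables M"
    and p: "\<And>b. b \<in> B' \<Longrightarrow> p b \<in> B" "\<And>x. x \<in> space M \<Longrightarrow> \<beta> x = p (\<beta>' x)"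
    and F: "window F" and F': "window F'" and FF: "F \<subseteq> F'" and n: "n > 0"
    and s: "\<And>g. g \<in> carrier G \<Longrightarrow> s g permutes {1..n}"
    and \<phi>: "\<phi> \<in> AP G M a B' \<beta>' F' \<delta> n s"
  shows "(\<lambda>j\<in>{1..n}. \<lambda>g\<in>F. p (\<phi> j g)) \<in> AP G M a B \<beta> F \<delta> n s"
proof -
  let ?P = "F \<rightarrow>\<^sub>E B" and ?P' = "F' \<rightarrow>\<^sub>E B'"
  define r where "r b = (\<lambda>g\<in>F. p (b g))" for b :: "'g \<Rightarrow> nat"
  define \<psi> where "\<psi> = (\<lambda>j\<in>{1..n}. r (\<phi> j))"
  have fin: "finite ?P" "finite ?P'" using finite_patterns F F' obs_finite[OF B] obs_finite[OF B'] by auto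
  have rP: "r b \<in> ?P" if "b \<in> ?P'" for b using that FF p(1) by (auto simp: r_def PiE_iff)
  have \<phi>P: "\<phi> j \<in> ?P'" if "j \<in> {1..n}" for j using AP_D(1)[OF \<phi>] that by (auto simp: PiE_iff)
  let ?u' = "\<lambda>b. measure (unif n) (\<phi> -` {b} \<inter> {1..n})" and ?m' = "\<lambda>b. measure M (pat \<beta>' F' -` {b} \<inter> space M)"
  have pr: "pat \<beta> F x = r (pat \<beta>' F' x)" if "x \<in> space M" for x
    using that FF F' by (auto simp: r_def observable_pattern_def fun_eq_iff window_def subset_iff intro!: p(2) act_space)
  have u: "measure (unif n) (\<psi> -` {b} \<inter> {1..n}) = (\<Sum>c\<in>?P'. (if r c = b then 1 else 0) * ?u' c)" for b
  proof -
    have "(\<Sum>j\<in>{1..n}. (if r (\<phi> j) = b then 1 else 0 :: real)) = card (\<psi> -` {b} \<inter> {1..n})"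
    proof -
      have "\<psi> -` {b} \<inter> {1..n} = {j\<in>{1..n}. r (\<phi> j) = b}" by (auto simp: \<psi>_def)
      then show ?thesis by (simp add: sum.If_cases Int_def)
    qed
    then show ?thesis
      using unif_expectation[where \<phi> = \<phi> and \<Theta> = "\<lambda>c. if r c = b then 1 else 0", OF fin(2) \<phi>P n] n unif_measure[OF n, of "\<psi> -` {b} \<inter> {1..n}"]
      by simp
  qed
  have m: "measure M (pat \<beta> F -` {b} \<inter> space M) = (\<Sum>c\<in>?P'. (if r c = b then 1 else 0) * ?m' c)" for b
  proof -
    have "(\<integral>x. (if r (pat \<beta>' F' x) = b then 1 else 0) \<partial>M) = (\<integral>x. indicator (pat \<beta> F -` {b} \<inter> space M) x \<partial>M :: real)"
      using pr by (intro Bochner_Integration.integral_cong) (auto simp: indicator_def)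
    also have "\<dots> = measure M (pat \<beta> F -` {b} \<inter> space M)" by (simp add: Int_absorb2)
    finally show ?thesis using pat_expectation[OF B' F', of "\<lambda>c. if r c = b then 1 else 0"] by simp
  qed
  have "(\<Sum>b\<in>?P. \<bar>measure (unif n) (\<psi> -` {b} \<inter> {1..n}) - measure M (pat \<beta> F -` {b} \<inter> space M)\<bar>)
    \<le> (\<Sum>b\<in>?P. \<Sum>c\<in>?P'. (if r c = b then 1 else 0) * \<bar>?u' c - ?m' c\<bar>)"
    unfolding u m sum_subtractf[symmetric] right_diff_distrib[symmetric]
    by (intro sum_mono order_trans[OF sum_abs]) (auto intro!: sum_mono)
  also have "\<dots> = (\<Sum>c\<in>?P'. \<Sum>b\<in>?P. (if r c = b then 1 else 0) * \<bar>?u' c - ?m' c\<bar>)" by (rule sum.swap)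
  also have "\<dots> = (\<Sum>c\<in>?P'. \<bar>?u' c - ?m' c\<bar>)"
  proof (rule sum.cong[OF refl])
    fix c assume c: "c \<in> ?P'"
    have "(\<Sum>b\<in>?P. (if r c = b then 1 else 0) * \<bar>?u' c - ?m' c\<bar>) = (\<Sum>b\<in>?P. if b = r c then \<bar>?u' c - ?m' c\<bar> else 0)"
      by (intro sum.cong) auto
    then show "(\<Sum>b\<in>?P. (if r c = b then 1 else 0) * \<bar>?u' c - ?m' c\<bar>) = \<bar>?u' c - ?m' c\<bar>"
      using fin(1) rP[OF c] by (simp add: sum.delta)
  qed
  also have "\<dots> < \<delta>" by (rule AP_D(2)[OF \<phi>])
  finally have l1: "(\<Sum>b\<in>?P. \<bar>measure (unif n) (\<psi> -` {b} \<inter> {1..n}) - measure M (pat \<beta> F -` {b} \<inter> space M)\<bar>) < \<delta>" .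
  have eq: "measure (unif n) {j\<in>{1..n}. \<psi> j g \<noteq> \<psi> (inv_into {1..n} (s g) j) \<one>} < \<delta>" if g: "g \<in> F" for g
  proof -
    have "{j\<in>{1..n}. \<psi> j g \<noteq> \<psi> (inv_into {1..n} (s g) j) \<one>}
        \<subseteq> {j\<in>{1..n}. \<phi> j g \<noteq> \<phi> (inv_into {1..n} (s g) j) \<one>}"
      using g F inv_perm_in[OF s] by (auto simp: \<psi>_def r_def window_def subset_iff)
    then have "card {j\<in>{1..n}. \<psi> j g \<noteq> \<psi> (inv_into {1..n} (s g) j) \<one>}
        \<le> card {j\<in>{1..n}. \<phi> j g \<noteq> \<phi> (inv_into {1..n} (s g) j) \<one>}" by (intro card_mono) auto
    then have "measure (unif n) {j\<in>{1..n}. \<psi> j g \<noteq> \<psi> (inv_into {1..n} (s g) j) \<one>}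
        \<le> measure (unif n) {j\<in>{1..n}. \<phi> j g \<noteq> \<phi> (inv_into {1..n} (s g) j) \<one>}"
      by (subst (1 2) unif_measure) (use n in \<open>auto intro!: divide_right_mono\<close>)
    also have "\<dots> < \<delta>" using AP_D(3)[OF \<phi>, of g] g FF by auto
    finally show ?thesis .
  qed
  have "\<psi> \<in> AP G M a B \<beta> F \<delta> n s"
    unfolding AP_def using l1 eq rP \<phi>P by (auto simp: \<psi>_def)
  then show ?thesis unfolding \<psi>_def r_def .
qed

definition micro :: "nat set \<Rightarrow> ('x \<Rightarrow> nat) \<Rightarrow> (nat \<Rightarrow> nat) \<Rightarrow> 'g set \<Rightarrow> real \<Rightarrow> nat \<Rightarrow> (nat \<Rightarrow> nat) set" where
  "micro B \<beta> \<pi> F \<delta> i = (\<lambda>\<phi>. \<lambda>j\<in>{1..d i}. \<pi> (\<phi> j \<one>)) ` AP G M a B \<beta> F \<delta> (d i) (\<sigma> i)"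

lemma micro_finite: "finite B \<Longrightarrow> window F \<Longrightarrow> finite (micro B \<beta> \<pi> F \<delta> i)"
  unfolding micro_def by (intro finite_imageI AP_finite)

lemma micro_project:
  assumes "(B, \<beta>) \<in> observables M" "(B', \<beta>') \<in> observables M"
    "\<And>b. b \<in> B' \<Longrightarrow> p b \<in> B" "\<And>x. x \<in> space M \<Longrightarrow> \<beta> x = p (\<beta>' x)"
    "window F" "window F'" "F \<subseteq> F'" "\<delta>' \<le> \<delta>"
    and \<phi>: "\<phi> \<in> AP G M a B' \<beta>' F' \<delta>' (d i) (\<sigma> i)"
  shows "(\<lambda>j\<in>{1..d i}. \<pi> (p (\<phi> j \<one>))) \<in> micro B \<beta> \<pi> F \<delta> i"
proof -
  let ?\<psi> = "\<lambda>j\<in>{1..d i}. \<lambda>g\<in>F. p (\<phi> j g)"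
  have "?\<psi> \<in> AP G M a B \<beta> F \<delta>' (d i) (\<sigma> i)"
    by (rule AP_project[OF assms(1-7) d_pos \<sigma>_perm \<phi>])
  then have "?\<psi> \<in> AP G M a B \<beta> F \<delta> (d i) (\<sigma> i)" using AP_mono[OF assms(8)] by blast
  moreover have "(\<lambda>j\<in>{1..d i}. \<pi> (p (\<phi> j \<one>))) = (\<lambda>j\<in>{1..d i}. \<pi> (?\<psi> j \<one>))"
    using assms(5) by (auto simp: window_def restrict_def)
  ultimately show ?thesis unfolding micro_def by blast
qed

text \<open>The functions that contribute no entropy in the presence of the whole system.\<close>

definition tame :: "('x \<Rightarrow> nat) \<Rightarrow> bool" where
  "tame \<gamma> \<longleftrightarrow> (\<forall>\<kappa>>0::real. \<exists>B \<beta> \<pi> F \<delta>. (B, \<beta>) \<in> observables M \<and> (\<forall>x\<in>space M. \<pi> (\<beta> x) = \<gamma> x) \<and> window F \<and> \<delta> > 0 \<and>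
     (\<forall>\<^sub>F i in sequentially. real (card (micro B \<beta> \<pi> F \<delta> i)) \<le> exp (\<kappa> * d i)))"

lemma tameE:
  assumes "tame \<gamma>" "\<kappa> > (0::real)"
  obtains B \<beta> \<pi> F \<delta> where "(B, \<beta>) \<in> observables M" "\<forall>x\<in>space M. \<pi> (\<beta> x) = \<gamma> x" "window F" "\<delta> > 0"
     "\<forall>\<^sub>F i in sequentially. real (card (micro B \<beta> \<pi> F \<delta> i)) \<le> exp (\<kappa> * d i)"
proof -
  have "\<exists>B \<beta> \<pi> F \<delta>. (B, \<beta>) \<in> observables M \<and> (\<forall>x\<in>space M. \<pi> (\<beta> x) = \<gamma> x) \<and> window F \<and> \<delta> > 0 \<and>
     (\<forall>\<^sub>F i in sequentially. real (card (micro B \<beta> \<pi> F \<delta> i)) \<le> exp (\<kappa> * d i))"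
    using assms unfolding tame_def by (elim allE impE)
  then show thesis by (elim exE conjE) (rule that)
qed

lemma tame_cong: "(\<And>x. x \<in> space M \<Longrightarrow> \<gamma> x = \<gamma>' x) \<Longrightarrow> tame \<gamma> \<Longrightarrow> tame \<gamma>'"
  unfolding tame_def by simp

section \<open>Closure properties of tame functions\<close>

lemma observables_pair:
  assumes "(B, \<beta>) \<in> observables M" "(C, \<gamma>) \<in> observables M"
  shows "(prod_encode ` (B \<times> C), \<lambda>x. prod_encode (\<beta> x, \<gamma> x)) \<in> observables M"
proof -
  have fin: "finite (prod_encode ` (B \<times> C))" using assms obs_finite by auto
  have "(\<lambda>x. prod_encode (\<beta> x, \<gamma> x)) \<in> measurable M (count_space (prod_encode ` (B \<times> C)))"
  proof (rule measurable_count_space_eq2[THEN iffD2, OF fin], intro conjI ballI)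
    show "(\<lambda>x. prod_encode (\<beta> x, \<gamma> x)) \<in> space M \<rightarrow> prod_encode ` (B \<times> C)" using obs_in assms by auto
    fix y assume "y \<in> prod_encode ` (B \<times> C)"
    then obtain b c where bc: "b \<in> B" "c \<in> C" "y = prod_encode (b, c)" by auto
    have "(\<lambda>x. prod_encode (\<beta> x, \<gamma> x)) -` {y} \<inter> space M = (\<beta> -` {b} \<inter> space M) \<inter> (\<gamma> -` {c} \<inter> space M)"
      by (auto simp: bc(3))
    also have "\<dots> \<in> sets M"
      using measurable_sets[OF obs_meas[OF assms(1)], of "{b}"] measurable_sets[OF obs_meas[OF assms(2)], of "{c}"] bc by simp
    finally show "(\<lambda>x. prod_encode (\<beta> x, \<gamma> x)) -` {y} \<inter> space M \<in> sets M" .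
  qed
  then show ?thesis using fin by (simp add: observables_def)
qed

text \<open>The pair of the two auxiliary observables, over the union of the windows, projects onto
  both. A microstate of the pair yields one of each, so the counts multiply and the exponents
  \<kappa> / 2 add.\<close>

lemma tame_combine:
  assumes "tame \<gamma>1" "tame \<gamma>2"
  shows "tame (\<lambda>x. h (\<gamma>1 x) (\<gamma>2 x))"
  unfolding tame_def
proof (intro allI impI)
  fix \<kappa> :: real assume "\<kappa> > 0"
  then have \<kappa>: "\<kappa> / 2 > 0" by simp
  obtain B1 \<beta>1 \<pi>1 F1 \<delta>1 where 1: "(B1, \<beta>1) \<in> observables M" "\<forall>x\<in>space M. \<pi>1 (\<beta>1 x) = \<gamma>1 x" "window F1" "\<delta>1 > 0"
     "\<forall>\<^sub>F i in sequentially. real (card (micro B1 \<beta>1 \<pi>1 F1 \<delta>1 i)) \<le> exp (\<kappa> / 2 * d i)"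
    using tameE[OF assms(1) \<kappa>] .
  obtain B2 \<beta>2 \<pi>2 F2 \<delta>2 where 2: "(B2, \<beta>2) \<in> observables M" "\<forall>x\<in>space M. \<pi>2 (\<beta>2 x) = \<gamma>2 x" "window F2" "\<delta>2 > 0"
     "\<forall>\<^sub>F i in sequentially. real (card (micro B2 \<beta>2 \<pi>2 F2 \<delta>2 i)) \<le> exp (\<kappa> / 2 * d i)"
    using tameE[OF assms(2) \<kappa>] .
  let ?B = "prod_encode ` (B1 \<times> B2)" and ?\<beta> = "\<lambda>x. prod_encode (\<beta>1 x, \<beta>2 x)"
  let ?p1 = "\<lambda>b. fst (prod_decode b)" and ?p2 = "\<lambda>b. snd (prod_decode b)"
  let ?\<pi> = "\<lambda>b. h (\<pi>1 (?p1 b)) (\<pi>2 (?p2 b))" and ?F = "F1 \<union> F2" and ?\<delta> = "min \<delta>1 \<delta>2"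
  have B: "(?B, ?\<beta>) \<in> observables M" using observables_pair 1(1) 2(1) .
  have F: "window ?F" using window_Un 1(3) 2(3) .
  have "\<forall>\<^sub>F i in sequentially. real (card (micro ?B ?\<beta> ?\<pi> ?F ?\<delta> i)) \<le> exp (\<kappa> * d i)"
    using 1(5) 2(5)
  proof eventually_elim
    case (elim i)
    let ?M1 = "micro B1 \<beta>1 \<pi>1 F1 \<delta>1 i" and ?M2 = "micro B2 \<beta>2 \<pi>2 F2 \<delta>2 i"
    have fin: "finite ?M1" "finite ?M2" using micro_finite obs_finite 1 2 by auto
    have "micro ?B ?\<beta> ?\<pi> ?F ?\<delta> i \<subseteq> (\<lambda>(y, z). \<lambda>j\<in>{1..d i}. h (y j) (z j)) ` (?M1 \<times> ?M2)"
    proof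
      fix y assume "y \<in> micro ?B ?\<beta> ?\<pi> ?F ?\<delta> i"
      then obtain \<phi> where \<phi>: "\<phi> \<in> AP G M a ?B ?\<beta> ?F ?\<delta> (d i) (\<sigma> i)" "y = (\<lambda>j\<in>{1..d i}. ?\<pi> (\<phi> j \<one>))"
        unfolding micro_def by auto
      have "(\<lambda>j\<in>{1..d i}. \<pi>1 (?p1 (\<phi> j \<one>))) \<in> ?M1"
        by (rule micro_project[OF 1(1) B _ _ 1(3) F _ _ \<phi>(1)]) auto
      moreover have "(\<lambda>j\<in>{1..d i}. \<pi>2 (?p2 (\<phi> j \<one>))) \<in> ?M2"
        by (rule micro_project[OF 2(1) B _ _ 2(3) F _ _ \<phi>(1)]) auto
      moreover have "y = (\<lambda>(y, z). \<lambda>j\<in>{1..d i}. h (y j) (z j)) (\<lambda>j\<in>{1..d i}. \<pi>1 (?p1 (\<phi> j \<one>)), \<lambda>j\<in>{1..d i}. \<pi>2 (?p2 (\<phi> j \<one>)))"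
        unfolding \<phi>(2) by (auto simp: restrict_def)
      ultimately show "y \<in> (\<lambda>(y, z). \<lambda>j\<in>{1..d i}. h (y j) (z j)) ` (?M1 \<times> ?M2)" by blast
    qed
    then have "card (micro ?B ?\<beta> ?\<pi> ?F ?\<delta> i) \<le> card (?M1 \<times> ?M2)"
      using fin by (intro surj_card_le) auto
    then have "real (card (micro ?B ?\<beta> ?\<pi> ?F ?\<delta> i)) \<le> real (card ?M1) * real (card ?M2)"
      by (simp add: card_cartesian_product flip: of_nat_mult)
    also have "\<dots> \<le> exp (\<kappa> / 2 * d i) * exp (\<kappa> / 2 * d i)" using elim by (intro mult_mono) auto
    also have "\<dots> = exp (\<kappa> * d i)" by (simp add: exp_add[symmetric])
    finally show ?case .
  qed
  then show "\<exists>B \<beta> \<pi> F \<delta>. (B, \<beta>) \<in> observables M \<and> (\<forall>x\<in>space M. \<pi> (\<beta> x) = h (\<gamma>1 x) (\<gamma>2 x)) \<and> window F \<and> \<delta> > 0 \<and>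
     (\<forall>\<^sub>F i in sequentially. real (card (micro B \<beta> \<pi> F \<delta> i)) \<le> exp (\<kappa> * d i))"
    using B F 1(2,4) 2(2,4)
    by (intro exI[of _ ?B] exI[of _ ?\<beta>] exI[of _ ?\<pi>] exI[of _ ?F] exI[of _ ?\<delta>]) simp
qed

lemma tame_const: "tame (\<lambda>x. c)"
  unfolding tame_def
proof (intro allI impI)
  fix \<kappa> :: real assume "\<kappa> > 0"
  have F: "window {\<one>}" by (simp add: window_def)
  have "real (card (micro {0} (\<lambda>x. 0) (\<lambda>b. c) {\<one>} 1 i)) \<le> exp (\<kappa> * d i)" for i
  proof -
    have "micro {0} (\<lambda>x. 0) (\<lambda>b. c) {\<one>} 1 i \<subseteq> {\<lambda>j\<in>{1..d i}. c}" by (auto simp: micro_def)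
    then have "card (micro {0} (\<lambda>x. 0) (\<lambda>b. c) {\<one>} 1 i) \<le> card {\<lambda>j\<in>{1..d i}. c}"
      by (rule card_mono[rotated]) simp
    then have "card (micro {0} (\<lambda>x. 0) (\<lambda>b. c) {\<one>} 1 i) \<le> 1" by simp
    moreover have "1 \<le> exp (\<kappa> * d i)" using \<open>\<kappa> > 0\<close> by simp
    ultimately show ?thesis by linarith
  qed
  then show "\<exists>B \<beta> \<pi> F \<delta>. (B, \<beta>) \<in> observables M \<and> (\<forall>x\<in>space M. \<pi> (\<beta> x) = c) \<and> window F \<and> \<delta> > 0 \<and>
     (\<forall>\<^sub>F i in sequentially. real (card (micro B \<beta> \<pi> F \<delta> i)) \<le> exp (\<kappa> * d i))"
    using F by (intro exI[of _ "{0}"] exI[of _ "\<lambda>x. 0"] exI[of _ "\<lambda>b. c"] exI[of _ "{\<one>}"] exI[of _ 1])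
      (auto simp: observables_def)
qed

lemma card_mismatch_triangle:
  assumes "finite J"
  shows "card {j\<in>J. y j \<noteq> y' j} \<le> card {j\<in>J. y j \<noteq> z j} + card {j\<in>J. y' j \<noteq> z j}"
proof -
  have "card {j\<in>J. y j \<noteq> y' j} \<le> card ({j\<in>J. y j \<noteq> z j} \<union> {j\<in>J. y' j \<noteq> z j})"
    using assms by (intro card_mono) auto
  then show ?thesis using card_Un_le order_trans by blast
qed

text \<open>The labels of \<gamma> in a microstate of the joint observable differ on few coordinates
  from a labelling counted for \<gamma>', and a small Hamming ball has little entropy. This is what
  admits countable unions and null modifications.\<close>

lemma tame_approx:
  assumes C: "(C, \<gamma>) \<in> observables M"
    and ap: "\<And>\<epsilon>. \<epsilon> > 0 \<Longrightarrow> \<exists>\<gamma>'. tame \<gamma>' \<and> measure M {x\<in>space M. \<gamma> x \<noteq> \<gamma>' x} < \<epsilon>"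
  shows "tame \<gamma>"
  unfolding tame_def
proof (intro allI impI)
  fix \<kappa> :: real assume "\<kappa> > 0"
  then have \<kappa>: "\<kappa> / 2 > 0" by simp
  obtain \<eta> :: real where \<eta>: "\<eta> > 0" and ball: "\<And>(J::nat set) (C'::nat set) y0. finite J \<Longrightarrow> finite C' \<Longrightarrow> real (card C') \<le> real (card C) \<Longrightarrow>
      real (card {y \<in> J \<rightarrow>\<^sub>E C'. real (card {j\<in>J. y j \<noteq> y0 j}) \<le> \<eta> * card J}) \<le> exp (\<kappa> / 2 * card J)"
    by (rule hamming_ball_entropy[of "real (card C)" "\<kappa> / 2"]) (use \<kappa> in auto)
  \<comment> \<open>The radius \<eta> is fixed by \<kappa> and the alphabet before \<gamma>' is
    chosen. Measure \<eta> / 4 plus the statistical error \<eta> / 4 puts a labelling within \<eta>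
    / 2 of its companion, hence two labellings with the same companion within \<eta>.\<close>
  obtain \<gamma>' where \<gamma>': "tame \<gamma>'" "measure M {x\<in>space M. \<gamma> x \<noteq> \<gamma>' x} < \<eta> / 4" using ap[of "\<eta> / 4"] \<eta> by auto
  obtain B \<beta> \<pi> F \<delta> where 1: "(B, \<beta>) \<in> observables M" "\<forall>x\<in>space M. \<pi> (\<beta> x) = \<gamma>' x" "window F" "\<delta> > 0"
     "\<forall>\<^sub>F i in sequentially. real (card (micro B \<beta> \<pi> F \<delta> i)) \<le> exp (\<kappa> / 2 * d i)"
    using tameE[OF \<gamma>'(1) \<kappa>] .
  let ?B = "prod_encode ` (B \<times> C)" and ?\<beta> = "\<lambda>x. prod_encode (\<beta> x, \<gamma> x)"
  let ?p = "\<lambda>b. fst (prod_decode b)" and ?\<pi> = "\<lambda>b. snd (prod_decode b)" and ?\<delta> = "min \<delta> (\<eta> / 4)"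
  have B: "(?B, ?\<beta>) \<in> observables M" using observables_pair 1(1) C .
  have "\<forall>\<^sub>F i in sequentially. real (card (micro ?B ?\<beta> ?\<pi> F ?\<delta> i)) \<le> exp (\<kappa> * d i)"
    using 1(5)
  proof eventually_elim
    case (elim i)
    let ?J = "{1..d i}"
    have "real (card (micro ?B ?\<beta> ?\<pi> F ?\<delta> i)) \<le> real (card (micro B \<beta> \<pi> F \<delta> i)) * exp (\<kappa> / 2 * d i)"
    proof (rule card_le_classes[where J = ?J and C = C and P = "\<lambda>y z. real (card {j\<in>?J. y j \<noteq> z j}) \<le> \<eta> / 2 * d i" and m = "\<eta> * d i"])
      show "micro ?B ?\<beta> ?\<pi> F ?\<delta> i \<subseteq> ?J \<rightarrow>\<^sub>E C"
      proof
        fix y assume "y \<in> micro ?B ?\<beta> ?\<pi> F ?\<delta> i"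
        then obtain \<phi> where \<phi>: "\<phi> \<in> AP G M a ?B ?\<beta> F ?\<delta> (d i) (\<sigma> i)" "y = (\<lambda>j\<in>?J. ?\<pi> (\<phi> j \<one>))"
          unfolding micro_def by auto
        have "\<phi> j \<one> \<in> ?B" if "j \<in> ?J" for j
          using AP_D(1)[OF \<phi>(1)] that 1(3) unfolding window_def by (meson PiE_mem)
        then have "?\<pi> (\<phi> j \<one>) \<in> C" if "j \<in> ?J" for j using that by fastforce
        then show "y \<in> ?J \<rightarrow>\<^sub>E C" unfolding \<phi>(2) by auto
      qed
      show "finite (micro B \<beta> \<pi> F \<delta> i)" using micro_finite obs_finite 1 by auto
      show "finite (?J \<rightarrow>\<^sub>E C)" using obs_finite[OF C] by (intro finite_PiE) auto
      show "real (card {y \<in> ?J \<rightarrow>\<^sub>E C. real (card {j\<in>?J. y j \<noteq> y0 j}) \<le> \<eta> * d i}) \<le> exp (\<kappa> / 2 * d i)" for y0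
        using ball[of ?J C y0] obs_finite[OF C] by simp
      show "real (card {j\<in>?J. y j \<noteq> y' j}) \<le> \<eta> * d i"
        if "real (card {j\<in>?J. y j \<noteq> z j}) \<le> \<eta> / 2 * d i" "real (card {j\<in>?J. y' j \<noteq> z j}) \<le> \<eta> / 2 * d i" for y y' z
        using card_mismatch_triangle[of ?J y y' z] that by simp
      fix y assume "y \<in> micro ?B ?\<beta> ?\<pi> F ?\<delta> i"
      then obtain \<phi> where \<phi>: "\<phi> \<in> AP G M a ?B ?\<beta> F ?\<delta> (d i) (\<sigma> i)" "y = (\<lambda>j\<in>?J. ?\<pi> (\<phi> j \<one>))"
        unfolding micro_def by auto
      let ?z = "\<lambda>j\<in>?J. \<pi> (?p (\<phi> j \<one>))"
      have z: "?z \<in> micro B \<beta> \<pi> F \<delta> i"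
        by (rule micro_project[OF 1(1) B _ _ 1(3) 1(3) _ _ \<phi>(1)]) auto
      have "{j\<in>?J. y j \<noteq> ?z j} = {j\<in>?J. ?\<pi> (\<phi> j \<one>) \<noteq> \<pi> (?p (\<phi> j \<one>))}" unfolding \<phi>(2) by auto
      then have "real (card {j\<in>?J. y j \<noteq> ?z j}) \<le> (measure M {x\<in>space M. ?\<pi> (?\<beta> x) \<noteq> \<pi> (?p (?\<beta> x))} + ?\<delta>) * d i"
        using AP_count[OF B 1(3) d_pos \<phi>(1), of "\<lambda>b. ?\<pi> b \<noteq> \<pi> (?p b)"] by simp
      also have "{x\<in>space M. ?\<pi> (?\<beta> x) \<noteq> \<pi> (?p (?\<beta> x))} = {x\<in>space M. \<gamma> x \<noteq> \<gamma>' x}" using 1(2) by auto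
      also have "(measure M {x\<in>space M. \<gamma> x \<noteq> \<gamma>' x} + ?\<delta>) * d i \<le> \<eta> / 2 * d i"
        using \<gamma>'(2) by (intro mult_right_mono) auto
      finally show "\<exists>z\<in>micro B \<beta> \<pi> F \<delta> i. real (card {j\<in>?J. y j \<noteq> z j}) \<le> \<eta> / 2 * d i" using z by blast
    qed
    also have "\<dots> \<le> exp (\<kappa> / 2 * d i) * exp (\<kappa> / 2 * d i)" using elim by (intro mult_right_mono) auto
    also have "\<dots> = exp (\<kappa> * d i)" by (simp add: exp_add[symmetric])
    finally show ?case .
  qed
  then show "\<exists>B \<beta> \<pi> F \<delta>. (B, \<beta>) \<in> observables M \<and> (\<forall>x\<in>space M. \<pi> (\<beta> x) = \<gamma> x) \<and> window F \<and> \<delta> > 0 \<and>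
     (\<forall>\<^sub>F i in sequentially. real (card (micro B \<beta> \<pi> F \<delta> i)) \<le> exp (\<kappa> * d i))"
    using B 1(3,4) \<eta>
    by (intro exI[of _ ?B] exI[of _ ?\<beta>] exI[of _ ?\<pi>] exI[of _ F] exI[of _ ?\<delta>]) simp
qed

abbreviation ind :: "'x set \<Rightarrow> 'x \<Rightarrow> nat" where "ind S \<equiv> indicator S"

lemma ind_observable: "S \<in> sets M \<Longrightarrow> ({0, 1}, ind S) \<in> observables M"
proof -
  assume S: "S \<in> sets M"
  have "ind S -` {1} \<inter> space M = S" using sets.sets_into_space[OF S] by (auto simp: indicator_def of_bool_def split: if_split_asm)
  moreover have "ind S -` {0} \<inter> space M = space M - S" by (auto simp: indicator_def of_bool_def split: if_split_asm)
  ultimately show ?thesis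
    using S by (auto simp: observables_def measurable_count_space_eq2 indicator_def of_bool_def split: if_splits)
qed

lemma tame_compl: "S \<subseteq> space M \<Longrightarrow> tame (ind S) \<Longrightarrow> tame (ind (space M - S))"
  using tame_combine[of "ind S" "ind S" "\<lambda>u v. 1 - u"] by (rule tame_cong[rotated]) (auto simp: indicator_def)

lemma tame_finite_UN:
  assumes "\<And>i::nat. tame (ind (S i))"
  shows "tame (ind (\<Union>i<n. S i))"
proof (induction n)
  case 0
  show ?case by (rule tame_cong[OF _ tame_const[of 0]]) simp
next
  case (Suc n)
  have "tame (\<lambda>x. max (ind (\<Union>i<n. S i) x) (ind (S n) x))"
    using tame_combine[OF Suc assms, of max] .
  then show ?case by (rule tame_cong[rotated]) (auto simp: indicator_def lessThan_Suc)
qed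

text \<open>Finite unions exhaust the countable one in measure, so \<open>tame_approx\<close>
  applies.\<close>

lemma tame_UN:
  assumes S: "\<And>i::nat. S i \<in> sets M" and "\<And>i. tame (ind (S i))"
  shows "tame (ind (\<Union>i. S i))"
proof (rule tame_approx[OF ind_observable])
  show U: "(\<Union>i. S i) \<in> sets M" using S by auto
  fix \<epsilon> :: real assume e: "\<epsilon> > 0"
  let ?A = "\<lambda>n. \<Union>i<n. S i"
  have A: "?A n \<in> sets M" for n using S by auto
  have "(\<lambda>n. measure M (?A n)) \<longlonglongrightarrow> measure M (\<Union>n. ?A n)"
    by (rule finite_Lim_measure_incseq) (use A in \<open>fastforce simp: incseq_def\<close>)+
  also have "(\<Union>n. ?A n) = (\<Union>i. S i)" by auto
  finally have "\<forall>\<^sub>F n in sequentially. measure M (?A n) > measure M (\<Union>i. S i) - \<epsilon>"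
    by (rule order_tendstoD) (use e in simp)
  then obtain n where n: "measure M (?A n) > measure M (\<Union>i. S i) - \<epsilon>" by (auto simp: eventually_sequentially)
  have "{x\<in>space M. ind (\<Union>i. S i) x \<noteq> ind (?A n) x} = (\<Union>i. S i) - ?A n"
    using sets.sets_into_space[OF U] by (auto simp: indicator_def)
  then have "measure M {x\<in>space M. ind (\<Union>i. S i) x \<noteq> ind (?A n) x} < \<epsilon>"
    using finite_measure_Diff[OF U A[of n] UN_mono[OF subset_UNIV order_refl]] n by simp
  then show "\<exists>\<gamma>'. tame \<gamma>' \<and> measure M {x\<in>space M. ind (\<Union>i. S i) x \<noteq> \<gamma>' x} < \<epsilon>"
    using tame_finite_UN[of S n, OF assms(2)] by (intro exI[of _ "ind (?A n)"] conjI)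
qed

lemma tame_null:
  assumes "S \<in> sets M" "tame (ind S')" "(S - S') \<union> (S' - S) \<in> null_sets M"
  shows "tame (ind S)"
proof (rule tame_approx[OF ind_observable[OF assms(1)]])
  fix \<epsilon> :: real assume e: "\<epsilon> > 0"
  have "(S - S') \<union> (S' - S) \<subseteq> space M" using assms(3) by (auto dest: null_setsD2 sets.sets_into_space)
  then have "{x\<in>space M. ind S x \<noteq> ind S' x} = (S - S') \<union> (S' - S)" by (auto simp: indicator_def)
  then have "measure M {x\<in>space M. ind S x \<noteq> ind S' x} = 0" using assms(3) by (simp add: measure_eq_0_null_sets)
  then show "\<exists>\<gamma>'. tame \<gamma>' \<and> measure M {x\<in>space M. ind S x \<noteq> \<gamma>' x} < \<epsilon>" using assms(2) e by auto
qed

text \<open>Measurability is carried through the induction because the union step approximates in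
  measure.\<close>

lemma tame_sigma_sets:
  assumes E: "\<And>S. S \<in> E \<Longrightarrow> S \<in> sets M \<and> tame (ind S)" and S: "S \<in> sigma_sets (space M) E"
  shows "S \<in> sets M \<and> tame (ind S)"
  using S
proof (induction rule: sigma_sets.induct)
  case Empty
  show ?case using tame_cong[OF _ tame_const[of 0]] by auto
next
  case (Compl S)
  then show ?case using tame_compl sets.sets_into_space by blast
next
  case (Union S)
  then show ?case using tame_UN by blast
qed (use E in blast)

text \<open>\<alpha> is the sum of its labels times the indicators of its level sets, and
  \<open>tame_combine\<close> allows sums.\<close>

lemma tame_observable:
  assumes A: "(A, \<alpha>) \<in> observables M" and t: "\<And>S. S \<in> sets M \<Longrightarrow> tame (ind S)"
  shows "tame \<alpha>"
proof -
  have "tame (\<lambda>x. \<Sum>b\<in>A'. b * ind (\<alpha> -` {b} \<inter> space M) x)" if "finite A'" "A' \<subseteq> A" for A'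
    using that
  proof (induction A' rule: finite_induct)
    case empty
    show ?case by (simp add: tame_const)
  next
    case (insert b A')
    have "\<alpha> -` {b} \<inter> space M \<in> sets M" using measurable_sets[OF obs_meas[OF A], of "{b}"] insert by auto
    then have "tame (\<lambda>x. b * ind (\<alpha> -` {b} \<inter> space M) x + (\<Sum>b\<in>A'. b * ind (\<alpha> -` {b} \<inter> space M) x))"
      using insert by (intro tame_combine[of "ind (\<alpha> -` {b} \<inter> space M)" _ "\<lambda>u v. b * u + v"] t) auto
    then show ?case unfolding sum.insert[OF insert.hyps] .
  qed
  from this[OF obs_finite[OF A] order_refl] show ?thesis
  proof (rule tame_cong[rotated])
    fix x assume x: "x \<in> space M"
    have "(\<Sum>b\<in>A. b * ind (\<alpha> -` {b} \<inter> space M) x) = (\<Sum>b\<in>A. if b = \<alpha> x then b else 0)"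
      using x by (intro sum.cong) (auto simp: indicator_def)
    also have "\<dots> = \<alpha> x" using obs_finite[OF A] obs_in[OF A x] by simp
    finally show "(\<Sum>b\<in>A. b * ind (\<alpha> -` {b} \<inter> space M) x) = \<alpha> x" .
  qed
qed

text \<open>The auxiliary observable of a tame \<alpha> is a refinement of it, and relabelling
  values cannot increase the number of labellings.\<close>

lemma entropy_nonpos:
  assumes "\<And>S. S \<in> sets M \<Longrightarrow> tame (ind S)"
  shows "sofic_entropy G d \<sigma> M a \<le> 0"
  unfolding sofic_entropy_def
proof (rule SUP_least, clarify)
  fix A \<alpha> assume A: "(A, \<alpha>) \<in> observables M"
  have t: "tame \<alpha>" using tame_observable[OF A assms] .
  show "(INF (B, \<beta>, \<pi>)\<in>refinements M A \<alpha>. entropy_rel G d \<sigma> M a B \<beta> \<pi>) \<le> 0"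
  proof (rule ereal_le_epsilon2)
    fix \<kappa> :: real assume \<kappa>: "\<kappa> > 0"
    obtain B \<beta> \<pi> F \<delta> where 1: "(B, \<beta>) \<in> observables M" "\<forall>x\<in>space M. \<pi> (\<beta> x) = \<alpha> x" "window F" "\<delta> > 0"
      "\<forall>\<^sub>F i in sequentially. real (card (micro B \<beta> \<pi> F \<delta> i)) \<le> exp (\<kappa> * d i)"
      using tameE[OF t \<kappa>] .
    obtain x0 where x0: "x0 \<in> space M" using not_empty by blast
    text \<open>\<open>\<pi>\<close> need not map unused labels into \<open>A\<close>.\<close>
    define \<rho> where "\<rho> c = (if c \<in> A then c else \<alpha> x0)" for c
    define \<pi>' where "\<pi>' b = \<rho> (\<pi> b)" for b
    have \<pi>': "(B, \<beta>, \<pi>') \<in> refinements M A \<alpha>"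
      using 1(1,2) obs_in[OF A] x0 by (auto simp: refinements_def \<pi>'_def \<rho>_def intro!: AE_I2)
    have 3: "entropy_at G d \<sigma> M a B \<beta> \<pi>' F \<delta> \<le> ereal \<kappa>"
      unfolding entropy_at_def
    proof (rule Limsup_bounded)
      show "\<forall>\<^sub>F i in sequentially. ereal (1 / real (d i)) *
        log_count (card ((\<lambda>\<phi>. \<lambda>j\<in>{1..d i}. \<pi>' (\<phi> j \<one>)) ` AP G M a B \<beta> F \<delta> (d i) (\<sigma> i))) \<le> ereal \<kappa>"
        using 1(5)
      proof eventually_elim
        case (elim i)
        let ?m = "micro B \<beta> \<pi> F \<delta> i" and ?m' = "(\<lambda>\<phi>. \<lambda>j\<in>{1..d i}. \<pi>' (\<phi> j \<one>)) ` AP G M a B \<beta> F \<delta> (d i) (\<sigma> i)"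
        have "?m' = (\<lambda>y. \<lambda>j\<in>{1..d i}. \<rho> (y j)) ` ?m"
          unfolding micro_def image_image by (rule image_cong) (auto simp: \<pi>'_def restrict_def)
        then have "card ?m' \<le> card ?m" using micro_finite[OF obs_finite[OF 1(1)] 1(3)] by (simp add: card_image_le)
        then have le: "real (card ?m') \<le> exp (\<kappa> * d i)" using elim by linarith
        show ?case
        proof (cases "card ?m' = 0")
          \<comment> \<open>No labelling at all gives the value -\<infinity>.\<close>
          case True
          then show ?thesis using d_pos[of i] by (simp add: log_count_def)
        next
          case False
          then have "ln (real (card ?m')) \<le> ln (exp (\<kappa> * d i))"
            using le by (intro ln_mono) simp_all
          then have "ln (real (card ?m')) \<le> \<kappa> * d i" by simp
          then have "1 / real (d i) * ln (real (card ?m')) \<le> \<kappa>" using d_pos[of i] by (simp add: field_simps)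
          then show ?thesis using False by (simp add: log_count_def)
        qed
      qed
    qed
    have 2: "entropy_rel G d \<sigma> M a B \<beta> \<pi>' \<le> entropy_at G d \<sigma> M a B \<beta> \<pi>' F \<delta>"
      unfolding entropy_rel_def by (rule INF_lower2[of "(F, \<delta>)"]) (use 1(3,4) in \<open>auto simp: window_def\<close>)
    have 1: "(INF (B, \<beta>, \<pi>)\<in>refinements M A \<alpha>. entropy_rel G d \<sigma> M a B \<beta> \<pi>) \<le> entropy_rel G d \<sigma> M a B \<beta> \<pi>'"
      by (rule INF_lower2[OF \<pi>']) simp
    show "(INF (B, \<beta>, \<pi>)\<in>refinements M A \<alpha>. entropy_rel G d \<sigma> M a B \<beta> \<pi>) \<le> 0 + ereal \<kappa>"
      using order_trans[OF 1 order_trans[OF 2 3]] by simp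
  qed
qed

end

section \<open>Microstates of a function and short columns\<close>

lemma L2_norm_triangle:
  assumes "f \<in> L2 N" "h \<in> L2 N"
  shows "L2_norm N (\<lambda>x. f x + h x) \<le> L2_norm N f + L2_norm N h"
proof -
  interpret semi_hilbert "L2 N" "L2_ip N" by (rule closed_subspace_semi_hilbert[OF closed_subspace_L2])
  show ?thesis using nrm_triangle[OF assms] by (simp add: nrm_def L2_norm_ip plus_fun_def)
qed

lemma L2_sum:
  assumes "finite A" "\<And>i. i \<in> A \<Longrightarrow> f i \<in> L2 N"
  shows "(\<lambda>x. \<Sum>i\<in>A. f i x) \<in> L2 N \<and> L2_norm N (\<lambda>x. \<Sum>i\<in>A. f i x) \<le> (\<Sum>i\<in>A. L2_norm N (f i))"
  using assms
proof (induction A rule: finite_induct)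
  case empty
  show ?case by (simp add: L2_0) (simp add: L2_norm_def)
next
  case (insert i A)
  then have "(\<lambda>x. \<Sum>i\<in>A. f i x) \<in> L2 N" "L2_norm N (\<lambda>x. \<Sum>i\<in>A. f i x) \<le> (\<Sum>i\<in>A. L2_norm N (f i))" "f i \<in> L2 N"
    by auto
  then show ?case
    using L2_norm_triangle[of "f i" N "\<lambda>x. \<Sum>i\<in>A. f i x"] L2_add[of "f i" N "\<lambda>x. \<Sum>i\<in>A. f i x"] insert.hyps by simp
qed

text \<open>Dominated convergence: the approximants satisfy |s| <= 2 |f|, so 9 |f|^2 majorises the
  squared errors.\<close>

lemma L2_simple_approx:
  assumes f: "f \<in> L2 N" and e: "e > 0"
  obtains s where "simple_function N s" "s \<in> L2 N" "L2_norm N (\<lambda>x. f x - s x) < e"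
proof -
  have [measurable]: "f \<in> borel_measurable N" using L2D(1)[OF f] .
  from borel_measurable_implies_sequence_metric[OF this, of 0]
  obtain S where S: "\<And>i. simple_function N (S i)" and lim: "\<And>x. x \<in> space N \<Longrightarrow> (\<lambda>i. S i x) \<longlonglongrightarrow> f x"
    and le: "\<And>i x. x \<in> space N \<Longrightarrow> cmod (S i x) \<le> 2 * cmod (f x)" by simp metis
  have [measurable]: "S i \<in> borel_measurable N" for i using S by (rule borel_measurable_simple_function)
  have bd: "(cmod (f x - S i x))\<^sup>2 \<le> 9 * (cmod (f x))\<^sup>2" if "x \<in> space N" for x i
  proof -
    have "cmod (f x - S i x) \<le> cmod (f x) + cmod (S i x)" by (rule norm_triangle_ineq4)
    also have "\<dots> \<le> 3 * cmod (f x)" using le[OF that, of i] by simp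
    finally have "(cmod (f x - S i x))\<^sup>2 \<le> (3 * cmod (f x))\<^sup>2" by (rule power_mono) simp
    then show ?thesis by (simp add: power_mult_distrib)
  qed
  have "(\<lambda>i. \<integral>x. (cmod (f x - S i x))\<^sup>2 \<partial>N) \<longlonglongrightarrow> (\<integral>x. 0 \<partial>N)"
  proof (rule integral_dominated_convergence[where w = "\<lambda>x. 9 * (cmod (f x))\<^sup>2"])
    show "integrable N (\<lambda>x. 9 * (cmod (f x))\<^sup>2)" using L2D(2)[OF f] by simp
    show "AE x in N. (\<lambda>i. (cmod (f x - S i x))\<^sup>2) \<longlonglongrightarrow> 0"
    proof (rule AE_I2)
      fix x assume "x \<in> space N"
      then have "(\<lambda>i. (cmod (f x - S i x))\<^sup>2) \<longlonglongrightarrow> (cmod (f x - f x))\<^sup>2" by (intro tendsto_intros lim)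
      then show "(\<lambda>i. (cmod (f x - S i x))\<^sup>2) \<longlonglongrightarrow> 0" by simp
    qed
    show "AE x in N. norm ((cmod (f x - S i x))\<^sup>2) \<le> 9 * (cmod (f x))\<^sup>2" for i using bd by (intro AE_I2) simp
  qed auto
  then have "(\<lambda>i. sqrt (\<integral>x. (cmod (f x - S i x))\<^sup>2 \<partial>N)) \<longlonglongrightarrow> sqrt 0" by (intro tendsto_real_sqrt) simp
  then have "\<forall>\<^sub>F i in sequentially. L2_norm N (\<lambda>x. f x - S i x) < e"
    unfolding L2_norm_def using e by (intro order_tendstoD(2)[where y = "sqrt 0"]) simp_all
  then obtain i where i: "L2_norm N (\<lambda>x. f x - S i x) < e" by (auto simp: eventually_sequentially)
  have "integrable N (\<lambda>x. (cmod (f x - S i x))\<^sup>2)"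
  proof (rule Bochner_Integration.integrable_bound[of N "\<lambda>x. 9 * (cmod (f x))\<^sup>2"])
    show "AE x in N. norm ((cmod (f x - S i x))\<^sup>2) \<le> norm (9 * (cmod (f x))\<^sup>2)" using bd by (intro AE_I2) simp
  qed (use L2D(2)[OF f] in auto)
  then have "(\<lambda>x. f x - S i x) \<in> L2 N" by (simp add: L2_def)
  from L2_diff[OF f this] have "S i \<in> L2 N" by simp
  then show thesis using that S i by blast
qed

section \<open>The matrix of a coefficient function in the sofic approximation\<close>

context sofic_pmp
begin

text \<open>The entry of T = sum c(g) sigma(g) in column j and row k: sigma(g) sends the j-th basis
  vector to the one with index \<open>\<sigma> i g j\<close>.\<close>

definition column :: "'g set \<Rightarrow> ('g \<Rightarrow> complex) \<Rightarrow> nat \<Rightarrow> nat \<Rightarrow> nat \<Rightarrow> complex" where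
  "column F c i j k = (\<Sum>g\<in>F. c g * (if \<sigma> i g j = k then 1 else 0))"

lemma \<sigma>_in: "g \<in> carrier G \<Longrightarrow> j \<in> {1..d i} \<Longrightarrow> \<sigma> i g j \<in> {1..d i}"
  using permutes_in_image[OF \<sigma>_perm] by blast

text \<open>The l1 norm of c bounds each entry of the column and also their total. The crude product
  of the two is meant for the few columns with coincidences.\<close>

lemma column_sum_le:
  assumes F: "finite F" "F \<subseteq> carrier G"
  shows "(\<Sum>k\<in>{1..d i}. (cmod (column F c i j k))\<^sup>2) \<le> (\<Sum>g\<in>F. cmod (c g))\<^sup>2"
proof -
  let ?C = "\<Sum>g\<in>F. cmod (c g)"
  have le: "cmod (column F c i j k) \<le> (\<Sum>g\<in>F. cmod (c g) * (if \<sigma> i g j = k then 1 else 0))" for k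
    unfolding column_def by (rule order_trans[OF norm_sum]) (auto intro!: sum_mono simp: norm_mult)
  have "cmod (column F c i j k) \<le> ?C" for k
    by (rule order_trans[OF le]) (auto intro!: sum_mono)
  then have "(\<Sum>k\<in>{1..d i}. (cmod (column F c i j k))\<^sup>2) \<le> (\<Sum>k\<in>{1..d i}. ?C * cmod (column F c i j k))"
    by (intro sum_mono) (auto simp: power2_eq_square intro!: mult_right_mono)
  also have "\<dots> = ?C * (\<Sum>k\<in>{1..d i}. cmod (column F c i j k))" by (simp add: sum_distrib_left)
  also have "(\<Sum>k\<in>{1..d i}. cmod (column F c i j k)) \<le> (\<Sum>k\<in>{1..d i}. \<Sum>g\<in>F. cmod (c g) * (if \<sigma> i g j = k then 1 else 0))"
    by (intro sum_mono le)
  also have "\<dots> = (\<Sum>g\<in>F. \<Sum>k\<in>{1..d i}. cmod (c g) * (if \<sigma> i g j = k then 1 else 0))" by (rule sum.swap)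
  also have "\<dots> \<le> ?C"
    by (intro sum_mono) (auto simp: sum_distrib_left[symmetric] mult_left_le)
  finally show ?thesis by (simp add: power2_eq_square mult_left_mono sum_nonneg)
qed

text \<open>When the points \<open>\<sigma> i g j\<close> are distinct, the coefficients sit in
  distinct rows and do not interfere.\<close>

lemma column_sum_good:
  assumes F: "finite F" "F \<subseteq> carrier G" and j: "j \<in> {1..d i}" and inj: "inj_on (\<lambda>g. \<sigma> i g j) F"
  shows "(\<Sum>k\<in>{1..d i}. (cmod (column F c i j k))\<^sup>2) = (\<Sum>g\<in>F. (cmod (c g))\<^sup>2)"
proof -
  have c1: "column F c i j (\<sigma> i g j) = c g" if "g \<in> F" for g
  proof -
    have "column F c i j (\<sigma> i g j) = (\<Sum>h\<in>F. if h = g then c h else 0)"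
      unfolding column_def using inj that by (intro sum.cong) (auto simp: inj_on_def)
    then show ?thesis using F that by simp
  qed
  have c0: "column F c i j k = 0" if "k \<notin> (\<lambda>g. \<sigma> i g j) ` F" for k
    unfolding column_def using that by (intro sum.neutral) auto
  have "(\<Sum>k\<in>{1..d i}. (cmod (column F c i j k))\<^sup>2) = (\<Sum>k\<in>(\<lambda>g. \<sigma> i g j) ` F. (cmod (column F c i j k))\<^sup>2)"
    by (rule sum.mono_neutral_right) (use F j \<sigma>_in c0 in auto)
  also have "\<dots> = (\<Sum>g\<in>F. (cmod (c g))\<^sup>2)" using inj by (simp add: sum.reindex c1)
  finally show ?thesis .
qed

text \<open>Asymptotic freeness for the finitely many pairs of distinct elements of
  \<open>F\<close>, each pair being allowed its share of e.\<close>

lemma few_coincidences: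
  assumes F: "finite F" "F \<subseteq> carrier G" and e: "e > (0::real)"
  shows "\<forall>\<^sub>F i in sequentially. real (card {j\<in>{1..d i}. \<not> inj_on (\<lambda>g. \<sigma> i g j) F}) \<le> e * d i"
proof -
  define P where "P = {(g, h). g \<in> F \<and> h \<in> F \<and> g \<noteq> h}"
  have P: "finite P" by (rule finite_subset[of _ "F \<times> F"]) (use F in \<open>auto simp: P_def\<close>)
  define e' where "e' = e / (card P + 1)"
  have e': "e' > 0" using e by (simp add: e'_def)
  have "\<forall>\<^sub>F i in sequentially. real (card {j\<in>{1..d i}. \<sigma> i (fst p) j = \<sigma> i (snd p) j}) \<le> e' * d i" if p: "p \<in> P" for p
  proof -
    have gh: "fst p \<in> carrier G" "snd p \<in> carrier G" "fst p \<noteq> snd p" using p F by (auto simp: P_def)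
    then have "(\<lambda>i. measure (unif (d i)) {k\<in>{1..d i}. \<sigma> i (fst p) k \<noteq> \<sigma> i (snd p) k}) \<longlonglongrightarrow> 1"
      using sofic by (simp add: sofic_approximation_def)
    then have "\<forall>\<^sub>F i in sequentially. measure (unif (d i)) {k\<in>{1..d i}. \<sigma> i (fst p) k \<noteq> \<sigma> i (snd p) k} > 1 - e'"
      by (rule order_tendstoD) (use e' in simp)
    then show ?thesis
    proof eventually_elim
      case (elim i)
      let ?N = "{k\<in>{1..d i}. \<sigma> i (fst p) k \<noteq> \<sigma> i (snd p) k}" and ?E = "{k\<in>{1..d i}. \<sigma> i (fst p) k = \<sigma> i (snd p) k}"
      have m: "measure (unif (d i)) ?N = card ?N / d i" using d_pos by (intro unif_measure) auto
      have "card ?N + card ?E = card (?N \<union> ?E)" by (rule card_Un_disjoint[symmetric]) auto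
      also have "?N \<union> ?E = {1..d i}" by auto
      finally have "card ?N + card ?E = d i" by simp
      then have s: "real (card ?E) = d i - real (card ?N)" by linarith
      have "(1 - e') * d i < card ?N" using elim d_pos[of i] unfolding m by (simp add: pos_less_divide_eq)
      then show ?case unfolding s by (simp add: left_diff_distrib)
    qed
  qed
  then have "\<forall>\<^sub>F i in sequentially. \<forall>p\<in>P. real (card {j\<in>{1..d i}. \<sigma> i (fst p) j = \<sigma> i (snd p) j}) \<le> e' * d i"
    using P by (simp add: eventually_ball_finite_distrib)
  then show ?thesis
  proof eventually_elim
    case (elim i)
    have "{j\<in>{1..d i}. \<not> inj_on (\<lambda>g. \<sigma> i g j) F} \<subseteq> (\<Union>p\<in>P. {j\<in>{1..d i}. \<sigma> i (fst p) j = \<sigma> i (snd p) j})"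
      by (fastforce simp: inj_on_def P_def)
    then have "card {j\<in>{1..d i}. \<not> inj_on (\<lambda>g. \<sigma> i g j) F} \<le> card (\<Union>p\<in>P. {j\<in>{1..d i}. \<sigma> i (fst p) j = \<sigma> i (snd p) j})"
      using P by (intro card_mono) auto
    also have "\<dots> \<le> (\<Sum>p\<in>P. card {j\<in>{1..d i}. \<sigma> i (fst p) j = \<sigma> i (snd p) j})" using P by (rule card_UN_le)
    finally have "real (card {j\<in>{1..d i}. \<not> inj_on (\<lambda>g. \<sigma> i g j) F}) \<le> (\<Sum>p\<in>P. real (card {j\<in>{1..d i}. \<sigma> i (fst p) j = \<sigma> i (snd p) j}))"
      by (simp flip: of_nat_sum)
    also have "\<dots> \<le> (\<Sum>p\<in>P. e' * d i)" using elim by (intro sum_mono) auto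
    also have "\<dots> = card P * e' * d i" by simp
    also have "card P * e' \<le> e" using e by (simp add: e'_def field_simps)
    finally show ?case by (simp add: mult_right_mono)
  qed
qed

text \<open>Good columns have squared norm below e^2. The others are made so rare, at proportion e^2
  / (C + 1) with C the squared l1 norm of c, that together they add at most another e^2 d.\<close>

lemma column_bound:
  assumes F: "finite F" "F \<subseteq> carrier G" and c: "(\<Sum>g\<in>F. (cmod (c g))\<^sup>2) < e\<^sup>2"
  shows "\<forall>\<^sub>F i in sequentially. (\<Sum>j\<in>{1..d i}. \<Sum>k\<in>{1..d i}. (cmod (column F c i j k))\<^sup>2) \<le> 2 * e\<^sup>2 * d i"
proof -
  let ?C = "(\<Sum>g\<in>F. cmod (c g))\<^sup>2"
  have e2: "e\<^sup>2 > 0" using c sum_nonneg[of F "\<lambda>g. (cmod (c g))\<^sup>2"] by (smt (verit) zero_le_power2)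
  have C1: "?C + 1 > 0" by (smt (verit) zero_le_power2)
  then have "e\<^sup>2 / (?C + 1) > 0" using e2 by simp
  from few_coincidences[OF F this] show ?thesis
  proof eventually_elim
    case (elim i)
    let ?bad = "{j\<in>{1..d i}. \<not> inj_on (\<lambda>g. \<sigma> i g j) F}"
    have "(\<Sum>k\<in>{1..d i}. (cmod (column F c i j k))\<^sup>2) \<le> e\<^sup>2 + (if j \<in> ?bad then ?C else 0)" if "j \<in> {1..d i}" for j
    proof (cases "inj_on (\<lambda>g. \<sigma> i g j) F")
      case True
      then show ?thesis using column_sum_good[OF F that, where c = c] c by simp
    next
      case False
      have "(\<Sum>k\<in>{1..d i}. (cmod (column F c i j k))\<^sup>2) \<le> e\<^sup>2 + ?C"
        using column_sum_le[OF F, where i = i and c = c and j = j] e2 by linarith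
      then show ?thesis using False that by simp
    qed
    then have "(\<Sum>j\<in>{1..d i}. \<Sum>k\<in>{1..d i}. (cmod (column F c i j k))\<^sup>2) \<le> (\<Sum>j\<in>{1..d i}. e\<^sup>2 + (if j \<in> ?bad then ?C else 0))"
      by (rule sum_mono)
    also have "\<dots> = e\<^sup>2 * d i + ?C * card ?bad"
    proof -
      have "(\<Sum>j\<in>{1..d i}. if j \<in> ?bad then ?C else 0) = (\<Sum>j\<in>?bad. ?C)"
        by (rule sum.mono_neutral_cong_right) auto
      then show ?thesis by (simp add: sum.distrib)
    qed
    also have "?C * card ?bad \<le> ?C * (e\<^sup>2 / (?C + 1) * d i)" using elim by (intro mult_left_mono) auto
    also have "\<dots> = ?C / (?C + 1) * (e\<^sup>2 * d i)" by simp
    also have "\<dots> \<le> 1 * (e\<^sup>2 * d i)" using C1 by (intro mult_right_mono) auto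
    finally show ?case by (simp add: mult_ac)
  qed
qed

text \<open>T v at k is the sum of c(g) v(sigma(g)^-1 k), the finite counterpart of rho(c); in this
  form the equivariance clause of \<open>AP\<close> applies to it.\<close>

lemma column_apply:
  assumes F: "finite F" "F \<subseteq> carrier G" and k: "k \<in> {1..d i}"
  shows "(\<Sum>j\<in>{1..d i}. v j * column F c i j k) = (\<Sum>g\<in>F. c g * v (inv_into {1..d i} (\<sigma> i g) k))"
proof -
  have "(\<Sum>j\<in>{1..d i}. v j * column F c i j k) = (\<Sum>j\<in>{1..d i}. \<Sum>g\<in>F. c g * (if \<sigma> i g j = k then v j else 0))"
    unfolding column_def sum_distrib_left by (intro sum.cong) auto
  also have "\<dots> = (\<Sum>g\<in>F. \<Sum>j\<in>{1..d i}. c g * (if \<sigma> i g j = k then v j else 0))" by (rule sum.swap)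
  also have "\<dots> = (\<Sum>g\<in>F. c g * v (inv_into {1..d i} (\<sigma> i g) k))"
  proof (rule sum.cong[OF refl])
    fix g assume "g \<in> F"
    then have p: "\<sigma> i g permutes {1..d i}" using F \<sigma>_perm by blast
    let ?k = "inv_into {1..d i} (\<sigma> i g) k"
    have k': "?k \<in> {1..d i}" using inv_perm_in[OF p k] .
    have "\<sigma> i g j = k \<longleftrightarrow> j = ?k" if "j \<in> {1..d i}" for j
      using that k permutes_image[OF p] permutes_inj_on[OF p, of "{1..d i}"]
      by (metis f_inv_into_f inv_into_f_f)
    then have "(\<Sum>j\<in>{1..d i}. c g * (if \<sigma> i g j = k then v j else 0)) = (\<Sum>j\<in>{1..d i}. if j = ?k then c g * v j else 0)"
      by (intro sum.cong) auto
    then show "(\<Sum>j\<in>{1..d i}. c g * (if \<sigma> i g j = k then v j else 0)) = c g * v ?k" using k' by simp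
  qed
  finally show ?thesis .
qed

text \<open>Replacing v(sigma(g)^-1 k) by the value read off the pattern at k turns the residual
  into a function of the pattern, whose mean square is \<epsilon> up to statistical error. The
  replacement is exact off at most |F| \<delta> d coordinates, and there it costs at most 2 Q C. The
  leading factor 2 comes from squaring a sum of two terms.\<close>

lemma micro_invariance:
  assumes B: "(B, \<beta>) \<in> observables M" and F: "finite F" "F \<subseteq> carrier G"
    and q: "\<And>b. b \<in> B \<Longrightarrow> cmod (q b) \<le> Q" and Q: "Q \<ge> 0"
    and \<phi>: "\<phi> \<in> AP G M a B \<beta> (insert \<one> F) \<delta> (d i) (\<sigma> i)" and \<delta>: "\<delta> > 0"
    and I: "(\<integral>x. (cmod (q (\<beta> x) - (\<Sum>g\<in>F. c g * q (\<beta> (a (inv g) x)))))\<^sup>2 \<partial>M) \<le> \<epsilon>"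
  defines "C \<equiv> \<Sum>g\<in>F. cmod (c g)" and "v \<equiv> \<lambda>j. q (\<phi> j \<one>)"
  shows "(\<Sum>k\<in>{1..d i}. (cmod (v k - (\<Sum>j\<in>{1..d i}. v j * column F c i j k)))\<^sup>2)
    \<le> 2 * (\<epsilon> + (Q * (1 + C))\<^sup>2 * \<delta> + (2 * Q * C)\<^sup>2 * card F * \<delta>) * d i"
proof -
  let ?F = "insert \<one> F" and ?J = "{1..d i}"
  let ?\<tau> = "\<lambda>g k. inv_into ?J (\<sigma> i g) k"
  have W: "window ?F" using F by (auto simp: window_def)
  have C0: "C \<ge> 0" by (simp add: C_def sum_nonneg)
  have \<phi>B: "\<phi> k g \<in> B" if "k \<in> ?J" "g \<in> ?F" for k g
    using AP_D(1)[OF \<phi>] that by (meson PiE_mem)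
  have \<tau>: "?\<tau> g k \<in> ?J" if "k \<in> ?J" "g \<in> F" for g k
    using inv_perm_in[OF \<sigma>_perm that(1)] that F by blast
  define \<Theta> where "\<Theta> b = (cmod (q (b \<one>) - (\<Sum>g\<in>F. c g * q (b g))))\<^sup>2" for b
  define u where "u k = (\<Sum>g\<in>F. c g * (q (\<phi> k g) - v (?\<tau> g k)))" for k
  have "(\<Sum>k\<in>?J. \<Theta> (\<phi> k)) \<le> ((\<integral>x. \<Theta> (pat \<beta> ?F x) \<partial>M) + (Q * (1 + C))\<^sup>2 * \<delta>) * d i"
  proof (rule AP_expectation[OF B W d_pos \<phi>])
    fix b assume b: "b \<in> ?F \<rightarrow>\<^sub>E B"
    have qb: "cmod (q (b g)) \<le> Q" if "g \<in> ?F" for g using q[of "b g"] b that by (meson PiE_mem)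
    have "cmod (\<Sum>g\<in>F. c g * q (b g)) \<le> (\<Sum>g\<in>F. cmod (c g) * Q)"
      by (rule order_trans[OF norm_sum]) (auto simp: norm_mult intro!: sum_mono mult_left_mono qb)
    then have "cmod (q (b \<one>) - (\<Sum>g\<in>F. c g * q (b g))) \<le> Q + C * Q"
      using norm_triangle_ineq4[of "q (b \<one>)" "\<Sum>g\<in>F. c g * q (b g)"] qb[of \<one>] by (simp add: C_def sum_distrib_right)
    then have "(cmod (q (b \<one>) - (\<Sum>g\<in>F. c g * q (b g))))\<^sup>2 \<le> (Q * (1 + C))\<^sup>2"
      by (intro power_mono) (auto simp: algebra_simps)
    then show "\<bar>\<Theta> b\<bar> \<le> (Q * (1 + C))\<^sup>2" by (simp add: \<Theta>_def)
  qed simp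
  also have "(\<integral>x. \<Theta> (pat \<beta> ?F x) \<partial>M) = (\<integral>x. (cmod (q (\<beta> x) - (\<Sum>g\<in>F. c g * q (\<beta> (a (inv g) x)))))\<^sup>2 \<partial>M)"
  proof (rule Bochner_Integration.integral_cong[OF refl])
    fix x assume "x \<in> space M"
    then have "\<Theta> (pat \<beta> ?F x) = (cmod (q (\<beta> x) - (\<Sum>g\<in>F. c g * q (pat \<beta> ?F x g))))\<^sup>2"
      using pat_one[OF W] by (simp add: \<Theta>_def)
    also have "(\<Sum>g\<in>F. c g * q (pat \<beta> ?F x g)) = (\<Sum>g\<in>F. c g * q (\<beta> (a (inv g) x)))"
      by (intro sum.cong) (auto simp: observable_pattern_def)
    finally show "\<Theta> (pat \<beta> ?F x) = (cmod (q (\<beta> x) - (\<Sum>g\<in>F. c g * q (\<beta> (a (inv g) x)))))\<^sup>2" .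
  qed
  also have "(\<dots> + (Q * (1 + C))\<^sup>2 * \<delta>) * d i \<le> (\<epsilon> + (Q * (1 + C))\<^sup>2 * \<delta>) * d i"
    using I by (intro mult_right_mono) auto
  finally have T: "(\<Sum>k\<in>?J. \<Theta> (\<phi> k)) \<le> (\<epsilon> + (Q * (1 + C))\<^sup>2 * \<delta>) * d i" .
  let ?bad = "\<Union>g\<in>F. {k\<in>?J. \<phi> k g \<noteq> \<phi> (?\<tau> g k) \<one>}"
  have "real (card ?bad) \<le> (\<Sum>g\<in>F. real (card {k\<in>?J. \<phi> k g \<noteq> \<phi> (?\<tau> g k) \<one>}))"
    unfolding of_nat_sum[symmetric] by (intro of_nat_mono card_UN_le F)
  also have "\<dots> \<le> (\<Sum>g\<in>F. \<delta> * d i)"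
  proof (rule sum_mono)
    fix g assume "g \<in> F"
    then have "measure (unif (d i)) {k\<in>?J. \<phi> k g \<noteq> \<phi> (?\<tau> g k) \<one>} < \<delta>" by (intro AP_D(3)[OF \<phi>]) auto
    moreover have "measure (unif (d i)) {k\<in>?J. \<phi> k g \<noteq> \<phi> (?\<tau> g k) \<one>} = card {k\<in>?J. \<phi> k g \<noteq> \<phi> (?\<tau> g k) \<one>} / d i"
      using d_pos by (intro unif_measure) auto
    ultimately show "real (card {k\<in>?J. \<phi> k g \<noteq> \<phi> (?\<tau> g k) \<one>}) \<le> \<delta> * d i"
      using d_pos[of i] by (simp add: pos_divide_less_eq less_imp_le)
  qed
  finally have bad: "real (card ?bad) \<le> card F * (\<delta> * d i)" by simp
  have u_bad: "(cmod (u k))\<^sup>2 \<le> (if k \<in> ?bad then (2 * Q * C)\<^sup>2 else 0)" if k: "k \<in> ?J" for k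
  proof (cases "k \<in> ?bad")
    case True
    have "cmod (u k) \<le> (\<Sum>g\<in>F. cmod (c g) * (2 * Q))"
      unfolding u_def
    proof (rule order_trans[OF norm_sum], rule sum_mono)
      fix g assume g: "g \<in> F"
      have "cmod (q (\<phi> k g) - v (?\<tau> g k)) \<le> cmod (q (\<phi> k g)) + cmod (v (?\<tau> g k))" by (rule norm_triangle_ineq4)
      also have "\<dots> \<le> 2 * Q" using q[OF \<phi>B[OF k, of g]] q[OF \<phi>B[OF \<tau>[OF k g], of \<one>]] g by (simp add: v_def)
      finally show "cmod (c g * (q (\<phi> k g) - v (?\<tau> g k))) \<le> cmod (c g) * (2 * Q)"
        by (simp add: norm_mult mult_left_mono)
    qed
    also have "\<dots> = 2 * Q * C" by (simp add: C_def sum_distrib_left mult_ac)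
    finally show ?thesis using True by (simp add: power_mono)
  next
    case False
    then have "u k = 0" using k by (auto simp: u_def v_def intro!: sum.neutral)
    then show ?thesis using False by simp
  qed
  have "(\<Sum>k\<in>?J. (cmod (u k))\<^sup>2) \<le> (\<Sum>k\<in>?J. if k \<in> ?bad then (2 * Q * C)\<^sup>2 else 0)" by (intro sum_mono u_bad)
  also have "\<dots> = (\<Sum>k\<in>?bad. (2 * Q * C)\<^sup>2)" by (rule sum.mono_neutral_cong_right) auto
  also have "\<dots> = (2 * Q * C)\<^sup>2 * card ?bad" by simp
  also have "\<dots> \<le> (2 * Q * C)\<^sup>2 * (card F * (\<delta> * d i))" using bad by (intro mult_left_mono) auto
  finally have U: "(\<Sum>k\<in>?J. (cmod (u k))\<^sup>2) \<le> (2 * Q * C)\<^sup>2 * card F * \<delta> * d i" by (simp add: mult_ac)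
  have "v k - (\<Sum>j\<in>?J. v j * column F c i j k) = (q (\<phi> k \<one>) - (\<Sum>g\<in>F. c g * q (\<phi> k g))) + u k" if "k \<in> ?J" for k
    unfolding column_apply[OF F that] u_def by (simp add: v_def right_diff_distrib sum_subtractf)
  then have "(\<Sum>k\<in>?J. (cmod (v k - (\<Sum>j\<in>?J. v j * column F c i j k)))\<^sup>2) \<le> (\<Sum>k\<in>?J. 2 * \<Theta> (\<phi> k) + 2 * (cmod (u k))\<^sup>2)"
    unfolding \<Theta>_def by (intro sum_mono) (simp only: cmod_add_sq_le)
  also have "\<dots> = 2 * (\<Sum>k\<in>?J. \<Theta> (\<phi> k)) + 2 * (\<Sum>k\<in>?J. (cmod (u k))\<^sup>2)"
    by (simp add: sum.distrib sum_distrib_left)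
  also have "\<dots> \<le> 2 * ((\<epsilon> + (Q * (1 + C))\<^sup>2 * \<delta>) * d i) + 2 * ((2 * Q * C)\<^sup>2 * card F * \<delta> * d i)"
    using T U by (intro add_mono mult_left_mono) auto
  also have "\<dots> = 2 * (\<epsilon> + (Q * (1 + C))\<^sup>2 * \<delta> + (2 * Q * C)\<^sup>2 * card F * \<delta>) * d i"
    by (simp add: algebra_simps)
  finally show ?thesis .
qed

end

section \<open>Level sets have no entropy\<close>

lemma cmod_sum4_sq_le: "(cmod (x + y + z + w))\<^sup>2 \<le> 4 * ((cmod x)\<^sup>2 + (cmod y)\<^sup>2 + (cmod z)\<^sup>2 + (cmod w)\<^sup>2)"
proof -
  have "(cmod ((x + y) + (z + w)))\<^sup>2 \<le> 2 * (cmod (x + y))\<^sup>2 + 2 * (cmod (z + w))\<^sup>2" by (rule cmod_add_sq_le)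
  also have "\<dots> \<le> 2 * (2 * (cmod x)\<^sup>2 + 2 * (cmod y)\<^sup>2) + 2 * (2 * (cmod z)\<^sup>2 + 2 * (cmod w)\<^sup>2)"
    by (intro add_mono mult_left_mono cmod_add_sq_le) auto
  finally show ?thesis by (simp add: add.assoc)
qed

context sofic_pmp
begin

section \<open>Measure estimates for level sets and simple approximations\<close>

lemma chebyshev_L2:
  assumes D: "D \<in> L2 M" and \<eta>: "\<eta> > 0"
  shows "measure M {x\<in>space M. cmod (D x) \<ge> \<eta>} \<le> (L2_norm M D)\<^sup>2 / \<eta>\<^sup>2"
proof -
  have [measurable]: "D \<in> borel_measurable M" using L2D(1)[OF D] .
  let ?S = "{x\<in>space M. cmod (D x) \<ge> \<eta>}"
  have S: "?S \<in> sets M" by measurable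
  have "measure M ?S = (\<integral>x. indicator ?S x \<partial>M)" using S by (simp add: Int_absorb2 sets.sets_into_space)
  also have "\<dots> \<le> (\<integral>x. (cmod (D x))\<^sup>2 / \<eta>\<^sup>2 \<partial>M)"
  proof (rule integral_mono)
    show "integrable M (indicator ?S :: _ \<Rightarrow> real)" using S by (simp add: emeasure_eq_measure)
    show "integrable M (\<lambda>x. (cmod (D x))\<^sup>2 / \<eta>\<^sup>2)" using L2D(2)[OF D] by simp
    fix x
    show "indicator ?S x \<le> (cmod (D x))\<^sup>2 / \<eta>\<^sup>2"
    proof (cases "x \<in> ?S")
      case True
      then have "\<eta>\<^sup>2 \<le> (cmod (D x))\<^sup>2" using \<eta> by (intro power_mono) auto
      then show ?thesis using True \<eta> by simp
    qed simp
  qed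
  also have "\<dots> = (L2_norm M D)\<^sup>2 / \<eta>\<^sup>2" by (simp add: L2_norm_def)
  finally show ?thesis .
qed

text \<open>It bounds the l1 size of a microstate independently of how fine the simple approximation
  is.\<close>

lemma integral_cmod_le:
  assumes f: "f \<in> L2 M"
  shows "(\<integral>x. cmod (f x) \<partial>M) \<le> 1 + (L2_norm M f)\<^sup>2"
proof -
  have "(\<integral>x. cmod (f x) \<partial>M) \<le> (\<integral>x. 1 + (cmod (f x))\<^sup>2 \<partial>M)"
  proof (rule integral_mono')
    show "integrable M (\<lambda>x. 1 + (cmod (f x))\<^sup>2)" using L2D(2)[OF f] by simp
    fix x
    have "0 \<le> (cmod (f x) - 1)\<^sup>2" "0 \<le> cmod (f x)" by auto
    then show "cmod (f x) \<le> 1 + (cmod (f x))\<^sup>2" unfolding power2_diff power_one mult_1_right by linarith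
  qed simp
  also have "\<dots> = 1 + (L2_norm M f)\<^sup>2" using L2D(2)[OF f] by (simp add: L2_norm_def prob_space)
  finally show ?thesis .
qed

text \<open>The strips omit the level t itself, so they decrease to the empty set even if u takes
  the value t on a set of positive measure.\<close>

lemma thin_strip:
  assumes [measurable]: "u \<in> borel_measurable M" and e: "e > 0"
  obtains \<eta> :: real where "\<eta> > 0" "measure M {x\<in>space M. t < u x \<and> u x \<le> t + \<eta>} < e"
proof -
  let ?S = "\<lambda>n. {x\<in>space M. t < u x \<and> u x \<le> t + 1 / Suc n}"
  have "(\<lambda>n. measure M (?S n)) \<longlonglongrightarrow> measure M (\<Inter>n. ?S n)"
  proof (rule finite_Lim_measure_decseq)
    show "range ?S \<subseteq> events" by auto
    show "decseq ?S"
    proof (rule decseq_SucI, rule subsetI)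
      fix n x assume x: "x \<in> ?S (Suc n)"
      have "1 / real (Suc (Suc n)) \<le> 1 / real (Suc n)" by (intro divide_left_mono) auto
      then show "x \<in> ?S n" using x by auto
    qed
  qed
  moreover have "(\<Inter>n. ?S n) = {}"
  proof (rule equals0I)
    fix x assume x: "x \<in> (\<Inter>n. ?S n)"
    then have "u x - t > 0" by auto
    then obtain n where "1 / Suc n < u x - t" using nat_approx_posE by blast
    moreover have "u x \<le> t + 1 / Suc n" using x by blast
    ultimately show False by simp
  qed
  ultimately have "(\<lambda>n. measure M (?S n)) \<longlonglongrightarrow> 0" by simp
  then have "\<forall>\<^sub>F n in sequentially. measure M (?S n) < e" using e by (rule order_tendstoD)
  then obtain n where "measure M (?S n) < e" by (auto simp: eventually_sequentially)
  then show thesis by (intro that[of "1 / Suc n"]) auto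
qed

lemma simple_observable:
  assumes s: "simple_function M s"
  obtains B \<beta> q where "(B, \<beta>) \<in> observables M" "\<And>x. x \<in> space M \<Longrightarrow> q (\<beta> x) = s x"
proof -
  have fin: "finite (s ` space M)" using simple_functionD(1)[OF s] .
  obtain e :: "_ \<Rightarrow> nat" where e: "inj_on e (s ` space M)" using finite_imp_inj_to_nat_seg[OF fin] by blast
  let ?B = "e ` s ` space M"
  have "(\<lambda>x. e (s x)) \<in> measurable M (count_space ?B)"
  proof (rule measurable_count_space_eq2[THEN iffD2], intro finite_imageI fin, intro conjI ballI)
    fix b assume "b \<in> ?B"
    then obtain x where x: "x \<in> space M" "b = e (s x)" by auto
    have "(\<lambda>x. e (s x)) -` {b} \<inter> space M = s -` {s x} \<inter> space M"
      using e x by (auto simp: inj_on_def)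
    then show "(\<lambda>x. e (s x)) -` {b} \<inter> space M \<in> sets M" using simple_functionD(2)[OF s] by simp
  qed auto
  then have "(?B, \<lambda>x. e (s x)) \<in> observables M" using fin by (simp add: observables_def)
  moreover have "inv_into (s ` space M) e (e (s x)) = s x" if "x \<in> space M" for x
    using e that by (simp add: inv_into_f_f)
  ultimately show thesis by (rule that)
qed

lemma three_level_observable:
  fixes u :: "'x \<Rightarrow> real"
  assumes [measurable]: "u \<in> borel_measurable M"
  shows "({0, 1, 2}, \<lambda>x. if u x \<le> t then 0 else if u x \<le> t + \<eta> then 1 else 2) \<in> observables M"
proof -
  have "(\<lambda>x. if u x \<le> t then 0 else if u x \<le> t + \<eta> then 1 else 2) \<in> measurable M (count_space {0, 1, 2 :: nat})"
    by measurable
  then show ?thesis by (simp add: observables_def)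
qed

text \<open>The order of the choices is forced. Hamming radius and sparsity come from \<kappa>, then
  the gap \<eta> and the accuracy \<rho>, then the lattice scale \<open>L\<close>, which depends on
  f but on neither c nor s; then c, with l2 norm small against \<rho> / L; and only then s and
  \<delta>, whose quality may depend on c.\<close>

theorem tame_halfspace:
  assumes inv_H: "invariant_subspace G M (koopman G a) H"
    and sing: "singular_reps G M (koopman G a) H cntG (left_regular G) (L2 cntG)"
    and f: "f \<in> H"
  shows "tame (ind {x\<in>space M. Re (f x) \<le> t})"
  unfolding tame_def
proof (intro allI impI)
  fix \<kappa> :: real assume \<kappa>: "\<kappa> > 0"
  have fL2: "f \<in> L2 M" using inv_H f by (auto simp: invariant_subspace_def closed_subspace_def)
  have f_meas[measurable]: "f \<in> borel_measurable M" using L2D(1)[OF fL2] .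
  obtain \<eta>1 :: real where \<eta>1: "\<eta>1 > 0" and ball: "\<And>(J::nat set) (C'::nat set) y0. finite J \<Longrightarrow> finite C' \<Longrightarrow> real (card C') \<le> 2 \<Longrightarrow>
      real (card {y \<in> J \<rightarrow>\<^sub>E C'. real (card {j\<in>J. y j \<noteq> y0 j}) \<le> \<eta>1 * card J}) \<le> exp (\<kappa> / 2 * card J)"
    by (rule hamming_ball_entropy[of 2 "\<kappa> / 2"]) (use \<kappa> in auto)
  \<comment> \<open>The lattice has two integer coordinates per point, so \<kappa> / 4 here amounts
    to \<kappa> / 2 in total.\<close>
  obtain \<eta>2 :: real where \<eta>2: "\<eta>2 > 0" and lattice: "\<And>J::(nat \<times> bool) set. finite J \<Longrightarrow>
      finite {z \<in> J \<rightarrow>\<^sub>E (UNIV::int set). (\<Sum>j\<in>J. \<bar>real_of_int (z j)\<bar>) \<le> \<eta>2 * card J} \<and>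
      real (card {z \<in> J \<rightarrow>\<^sub>E (UNIV::int set). (\<Sum>j\<in>J. \<bar>real_of_int (z j)\<bar>) \<le> \<eta>2 * card J}) \<le> exp (\<kappa> / 4 * card J)"
    by (rule lattice_entropy[of "\<kappa> / 4"]) (use \<kappa> in auto)
  \<comment> \<open>Outside this strip the two sides of the level are separated by a gap \<eta>, so
    values known up to \<eta> / 4 decide the side.\<close>
  obtain \<eta> :: real where \<eta>: "\<eta> > 0" and strip: "measure M {x\<in>space M. t < Re (f x) \<and> Re (f x) \<le> t + \<eta>} < \<eta>1 / 8"
    using thin_strip[of "\<lambda>x. Re (f x)" "\<eta>1 / 8" t] \<eta>1 by auto
  \<comment> \<open>Two microstates with the same lattice vector will have squared distance at most
    16 \<rho>^2 d; by this choice at most (\<eta>1 / 4) d coordinates can then be \<eta> / 2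
    apart.\<close>
  define \<rho> where "\<rho> = sqrt \<eta>1 * \<eta> / 16"
  have \<rho>: "\<rho> > 0" and \<rho>2: "\<rho>\<^sup>2 = \<eta>1 * \<eta>\<^sup>2 / 256"
    using \<eta>1 \<eta> by (auto simp: \<rho>_def power_divide power_mult_distrib)
  \<comment> \<open>One unit plus the square bounds the mean of |s|, as the norm of s stays below
    that of f plus 1; the other unit absorbs the statistical error Q \<delta>.\<close>
  define R where "R = 2 + (L2_norm M f + 1)\<^sup>2"
  have R: "R > 0" unfolding R_def by (smt (verit) zero_le_power2)
  define L where "L = 2 * R / \<eta>2"
  have L: "L > 0" using R \<eta>2 by (simp add: L_def)
  \<comment> \<open>The first bound makes the columns short relative to the lattice scale, the
    second makes the residual of f small.\<close>
  define e where "e = min (\<rho> / (2 * L)) (\<rho> / 8)"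
  have e: "e > 0" using \<rho> L by (simp add: e_def)
  obtain F c where F: "finite F" "F \<subseteq> carrier G" and c: "(\<Sum>g\<in>F. (cmod (c g))\<^sup>2) < e\<^sup>2"
    and fc: "L2_norm M (\<lambda>x. f x - (\<Sum>g\<in>F. c g * f (a (inv g) x))) < e"
    using small_coefficients[OF inv_H sing f e] by blast
  define C where "C = (\<Sum>g\<in>F. cmod (c g))"
  have C: "C \<ge> 0" by (simp add: C_def sum_nonneg)
  \<comment> \<open>The 1 keeps the norm of s below that of f plus 1, on which \<open>R\<close>
    relies. The other bound pays for passing from f to s in the residual, at cost (1 + C)
    e3.\<close>
  define e3 where "e3 = min 1 (\<rho> / (8 * (1 + C)))"
  have e3: "e3 > 0" using \<rho> C by (simp add: e3_def)
  obtain s where s: "simple_function M s" "s \<in> L2 M" "L2_norm M (\<lambda>x. f x - s x) < e3"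
    using L2_simple_approx[OF fL2 e3] .
  obtain B1 \<beta>1 q1 where 1: "(B1, \<beta>1) \<in> observables M" "\<And>x. x \<in> space M \<Longrightarrow> q1 (\<beta>1 x) = s x"
    using simple_observable[OF s(1)] by blast
  \<comment> \<open>The exact position of f relative to the strip is recorded beside s, so that the
    indicator of the level set is a function of the joint observable.\<close>
  define lev :: "'x \<Rightarrow> nat" where "lev x = (if Re (f x) \<le> t then 0 else if Re (f x) \<le> t + \<eta> then 1 else 2)" for x
  have lev: "({0, 1, 2}, lev) \<in> observables M"
    using three_level_observable[of "\<lambda>x. Re (f x)" t \<eta>] by (simp add: lev_def[abs_def])
  let ?B = "prod_encode ` (B1 \<times> {0, 1, 2})" and ?\<beta> = "\<lambda>x. prod_encode (\<beta>1 x, lev x)"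
  have B: "(?B, ?\<beta>) \<in> observables M" using observables_pair[OF 1(1) lev] .
  define q where "q b = q1 (fst (prod_decode b))" for b
  define l where "l b = snd (prod_decode b)" for b
  define \<pi> :: "nat \<Rightarrow> nat" where "\<pi> b = (if l b = 0 then 1 else 0)" for b
  have q\<beta>: "q (?\<beta> x) = s x" if "x \<in> space M" for x using 1(2)[OF that] by (simp add: q_def)
  have l\<beta>: "l (?\<beta> x) = lev x" for x by (simp add: l_def)
  have lB: "l b \<in> {0, 1, 2}" if "b \<in> ?B" for b using that by (auto simp: l_def)
  define Q where "Q = (\<Sum>b\<in>?B. cmod (q b))"
  have Q: "Q \<ge> 0" by (simp add: Q_def sum_nonneg)
  have qQ: "cmod (q b) \<le> Q" if "b \<in> ?B" for b
    unfolding Q_def using that obs_finite[OF B] by (intro member_le_sum) auto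
  define X where "X = (Q * (1 + C))\<^sup>2 + (2 * Q * C)\<^sup>2 * card F"
  have X: "X \<ge> 0" by (simp add: X_def)
  \<comment> \<open>The three bounds serve the share of bad labels, the l1 bound \<open>R\<close>
    and the invariance estimate, in this order.\<close>
  define \<delta> where "\<delta> = min (\<eta>1 / 8) (min (1 / (Q + 1)) (\<rho>\<^sup>2 / (16 * (X + 1))))"
  have \<delta>: "\<delta> > 0" using \<eta>1 Q X \<rho> by (simp add: \<delta>_def add_nonneg_pos)
  let ?F = "insert \<one> F"
  have W: "window ?F" using F by (auto simp: window_def)

  have D: "(\<lambda>x. f x - s x) \<in> L2 M" using L2_diff[OF fL2 s(2)] .
  have trans_L2: "(\<lambda>x. c g * h (a (inv g) x)) \<in> L2 M \<and>
      L2_norm M (\<lambda>x. c g * h (a (inv g) x)) = cmod (c g) * L2_norm M h" if "g \<in> F" "h \<in> L2 M" for g h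
  proof -
    have g: "g \<in> carrier G" using that F by auto
    show ?thesis
      using L2_mult[OF koopman_L2[OF g that(2)], of "c g"] L2_norm_mult[of M "c g" "koopman G a g h"]
        koopman_norm[OF g that(2)] by (simp add: koopman_def)
  qed
  have sum_L2: "(\<lambda>x. \<Sum>g\<in>F. c g * h (a (inv g) x)) \<in> L2 M"
    "L2_norm M (\<lambda>x. \<Sum>g\<in>F. c g * h (a (inv g) x)) \<le> C * L2_norm M h" if "h \<in> L2 M" for h
    using L2_sum[OF F(1), of "\<lambda>g x. c g * h (a (inv g) x)" M] trans_L2[OF _ that]
    by (auto simp: C_def sum_distrib_right)
  let ?E1 = "\<lambda>x. f x - (\<Sum>g\<in>F. c g * f (a (inv g) x))" and ?E2 = "\<lambda>x. f x - s x"
    and ?E3 = "\<lambda>x. \<Sum>g\<in>F. c g * (f (a (inv g) x) - s (a (inv g) x))"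
  let ?E = "\<lambda>x. s x - (\<Sum>g\<in>F. c g * s (a (inv g) x))"
  have E1: "?E1 \<in> L2 M" using L2_diff[OF fL2 sum_L2(1)[OF fL2]] .
  have E3: "?E3 \<in> L2 M" "L2_norm M ?E3 \<le> C * L2_norm M ?E2" using sum_L2[OF D] by auto
  have mE2: "(\<lambda>x. (-1) * ?E2 x) \<in> L2 M" "L2_norm M (\<lambda>x. (-1) * ?E2 x) = L2_norm M ?E2"
    using L2_mult[OF D, of "-1"] L2_norm_mult[of M "-1" ?E2] by auto
  \<comment> \<open>The residual of s is that of f, corrected by the approximation error at x and at
    its translates.\<close>
  have E_eq: "?E = (\<lambda>x. (?E1 x + (-1) * ?E2 x) + ?E3 x)"
    by (rule ext) (simp add: right_diff_distrib sum_subtractf)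
  have "L2_norm M ?E \<le> L2_norm M ?E1 + L2_norm M ?E2 + L2_norm M ?E3"
    unfolding E_eq
    using L2_norm_triangle[OF L2_add[OF E1 mE2(1)] E3(1)] L2_norm_triangle[OF E1 mE2(1)] mE2(2) by linarith
  also have "\<dots> \<le> e + (e3 + C * e3)"
    using fc s(3) E3(2) mult_left_mono[OF less_imp_le[OF s(3)] C] by linarith
  also have "e3 + C * e3 \<le> \<rho> / 8"
  proof -
    have "e3 * (8 * (1 + C)) \<le> \<rho>" using C unfolding e3_def by (subst pos_le_divide_eq[symmetric]) auto
    then show ?thesis by (simp add: algebra_simps)
  qed
  also have "e \<le> \<rho> / 8" by (simp add: e_def)
  finally have E_norm: "L2_norm M ?E \<le> \<rho> / 4" by simp
  have "(\<integral>x. (cmod (q (?\<beta> x) - (\<Sum>g\<in>F. c g * q (?\<beta> (a (inv g) x)))))\<^sup>2 \<partial>M) = (L2_norm M ?E)\<^sup>2"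
    unfolding L2_norm_def
  proof (subst real_sqrt_pow2)
    show "0 \<le> (\<integral>x. (cmod (?E x))\<^sup>2 \<partial>M)" by simp
    show "(\<integral>x. (cmod (q (?\<beta> x) - (\<Sum>g\<in>F. c g * q (?\<beta> (a (inv g) x)))))\<^sup>2 \<partial>M) = (\<integral>x. (cmod (?E x))\<^sup>2 \<partial>M)"
    proof (rule Bochner_Integration.integral_cong[OF refl])
      fix x assume x: "x \<in> space M"
      have "(\<Sum>g\<in>F. c g * q (?\<beta> (a (inv g) x))) = (\<Sum>g\<in>F. c g * s (a (inv g) x))"
        using F x by (intro sum.cong refl) (auto simp: q\<beta> act_space subset_iff)
      then show "(cmod (q (?\<beta> x) - (\<Sum>g\<in>F. c g * q (?\<beta> (a (inv g) x)))))\<^sup>2 = (cmod (?E x))\<^sup>2"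
        using q\<beta>[OF x] by simp
    qed
  qed
  also have "\<dots> \<le> (\<rho> / 4)\<^sup>2" using E_norm by (intro power_mono) (auto simp: L2_norm_def)
  finally have I: "(\<integral>x. (cmod (q (?\<beta> x) - (\<Sum>g\<in>F. c g * q (?\<beta> (a (inv g) x)))))\<^sup>2 \<partial>M) \<le> \<rho>\<^sup>2 / 16"
    by (simp add: power_divide)

  \<comment> \<open>A label is bad if it lies in the strip or if its value contradicts its level.
    Good labels of different levels have real parts at least \<eta> / 2 apart.\<close>
  define bad where "bad b \<longleftrightarrow> l b = 1 \<or> (l b = 0 \<and> Re (q b) > t + \<eta> / 4) \<or> (l b = 2 \<and> Re (q b) < t + 3 * \<eta> / 4)" for b
  have bad: "measure M {x\<in>space M. bad (?\<beta> x)} \<le> \<eta>1 / 4"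
  proof -
    let ?S1 = "{x\<in>space M. t < Re (f x) \<and> Re (f x) \<le> t + \<eta>}" and ?S2 = "{x\<in>space M. cmod (f x - s x) \<ge> \<eta> / 4}"
    have [measurable]: "s \<in> borel_measurable M" using L2D(1)[OF s(2)] .
    have S: "?S1 \<in> sets M" "?S2 \<in> sets M" by measurable
    have "{x\<in>space M. bad (?\<beta> x)} \<subseteq> ?S1 \<union> ?S2"
    proof
      fix x assume "x \<in> {x\<in>space M. bad (?\<beta> x)}"
      then have x: "x \<in> space M" and b: "bad (?\<beta> x)" by auto
      have "\<bar>Re (f x) - Re (s x)\<bar> \<le> cmod (f x - s x)" using abs_Re_le_cmod[of "f x - s x"] by simp
      moreover have "lev x = 1 \<or> (lev x = 0 \<and> Re (s x) > t + \<eta> / 4) \<or> (lev x = 2 \<and> Re (s x) < t + 3 * \<eta> / 4)"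
        using b by (simp only: bad_def l\<beta> q\<beta>[OF x])
      ultimately show "x \<in> ?S1 \<union> ?S2" using x unfolding lev_def by (auto split: if_split_asm)
    qed
    then have "measure M {x\<in>space M. bad (?\<beta> x)} \<le> measure M (?S1 \<union> ?S2)"
      using S by (intro finite_measure_mono) auto
    also have "\<dots> \<le> measure M ?S1 + measure M ?S2" using S by (intro measure_Un_le) auto
    also have "measure M ?S2 \<le> (L2_norm M (\<lambda>x. f x - s x))\<^sup>2 / (\<eta> / 4)\<^sup>2"
      using \<eta> by (intro chebyshev_L2 D) auto
    also have "\<dots> \<le> \<rho>\<^sup>2 / (\<eta> / 4)\<^sup>2"
    proof (intro divide_right_mono power_mono)
      have "\<rho> / (8 * (1 + C)) \<le> \<rho> / 1" using \<rho> C by (intro divide_left_mono) auto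
      then show "L2_norm M (\<lambda>x. f x - s x) \<le> \<rho>" using s(3) unfolding e3_def by linarith
    qed (auto simp: L2_norm_def)
    also have "\<dots> = \<eta>1 / 16" using \<eta> by (simp add: \<rho>2 power_divide)
    finally show ?thesis using strip \<eta>1 by linarith
  qed

  have "\<forall>\<^sub>F i in sequentially. real (card (micro ?B ?\<beta> \<pi> ?F \<delta> i)) \<le> exp (\<kappa> * d i)"
    using column_bound[OF F c]
  proof eventually_elim
    case (elim i)
    let ?J = "{1..d i}" and ?P = "{1..d i} \<times> (UNIV::bool set)"
    let ?t = "column F c i"
    let ?v = "\<lambda>\<phi> j. q (\<phi> j \<one>)" and ?AP = "AP G M a ?B ?\<beta> ?F \<delta> (d i) (\<sigma> i)"
    let ?Tv = "\<lambda>\<phi> k. \<Sum>j\<in>?J. q (\<phi> j \<one>) * ?t j k"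
    let ?Z = "{z \<in> ?P \<rightarrow>\<^sub>E (UNIV::int set). (\<Sum>p\<in>?P. \<bar>real_of_int (z p)\<bar>) \<le> \<eta>2 * card ?P}"
    \<comment> \<open>A labelling does not determine its microstate, so it is attached to z through
      some microstate that induces it.\<close>
    define Pr where "Pr y z \<longleftrightarrow> (\<exists>\<phi>\<in>?AP. y = (\<lambda>j\<in>?J. \<pi> (\<phi> j \<one>)) \<and>
      (\<Sum>k\<in>?J. (cmod (lattice_vector L (d i) ?t z k - ?Tv \<phi> k))\<^sup>2) \<le> \<rho>\<^sup>2 * d i)" for y z
    have \<phi>B: "\<phi> j \<one> \<in> ?B" if "\<phi> \<in> ?AP" "j \<in> ?J" for \<phi> j
      using AP_D(1)[OF that(1)] that(2) by (meson PiE_mem insertI1)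
    have near: "(\<Sum>k\<in>?J. (cmod (?v \<phi> k - ?Tv \<phi> k))\<^sup>2) \<le> \<rho>\<^sup>2 * d i" if \<phi>: "\<phi> \<in> ?AP" for \<phi>
    proof -
      have "(\<Sum>k\<in>?J. (cmod (?v \<phi> k - ?Tv \<phi> k))\<^sup>2)
          \<le> 2 * (\<rho>\<^sup>2 / 16 + (Q * (1 + C))\<^sup>2 * \<delta> + (2 * Q * C)\<^sup>2 * card F * \<delta>) * d i"
        using micro_invariance[OF B F qQ Q \<phi> \<delta> I] unfolding C_def by simp
      also have "\<dots> = 2 * (\<rho>\<^sup>2 / 16 + X * \<delta>) * d i" by (simp add: X_def algebra_simps)
      also have "\<dots> \<le> \<rho>\<^sup>2 * d i"
      proof (rule mult_right_mono)
        have "X * \<delta> \<le> X * (\<rho>\<^sup>2 / (16 * (X + 1)))" using X by (intro mult_left_mono) (auto simp: \<delta>_def)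
        also have "\<dots> = X / (X + 1) * (\<rho>\<^sup>2 / 16)" by simp
        also have "\<dots> \<le> 1 * (\<rho>\<^sup>2 / 16)" using X by (intro mult_right_mono) auto
        finally have "2 * (\<rho>\<^sup>2 / 16 + X * \<delta>) \<le> \<rho>\<^sup>2 / 4" by simp
        also have "\<dots> \<le> \<rho>\<^sup>2" by simp
        finally show "2 * (\<rho>\<^sup>2 / 16 + X * \<delta>) \<le> \<rho>\<^sup>2" .
      qed simp
      finally show ?thesis .
    qed
    \<comment> \<open>The l1 norm of v / L is what limits the l1 norm of the rounded integer
      vector.\<close>
    have l1: "(\<Sum>j\<in>?J. cmod (?v \<phi> j)) \<le> R * d i" if \<phi>: "\<phi> \<in> ?AP" for \<phi>
    proof -
      have "(\<Sum>j\<in>?J. cmod (q (\<phi> j \<one>))) \<le> ((\<integral>x. cmod (q (pat ?\<beta> ?F x \<one>)) \<partial>M) + Q * \<delta>) * d i"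
        by (rule AP_expectation[OF B W d_pos \<phi>, of "\<lambda>b. cmod (q (b \<one>))" Q])
          (use qQ Q in \<open>auto simp: PiE_iff\<close>)
      also have "(\<integral>x. cmod (q (pat ?\<beta> ?F x \<one>)) \<partial>M) = (\<integral>x. cmod (s x) \<partial>M)"
        using pat_one[OF W] q\<beta> by (intro Bochner_Integration.integral_cong) auto
      also have "(\<dots> + Q * \<delta>) * d i \<le> R * d i"
      proof (rule mult_right_mono)
        have "L2_norm M s \<le> L2_norm M f + L2_norm M (\<lambda>x. (-1) * ?E2 x)"
          using L2_norm_triangle[OF fL2 mE2(1)] by simp
        also have "\<dots> \<le> L2_norm M f + 1" using mE2(2) s(3) by (simp add: e3_def)
        finally have "(L2_norm M s)\<^sup>2 \<le> (L2_norm M f + 1)\<^sup>2" by (intro power_mono) (auto simp: L2_norm_def)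
        then have 1: "(\<integral>x. cmod (s x) \<partial>M) \<le> 1 + (L2_norm M f + 1)\<^sup>2" using integral_cmod_le[OF s(2)] by linarith
        have "Q * \<delta> \<le> Q * (1 / (Q + 1))" using Q by (intro mult_left_mono) (auto simp: \<delta>_def)
        also have "\<dots> \<le> 1" using Q by simp
        finally show "(\<integral>x. cmod (s x) \<partial>M) + Q * \<delta> \<le> R" using 1 by (simp add: R_def)
      qed simp
      finally show ?thesis .
    qed
    have col: "(\<Sum>j\<in>?J. \<Sum>k\<in>?J. (cmod (?t j k))\<^sup>2) \<le> \<rho>\<^sup>2 / L\<^sup>2 * d i"
    proof -
      have "e\<^sup>2 \<le> (\<rho> / (2 * L))\<^sup>2" using e by (intro power_mono) (auto simp: e_def)
      then have "2 * e\<^sup>2 \<le> \<rho>\<^sup>2 / L\<^sup>2 / 2" by (simp add: power_divide power_mult_distrib)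
      also have "\<dots> \<le> \<rho>\<^sup>2 / L\<^sup>2 / 1" by (rule divide_left_mono) auto
      finally have "2 * e\<^sup>2 \<le> \<rho>\<^sup>2 / L\<^sup>2" by simp
      then have "2 * e\<^sup>2 * d i \<le> \<rho>\<^sup>2 / L\<^sup>2 * d i" by (intro mult_right_mono) auto
      then show ?thesis using elim by linarith
    qed
    have bad_card: "real (card {j\<in>?J. bad (\<phi> j \<one>)}) \<le> 3 / 8 * \<eta>1 * d i" if \<phi>: "\<phi> \<in> ?AP" for \<phi>
    proof -
      have "real (card {j\<in>?J. bad (\<phi> j \<one>)}) \<le> (measure M {x\<in>space M. bad (?\<beta> x)} + \<delta>) * d i"
        by (rule AP_count[OF B W d_pos \<phi>])
      also have "\<dots> \<le> 3 / 8 * \<eta>1 * d i"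
      proof (rule mult_right_mono)
        have "\<delta> \<le> \<eta>1 / 8" unfolding \<delta>_def by (rule min.cobounded1)
        then show "measure M {x\<in>space M. bad (?\<beta> x)} + \<delta> \<le> 3 / 8 * \<eta>1" using bad by linarith
      qed simp
      finally show ?thesis .
    qed
    have fin: "finite ?Z" and Zcard: "real (card ?Z) \<le> exp (\<kappa> / 4 * card ?P)" using lattice[of ?P] by auto
    have "real (card (micro ?B ?\<beta> \<pi> ?F \<delta> i)) \<le> real (card ?Z) * exp (\<kappa> / 2 * d i)"
    proof (rule card_le_classes[where J = ?J and C = "{0, 1}" and P = Pr and m = "\<eta>1 * d i"])
      show "micro ?B ?\<beta> \<pi> ?F \<delta> i \<subseteq> ?J \<rightarrow>\<^sub>E {0, 1}" by (auto simp: micro_def \<pi>_def split: if_split_asm)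
      show "finite ?Z" by (rule fin)
      show "finite (?J \<rightarrow>\<^sub>E {0, 1::nat})" by (intro finite_PiE) auto
      show "real (card {y \<in> ?J \<rightarrow>\<^sub>E {0, 1::nat}. real (card {j\<in>?J. y j \<noteq> y0 j}) \<le> \<eta>1 * d i}) \<le> exp (\<kappa> / 2 * d i)" for y0
        using ball[of ?J "{0, 1}" y0] by simp
    next
      fix y assume "y \<in> micro ?B ?\<beta> \<pi> ?F \<delta> i"
      then obtain \<phi> where \<phi>: "\<phi> \<in> ?AP" "y = (\<lambda>j\<in>?J. \<pi> (\<phi> j \<one>))" unfolding micro_def by auto
      obtain z where "z \<in> ?P \<rightarrow>\<^sub>E (UNIV::int set)" "(\<Sum>p\<in>?P. \<bar>real_of_int (z p)\<bar>) \<le> \<eta>2 * card ?P"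
        "(\<Sum>k\<in>?J. (cmod (lattice_vector L (d i) ?t z k - ?Tv \<phi> k))\<^sup>2) \<le> \<rho>\<^sup>2 * d i"
        by (rule rounding_complex[OF \<eta>2 R \<rho> L_def col l1[OF \<phi>(1)]])
      then show "\<exists>z\<in>?Z. Pr y z" using \<phi> unfolding Pr_def by (intro bexI[of _ z] bexI[of _ \<phi>]) auto
    next
      fix y y' z assume "Pr y z" "Pr y' z"
      then obtain \<phi> \<psi> where \<phi>: "\<phi> \<in> ?AP" "y = (\<lambda>j\<in>?J. \<pi> (\<phi> j \<one>))"
          "(\<Sum>k\<in>?J. (cmod (lattice_vector L (d i) ?t z k - ?Tv \<phi> k))\<^sup>2) \<le> \<rho>\<^sup>2 * d i"
        and \<psi>: "\<psi> \<in> ?AP" "y' = (\<lambda>j\<in>?J. \<pi> (\<psi> j \<one>))"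
          "(\<Sum>k\<in>?J. (cmod (lattice_vector L (d i) ?t z k - ?Tv \<psi> k))\<^sup>2) \<le> \<rho>\<^sup>2 * d i"
        unfolding Pr_def by blast
      let ?W = "lattice_vector L (d i) ?t z"
      \<comment> \<open>The two microstates are joined through their images under T and the common
        lattice vector: four differences, each of mean square at most \<rho>^2.\<close>
      have "(\<Sum>k\<in>?J. (cmod (?v \<phi> k - ?v \<psi> k))\<^sup>2) \<le> (\<Sum>k\<in>?J. 4 * ((cmod (?v \<phi> k - ?Tv \<phi> k))\<^sup>2
          + (cmod (?W k - ?Tv \<phi> k))\<^sup>2 + (cmod (?W k - ?Tv \<psi> k))\<^sup>2 + (cmod (?v \<psi> k - ?Tv \<psi> k))\<^sup>2))"
      proof (rule sum_mono)
        fix k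
        have "?v \<phi> k - ?v \<psi> k = (?v \<phi> k - ?Tv \<phi> k) + (- (?W k - ?Tv \<phi> k)) + (?W k - ?Tv \<psi> k) + (- (?v \<psi> k - ?Tv \<psi> k))"
          by simp
        then show "(cmod (?v \<phi> k - ?v \<psi> k))\<^sup>2 \<le> 4 * ((cmod (?v \<phi> k - ?Tv \<phi> k))\<^sup>2
          + (cmod (?W k - ?Tv \<phi> k))\<^sup>2 + (cmod (?W k - ?Tv \<psi> k))\<^sup>2 + (cmod (?v \<psi> k - ?Tv \<psi> k))\<^sup>2)"
          using cmod_sum4_sq_le[of "?v \<phi> k - ?Tv \<phi> k" "- (?W k - ?Tv \<phi> k)" "?W k - ?Tv \<psi> k" "- (?v \<psi> k - ?Tv \<psi> k)"]
          unfolding norm_minus_cancel by metis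
      qed
      also have "\<dots> \<le> 4 * (\<rho>\<^sup>2 * d i + \<rho>\<^sup>2 * d i + \<rho>\<^sup>2 * d i + \<rho>\<^sup>2 * d i)"
        unfolding sum_distrib_left[symmetric] sum.distrib
        using near[OF \<phi>(1)] near[OF \<psi>(1)] \<phi>(3) \<psi>(3) by (intro mult_left_mono add_mono) auto
      also have "\<dots> = \<eta>1 * \<eta>\<^sup>2 / 16 * d i" by (simp add: \<rho>2)
      finally have dist: "(\<Sum>k\<in>?J. (cmod (?v \<phi> k - ?v \<psi> k))\<^sup>2) \<le> \<eta>1 * \<eta>\<^sup>2 / 16 * d i" .
      let ?far = "{j\<in>?J. cmod (?v \<phi> j - ?v \<psi> j) \<ge> \<eta> / 2}"
      have "(\<eta> / 2)\<^sup>2 * card ?far = (\<Sum>j\<in>?far. (\<eta> / 2)\<^sup>2)" by simp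
      also have "\<dots> \<le> (\<Sum>j\<in>?far. (cmod (?v \<phi> j - ?v \<psi> j))\<^sup>2)" using \<eta> by (intro sum_mono power_mono) auto
      also have "\<dots> \<le> (\<Sum>j\<in>?J. (cmod (?v \<phi> j - ?v \<psi> j))\<^sup>2)" by (intro sum_mono2) auto
      also note dist
      also have "\<eta>1 * \<eta>\<^sup>2 / 16 * d i = (\<eta> / 2)\<^sup>2 * (\<eta>1 / 4 * d i)" by (simp add: power_divide)
      finally have "(\<eta> / 2)\<^sup>2 * card ?far \<le> (\<eta> / 2)\<^sup>2 * (\<eta>1 / 4 * d i)" .
      then have far: "card ?far \<le> \<eta>1 / 4 * d i" by (rule mult_left_le_imp_le) (use \<eta> in simp)
      \<comment> \<open>Good labels that induce different values belong to different levels, hence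
        their values under \<open>q\<close> are far apart.\<close>
      have "{j\<in>?J. y j \<noteq> y' j} \<subseteq> ({j\<in>?J. bad (\<phi> j \<one>)} \<union> {j\<in>?J. bad (\<psi> j \<one>)}) \<union> ?far"
      proof
        fix j assume "j \<in> {j\<in>?J. y j \<noteq> y' j}"
        then have j: "j \<in> ?J" and ne: "\<pi> (\<phi> j \<one>) \<noteq> \<pi> (\<psi> j \<one>)" using \<phi>(2) \<psi>(2) by auto
        have ll: "l (\<phi> j \<one>) \<in> {0, 1, 2}" "l (\<psi> j \<one>) \<in> {0, 1, 2}" using lB \<phi>B \<phi>(1) \<psi>(1) j by blast+
        have "\<eta> / 2 \<le> cmod (?v \<phi> j - ?v \<psi> j)" if nb: "\<not> bad (\<phi> j \<one>)" "\<not> bad (\<psi> j \<one>)"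
        proof -
          have "\<bar>Re (?v \<phi> j) - Re (?v \<psi> j)\<bar> \<le> cmod (?v \<phi> j - ?v \<psi> j)"
            using abs_Re_le_cmod[of "?v \<phi> j - ?v \<psi> j"] by simp
          moreover have "(Re (?v \<phi> j) \<le> t + \<eta> / 4 \<and> Re (?v \<psi> j) \<ge> t + 3 * \<eta> / 4) \<or>
              (Re (?v \<psi> j) \<le> t + \<eta> / 4 \<and> Re (?v \<phi> j) \<ge> t + 3 * \<eta> / 4)"
            using nb ne ll by (auto simp: bad_def \<pi>_def not_less split: if_split_asm)
          then have "Re (?v \<psi> j) - Re (?v \<phi> j) \<ge> \<eta> / 2 \<or> Re (?v \<phi> j) - Re (?v \<psi> j) \<ge> \<eta> / 2"
            by (elim disjE conjE) (simp_all add: field_simps)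
          ultimately show ?thesis by linarith
        qed
        then show "j \<in> ({j\<in>?J. bad (\<phi> j \<one>)} \<union> {j\<in>?J. bad (\<psi> j \<one>)}) \<union> ?far" using j by auto
      qed
      then have "card {j\<in>?J. y j \<noteq> y' j} \<le> card (({j\<in>?J. bad (\<phi> j \<one>)} \<union> {j\<in>?J. bad (\<psi> j \<one>)}) \<union> ?far)"
        by (intro card_mono) auto
      also have "\<dots> \<le> card ({j\<in>?J. bad (\<phi> j \<one>)} \<union> {j\<in>?J. bad (\<psi> j \<one>)}) + card ?far" by (rule card_Un_le)
      also have "\<dots> \<le> (card {j\<in>?J. bad (\<phi> j \<one>)} + card {j\<in>?J. bad (\<psi> j \<one>)}) + card ?far"
        by (intro add_right_mono card_Un_le)
      finally have "real (card {j\<in>?J. y j \<noteq> y' j})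
        \<le> real (card {j\<in>?J. bad (\<phi> j \<one>)}) + real (card {j\<in>?J. bad (\<psi> j \<one>)}) + real (card ?far)" by linarith
      \<comment> \<open>The shares add up: 3/8 + 3/8 + 1/4 = 1.\<close>
      also have "\<dots> \<le> \<eta>1 * d i" using bad_card[OF \<phi>(1)] bad_card[OF \<psi>(1)] far by (simp add: algebra_simps)
      finally show "real (card {j\<in>?J. y j \<noteq> y' j}) \<le> \<eta>1 * d i" .
    qed
    also have "\<dots> \<le> exp (\<kappa> / 4 * card ?P) * exp (\<kappa> / 2 * d i)" using Zcard by (intro mult_right_mono) auto
    also have "\<dots> = exp (\<kappa> * d i)" by (simp add: exp_add[symmetric] card_cartesian_product)
    finally show ?case .
  qed
  moreover have "\<pi> (?\<beta> x) = ind {x\<in>space M. Re (f x) \<le> t} x" if "x \<in> space M" for x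
  proof -
    have "lev x = 0 \<longleftrightarrow> Re (f x) \<le> t" using \<eta> by (simp add: lev_def)
    then show ?thesis using that unfolding \<pi>_def l\<beta> by simp
  qed
  ultimately show "\<exists>B \<beta> \<pi> F \<delta>. (B, \<beta>) \<in> observables M \<and> (\<forall>x\<in>space M. \<pi> (\<beta> x) = ind {x\<in>space M. Re (f x) \<le> t} x) \<and>
      window F \<and> \<delta> > 0 \<and> (\<forall>\<^sub>F i in sequentially. real (card (micro B \<beta> \<pi> F \<delta> i)) \<le> exp (\<kappa> * d i))"
    using B W \<delta> by (intro exI[of _ ?B] exI[of _ ?\<beta>] exI[of _ \<pi>] exI[of _ ?F] exI[of _ \<delta>]) simp
qed

end

section \<open>Passage from half-planes to the whole sigma-algebra\<close>

theorem theorem1p1: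
  fixes G :: "('g, 'z) monoid_scheme"
    and d :: "nat \<Rightarrow> nat" and \<sigma> :: "nat \<Rightarrow> 'g \<Rightarrow> nat \<Rightarrow> nat"
    and M :: "'x measure" and a :: "'g \<Rightarrow> 'x \<Rightarrow> 'x"
    and H :: "('x \<Rightarrow> complex) set"
  assumes "group G" and "countable (carrier G)" and "infinite (carrier G)"
    and "sofic_approximation G d \<sigma>"
    and "standard_probability_space M"
    and "measure_preserving_action G M a"
    and "invariant_subspace G M (koopman G a) H"
    and "generates_mod_null M H"
    and "singular_reps G M (koopman G a) H
           (count_space (carrier G)) (left_regular G) (L2 (count_space (carrier G)))"
  shows "sofic_entropy G d \<sigma> M a \<le> 0"
proof -
  interpret group G by fact
  interpret prob_space M using assms(5) by (simp add: standard_probability_space_def)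
  interpret sofic_pmp G M a d \<sigma> by unfold_locales fact+
  note inv_H = assms(7)
  have HM: "f \<in> borel_measurable M" if "f \<in> H" for f
    using inv_H that L2D(1) by (auto simp: invariant_subspace_def closed_subspace_def)
  have mult: "(\<lambda>x. c * f x) \<in> H" if "f \<in> H" for c f
    using inv_H that by (simp add: invariant_subspace_def closed_subspace_def)
  have gen: "f -` A \<inter> space M \<in> sets M \<and> tame (ind (f -` A \<inter> space M))"
    if f: "f \<in> H" and A: "A \<in> sets borel" for f :: "'x \<Rightarrow> complex" and A
  proof -
    let ?E = "(\<lambda>(t, i). {z :: complex. z \<bullet> i \<le> t}) ` (UNIV \<times> Basis)"
    have "A \<in> sigma_sets UNIV ?E" using A by (subst (asm) borel_eq_halfspace_le) simp
    then show ?thesis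
    proof (induction rule: sigma_sets.induct)
      case (Basic S)
      then obtain t i where S: "S = {z. z \<bullet> i \<le> t}" "i \<in> Basis" by auto
      \<comment> \<open>Multiplying f by the conjugate of i, which keeps it in \<open>H\<close>,
        turns the imaginary part into a real part, so level sets of real parts suffice.\<close>
      have "z \<bullet> i = Re (cnj i * z)" for z by (simp add: inner_complex_def)
      then have "f -` S \<inter> space M = {x\<in>space M. Re (cnj i * f x) \<le> t}" by (auto simp: S)
      then show ?case
        using tame_halfspace[OF inv_H assms(9) mult[OF f, of "cnj i"], of t]
          measurable_sets[OF HM[OF f], of S] by (simp add: S)
    next
      case Empty
      show ?case using tame_cong[OF _ tame_const[of 0]] by simp
    next
      case (Compl S)
      have "f -` (UNIV - S) \<inter> space M = space M - f -` S \<inter> space M" by auto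
      then show ?case using Compl.IH tame_compl[of "f -` S \<inter> space M"] by auto
    next
      case (Union S)
      have "f -` (\<Union>i. S i) \<inter> space M = (\<Union>i. f -` S i \<inter> space M)" by auto
      moreover have "(\<Union>i. f -` S i \<inter> space M) \<in> sets M" using Union.IH by (intro sets.countable_UN) auto
      moreover have "tame (ind (\<Union>i. f -` S i \<inter> space M))" using Union.IH by (intro tame_UN) auto
      ultimately show ?case by (simp only:)
    qed
  qed
  show ?thesis
  proof (rule entropy_nonpos)
    fix S assume S: "S \<in> sets M"
    then obtain S' where S': "S' \<in> sigma_sets (space M) {f -` A \<inter> space M | f A. f \<in> H \<and> A \<in> sets borel}"
      "(S - S') \<union> (S' - S) \<in> null_sets M"
      using assms(8) unfolding generates_mod_null_def by blast
    have "tame (ind S')" using tame_sigma_sets[OF _ S'(1)] gen by blast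
    then show "tame (ind S)" using tame_null[OF S _ S'(2)] by blast
  qed
qed

end
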